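(* Let $E$ be an arbitrary directed graph, let $K$ be a field, and let $L := L_K(E)$ be the Leavitt path algebra of $E$ over $K$. Then the following properties are equivalent for a prime ideal $P$ of $L$: (a) $P$ is locally closed; (b) $P$ is completely irreducible; (c) there is an element $a \in L$ such that $P$ is maximal (among ideals of $L$) with respect to the property that $a \notin P$; (d) $P$ is strongly primitive.
   Context: Ideals are two-sided. A directed graph $E=(E^0,E^1,r,s)$ consists of sets $E^0$ (vertices), $E^1$ (edges) and maps $r,s:E^1\to E^0$; no cardinality restrictions are imposed (on the number of vertices, or on the number of edges emitted by a vertex). A vertex is regular if it emits a non-empty finite set of edges, and an infinite emitter if it emits infinitely many edges. A path of length $n>0$ is a sequence of edges $\mu=e_1\cdots e_n$ with $r(e_i)=s(e_{i+1})$; vertices are paths of length $0$. Write $u\ge v$ if there is a path from $u$ to $v$. A path $e_1\cdots e_n$ of positive length is closed if $r(e_n)=s(e_1)$, and a closed path is a cycle if $s(e_i)\ne s(e_j)$ for $i\neq j$. An exit for $e_1\cdots e_n$ is an edge $f$ with $s(f)=s(e_i)$ and $f\ne e_i$ for some $i$. $E$ satisfies Condition (L) if every cycle in $E$ has an exit in $E$. A non-empty set $D$ of vertices is downward directed if for all $u,v\in D$ there is $w\in D$ with $u\ge w$ and $v\ge w$; a graph is downward directed if its vertex set is. A set $H\subseteq E^0$ is hereditary if $v\in H$, $v\ge w$ imply $w\in H$; it is saturated if for every regular vertex $v$, $r(s^{-1}(v))\subseteq H$ implies $v\in H$. Leavitt path algebra: $L_K(E)$ is the $K$-algebra (not necessarily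 unital) generated by pairwise orthogonal idempotents $\{v: v\in E^0\}$ and elements $\{e,e^*: e\in E^1\}$ subject to: $s(e)e=e=e\,r(e)$; $r(e)e^*=e^*=e^*s(e)$; $e^*e=r(e)$ and $e^*f=0$ for $e\ne f$ in $E^1$; and $v=\sum_{s(e)=v}ee^*$ for every regular vertex $v$. It is $\mathbb{Z}$-graded by $\deg v=0$, $\deg e=1$, $\deg e^*=-1$. An ideal $I$ is graded if $I=\bigoplus_n (I\cap L_n)$; $gr(P)$ denotes the graded part of $P$, i.e. the largest graded ideal contained in $P$. Admissible pairs and quotient graphs: for a hereditary saturated $H$, a breaking vertex of $H$ is an infinite emitter $w\in E^0\setminus H$ with $0<|s^{-1}(w)\cap r^{-1}(E^0\setminus H)|<\infty$; $B_H$ is the set of breaking vertices. For $v\in B_H$, $v^H:=v-\sum_{s(e)=v,\ r(e)\notin H}ee^*$. For $S\subseteq B_H$, $(H,S)$ is an admissible pair and $I(H,S)$ is the ideal generated by $H\cup\{v^H:v\in S\}$. The graded ideals of $L_K(E)$ are precisely the ideals $I(H,S)$. The quotient graph $E\setminus(H,S)$ has vertex set $(E^0\setminus H)\cup\{v':v\in B_H\setminus S\}$ and edge set $\{e\in E^1:r(e)\notin H\}\cup\{e':e\in E^1,\ r(e)\in B_H\setminus S\}$, with $r,s$ extended by $s(e')=s(e)$, $r(e')=r(e)'$. Strong CSP: a graph $E$ satisfies the strong CSP if there is a countable set $S\subseteq E^0$ such that for every $u\in E^0$ there is $v\in S$ with $u\ge v$, and $S$ is contained in every non-empty hereditary saturated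 subset of $E^0$. Strongly primitive: an ideal $P$ of $L_K(E)$ with graded part $gr(P)=I(H,S)$ is strongly primitive if the quotient graph $E\setminus(H,S)$ is downward directed and satisfies both Condition (L) and the strong CSP; in addition, every non-graded prime ideal of $L_K(E)$ is regarded as strongly primitive. Locally closed: a prime ideal $P$ of a ring $R$ is locally closed if $P$ is not the intersection of all the prime ideals of $R$ properly containing $P$. Completely irreducible: an ideal $I$ of a ring $R$ is completely irreducible if $I$ is not the intersection of all the ideals of $R$ properly containing $I$. (The intersection of an empty family of ideals of $R$ is $R$.) *)

theory Defs
  imports "HOL-Library.Poly_Mapping" "HOL-Library.Countable_Set" "HOL-Algebra.QuotRing"
    "Graph_Theory.Arc_Walk"
begin

section \<open>Directed graphs\<close>

text \<open>
  A directed graph is a \<^locale>\<open>wf_digraph\<close>, with \<open>s = tail\<close> and \<open>r = head\<close>; \<open>u \<ge> v\<close> is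
  \<^const>\<open>reachable\<close>, \<open>s\<^sup>-\<^sup>1(v)\<close> is \<^const>\<open>out_arcs\<close>, and cycles (loops included) are
  \<^const>\<open>pre_digraph.cycle\<close>.
\<close>

definition regular_vertex :: "('v,'e) pre_digraph \<Rightarrow> 'v \<Rightarrow> bool" where
  "regular_vertex G v \<longleftrightarrow> v \<in> verts G \<and> finite (out_arcs G v) \<and> out_arcs G v \<noteq> {}"

definition infinite_emitter :: "('v,'e) pre_digraph \<Rightarrow> 'v \<Rightarrow> bool" where
  "infinite_emitter G v \<longleftrightarrow> v \<in> verts G \<and> infinite (out_arcs G v)"

definition has_exit :: "('v,'e) pre_digraph \<Rightarrow> 'e list \<Rightarrow> bool" where
  "has_exit G p \<longleftrightarrow> (\<exists>f\<in>arcs G. \<exists>e\<in>set p. tail G f = tail G e \<and> f \<noteq> e)"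

definition condition_L :: "('v,'e) pre_digraph \<Rightarrow> bool" where
  "condition_L G \<longleftrightarrow> (\<forall>p. pre_digraph.cycle G p \<longrightarrow> has_exit G p)"

definition downward_directed_set :: "('v,'e) pre_digraph \<Rightarrow> 'v set \<Rightarrow> bool" where
  "downward_directed_set G D \<longleftrightarrow> D \<noteq> {} \<and> D \<subseteq> verts G \<and>
     (\<forall>u\<in>D. \<forall>v\<in>D. \<exists>w\<in>D. u \<rightarrow>\<^sup>*\<^bsub>G\<^esub> w \<and> v \<rightarrow>\<^sup>*\<^bsub>G\<^esub> w)"

definition downward_directed :: "('v,'e) pre_digraph \<Rightarrow> bool" where
  "downward_directed G \<longleftrightarrow> downward_directed_set G (verts G)"

definition hereditary :: "('v,'e) pre_digraph \<Rightarrow> 'v set \<Rightarrow> bool" where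
  "hereditary G H \<longleftrightarrow> H \<subseteq> verts G \<and> (\<forall>v\<in>H. \<forall>w. v \<rightarrow>\<^sup>*\<^bsub>G\<^esub> w \<longrightarrow> w \<in> H)"

definition saturated :: "('v,'e) pre_digraph \<Rightarrow> 'v set \<Rightarrow> bool" where
  "saturated G H \<longleftrightarrow> H \<subseteq> verts G \<and>
     (\<forall>v. regular_vertex G v \<longrightarrow> head G ` out_arcs G v \<subseteq> H \<longrightarrow> v \<in> H)"

definition strong_CSP :: "('v,'e) pre_digraph \<Rightarrow> bool" where
  "strong_CSP G \<longleftrightarrow> (\<exists>S. S \<subseteq> verts G \<and> countable S \<and>
     (\<forall>u\<in>verts G. \<exists>v\<in>S. u \<rightarrow>\<^sup>*\<^bsub>G\<^esub> v) \<and>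
     (\<forall>H. H \<noteq> {} \<longrightarrow> hereditary G H \<longrightarrow> saturated G H \<longrightarrow> S \<subseteq> H))"

definition breaking_vertices :: "('v,'e) pre_digraph \<Rightarrow> 'v set \<Rightarrow> 'v set" where
  "breaking_vertices G H = {w \<in> verts G - H. infinite_emitter G w \<and>
     finite {e \<in> out_arcs G w. head G e \<notin> H} \<and> {e \<in> out_arcs G w. head G e \<notin> H} \<noteq> {}}"

definition admissible_pair :: "('v,'e) pre_digraph \<Rightarrow> 'v set \<Rightarrow> 'v set \<Rightarrow> bool" where
  "admissible_pair G H S \<longleftrightarrow> hereditary G H \<and> saturated G H \<and> S \<subseteq> breaking_vertices G H"

text \<open>The vertex \<open>v\<close> becomes \<open>Inl v\<close> and \<open>v'\<close> is \<open>Inr v\<close>; likewise for edges.\<close>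

definition quotient_graph ::
  "('v,'e) pre_digraph \<Rightarrow> 'v set \<Rightarrow> 'v set \<Rightarrow> ('v + 'v, 'e + 'e) pre_digraph" where
  "quotient_graph G H S =
    \<lparr>verts = Inl ` (verts G - H) \<union> Inr ` (breaking_vertices G H - S),
     arcs = Inl ` {e \<in> arcs G. head G e \<notin> H} \<union>
            Inr ` {e \<in> arcs G. head G e \<in> breaking_vertices G H - S},
     tail = (\<lambda>x. case x of Inl e \<Rightarrow> Inl (tail G e) | Inr e \<Rightarrow> Inl (tail G e)),
     head = (\<lambda>x. case x of Inl e \<Rightarrow> Inl (head G e) | Inr e \<Rightarrow> Inr (head G e))\<rparr>"


section \<open>Two-sided ideals of rings without identity\<close>

text \<open>
  The locales \<^locale>\<open>ring\<close> and \<^locale>\<open>ideal\<close> require an identity. The rings considered here need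
  not have one: they are \<^typ>\<open>'a ring\<close> records whose field \<open>one\<close> is never used, neither below
  nor (except to fill the same field of the quotient) in the definition of \<^const>\<open>FactRing\<close>.
\<close>

definition two_sided_ideal :: "'a set \<Rightarrow> 'a ring \<Rightarrow> bool" where
  "two_sided_ideal I R \<longleftrightarrow> additive_subgroup I R \<and>
     (\<forall>a\<in>I. \<forall>x\<in>carrier R. x \<otimes>\<^bsub>R\<^esub> a \<in> I \<and> a \<otimes>\<^bsub>R\<^esub> x \<in> I)"

definition ideal_generated_by :: "'a ring \<Rightarrow> 'a set \<Rightarrow> 'a set" where
  "ideal_generated_by R X = \<Inter> {I. two_sided_ideal I R \<and> X \<subseteq> I}"

definition prime_ideal :: "'a set \<Rightarrow> 'a ring \<Rightarrow> bool" where
  "prime_ideal P R \<longleftrightarrow> two_sided_ideal P R \<and> P \<noteq> carrier R \<and>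
     (\<forall>A B. two_sided_ideal A R \<longrightarrow> two_sided_ideal B R \<longrightarrow>
        (\<forall>a\<in>A. \<forall>b\<in>B. a \<otimes>\<^bsub>R\<^esub> b \<in> P) \<longrightarrow> A \<subseteq> P \<or> B \<subseteq> P)"

text \<open>Intersecting with the carrier makes the empty intersection the whole ring.\<close>

definition locally_closed :: "'a set \<Rightarrow> 'a ring \<Rightarrow> bool" where
  "locally_closed P R \<longleftrightarrow> P \<noteq> carrier R \<inter> \<Inter> {Q. prime_ideal Q R \<and> P \<subset> Q}"

definition completely_irreducible :: "'a set \<Rightarrow> 'a ring \<Rightarrow> bool" where
  "completely_irreducible I R \<longleftrightarrow> I \<noteq> carrier R \<inter> \<Inter> {J. two_sided_ideal J R \<and> I \<subset> J}"

definition maximal_not_containing :: "'a set \<Rightarrow> 'a \<Rightarrow> 'a ring \<Rightarrow> bool" where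
  "maximal_not_containing P a R \<longleftrightarrow> two_sided_ideal P R \<and> a \<notin> P \<and>
     (\<forall>J. two_sided_ideal J R \<longrightarrow> a \<notin> J \<longrightarrow> P \<subseteq> J \<longrightarrow> J = P)"


section \<open>The Leavitt path algebra\<close>

datatype ('v,'e) gen = Vertex 'v | Edge 'e | Ghost 'e

text \<open>Words, as a type of their own in order to carry the monoid structure of concatenation.\<close>

datatype 'g gword = Word (letters: "'g list")

instantiation gword :: (type) monoid_add
begin

definition zero_gword :: "'a gword" where
  "zero_gword = Word []"

definition plus_gword :: "'a gword \<Rightarrow> 'a gword \<Rightarrow> 'a gword" where
  "plus_gword u w = Word (letters u @ letters w)"

instance
  by standard (simp_all add: zero_gword_def plus_gword_def)

end

text \<open>
  With the convolution product, this type is the free associative unital algebra on all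
  conceivable generators.
\<close>

type_synonym ('v,'e,'k) free_elem = "('v,'e) gen gword \<Rightarrow>\<^sub>0 'k"

definition monomial :: "('v,'e) gen \<Rightarrow> ('v,'e,'k::field) free_elem" where
  "monomial g = Poly_Mapping.single (Word [g]) 1"

abbreviation vx :: "'v \<Rightarrow> ('v,'e,'k::field) free_elem" where "vx v \<equiv> monomial (Vertex v)"
abbreviation ed :: "'e \<Rightarrow> ('v,'e,'k::field) free_elem" where "ed e \<equiv> monomial (Edge e)"
abbreviation gh :: "'e \<Rightarrow> ('v,'e,'k::field) free_elem" where "gh e \<equiv> monomial (Ghost e)"

definition generators :: "('v,'e) pre_digraph \<Rightarrow> ('v,'e) gen set" where
  "generators G = Vertex ` verts G \<union> Edge ` arcs G \<union> Ghost ` arcs G"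

text \<open>
  The free associative algebra without identity on the generators of \<open>G\<close>: linear combinations of
  non-empty words. The field \<open>one\<close> lies outside the carrier.
\<close>

definition free_algebra :: "('v,'e) pre_digraph \<Rightarrow> ('v,'e,'k::field) free_elem ring" where
  "free_algebra G =
    \<lparr>carrier = {x. \<forall>w \<in> Poly_Mapping.keys x. letters w \<noteq> [] \<and> set (letters w) \<subseteq> generators G},
     mult = (*), one = 1, zero = 0, add = (+)\<rparr>"

definition scale :: "'k::field \<Rightarrow> ('v,'e,'k) free_elem \<Rightarrow> ('v,'e,'k) free_elem" where
  "scale c x = Poly_Mapping.map (\<lambda>a. c * a) x"

inductive_set leavitt_relators :: "('v,'e) pre_digraph \<Rightarrow> ('v,'e,'k::field) free_elem set"
  for G :: "('v,'e) pre_digraph"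
where
  idem: "v \<in> verts G \<Longrightarrow> vx v * vx v - vx v \<in> leavitt_relators G"
| orth: "v \<in> verts G \<Longrightarrow> w \<in> verts G \<Longrightarrow> v \<noteq> w \<Longrightarrow> vx v * vx w \<in> leavitt_relators G"
| edge_source: "e \<in> arcs G \<Longrightarrow> vx (tail G e) * ed e - ed e \<in> leavitt_relators G"
| edge_range: "e \<in> arcs G \<Longrightarrow> ed e * vx (head G e) - ed e \<in> leavitt_relators G"
| ghost_source: "e \<in> arcs G \<Longrightarrow> vx (head G e) * gh e - gh e \<in> leavitt_relators G"
| ghost_range: "e \<in> arcs G \<Longrightarrow> gh e * vx (tail G e) - gh e \<in> leavitt_relators G"
| CK1_same: "e \<in> arcs G \<Longrightarrow> gh e * ed e - vx (head G e) \<in> leavitt_relators G"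
| CK1_diff: "e \<in> arcs G \<Longrightarrow> f \<in> arcs G \<Longrightarrow> e \<noteq> f \<Longrightarrow> gh e * ed f \<in> leavitt_relators G"
| CK2: "regular_vertex G v \<Longrightarrow> vx v - (\<Sum>e\<in>out_arcs G v. ed e * gh e) \<in> leavitt_relators G"

text \<open>
  The free algebra has no local units, so a ring ideal of it need not be a subspace; the ideal of
  relations is the smallest algebra ideal containing the relators.
\<close>

definition relation_ideal :: "('v,'e) pre_digraph \<Rightarrow> ('v,'e,'k::field) free_elem set" where
  "relation_ideal G = \<Inter> {I. two_sided_ideal I (free_algebra G) \<and>
     (\<forall>c. \<forall>x\<in>I. scale c x \<in> I) \<and> leavitt_relators G \<subseteq> I}"

type_synonym ('v,'e,'k) lpa_elem = "('v,'e,'k) free_elem set"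

definition leavitt_path_algebra :: "('v,'e) pre_digraph \<Rightarrow> ('v,'e,'k::field) lpa_elem ring" where
  "leavitt_path_algebra G = free_algebra G Quot relation_ideal G"

definition lpa_class ::
  "('v,'e) pre_digraph \<Rightarrow> ('v,'e,'k::field) free_elem \<Rightarrow> ('v,'e,'k) lpa_elem" where
  "lpa_class G x = relation_ideal G +>\<^bsub>free_algebra G\<^esub> x"


section \<open>Grading\<close>

fun gen_degree :: "('v,'e) gen \<Rightarrow> int" where
  "gen_degree (Vertex v) = 0"
| "gen_degree (Edge e) = 1"
| "gen_degree (Ghost e) = -1"

definition word_degree :: "('v,'e) gen gword \<Rightarrow> int" where
  "word_degree w = sum_list (map gen_degree (letters w))"

definition lpa_component :: "('v,'e) pre_digraph \<Rightarrow> int \<Rightarrow> ('v,'e,'k::field) lpa_elem set" where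
  "lpa_component G n = lpa_class G `
     {x \<in> carrier (free_algebra G). \<forall>w \<in> Poly_Mapping.keys x. word_degree w = n}"

text \<open>
  Existence and uniqueness of finitely supported decompositions express that \<open>I\<close> is the
  internal direct sum of its intersections with the homogeneous components.
\<close>

definition graded_ideal ::
  "('v,'e) pre_digraph \<Rightarrow> ('v,'e,'k::field) lpa_elem set \<Rightarrow> bool" where
  "graded_ideal G I \<longleftrightarrow> two_sided_ideal I (leavitt_path_algebra G) \<and>
     (\<forall>a\<in>I. \<exists>!f. (\<forall>n. f n \<in> I \<inter> lpa_component G n) \<and>
        finite {n. f n \<noteq> \<zero>\<^bsub>leavitt_path_algebra G\<^esub>} \<and>
        a = finsum (leavitt_path_algebra G) f {n. f n \<noteq> \<zero>\<^bsub>leavitt_path_algebra G\<^esub>})"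

definition graded_part ::
  "('v,'e) pre_digraph \<Rightarrow> ('v,'e,'k::field) lpa_elem set \<Rightarrow> ('v,'e,'k) lpa_elem set" where
  "graded_part G P = (GREATEST I. graded_ideal G I \<and> I \<subseteq> P)"


section \<open>Strongly primitive ideals\<close>

definition breaking_element ::
  "('v,'e) pre_digraph \<Rightarrow> 'v set \<Rightarrow> 'v \<Rightarrow> ('v,'e,'k::field) lpa_elem" where
  "breaking_element G H v =
     lpa_class G (vx v - (\<Sum>e | e \<in> out_arcs G v \<and> head G e \<notin> H. ed e * gh e))"

definition pair_ideal ::
  "('v,'e) pre_digraph \<Rightarrow> 'v set \<Rightarrow> 'v set \<Rightarrow> ('v,'e,'k::field) lpa_elem set" where
  "pair_ideal G H S = ideal_generated_by (leavitt_path_algebra G)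
     ((\<lambda>v. lpa_class G (vx v)) ` H \<union> breaking_element G H ` S)"

definition strongly_primitive ::
  "('v,'e) pre_digraph \<Rightarrow> ('v,'e,'k::field) lpa_elem set \<Rightarrow> bool" where
  "strongly_primitive G P \<longleftrightarrow>
     (two_sided_ideal P (leavitt_path_algebra G) \<and>
      (\<exists>H S. admissible_pair G H S \<and> graded_part G P = pair_ideal G H S \<and>
         downward_directed (quotient_graph G H S) \<and>
         condition_L (quotient_graph G H S) \<and>
         strong_CSP (quotient_graph G H S)))
     \<or> (prime_ideal P (leavitt_path_algebra G) \<and> \<not> graded_ideal G P)"

end

theory Submission
  imports Defs "HOL-Computational_Algebra.Polynomial" "HOL-Library.Function_Algebras"
begin

text \<open>
  Let \<open>L\<close> be the Leavitt path algebra of \<open>E\<close> and \<open>P\<close> a prime ideal. That (b) and (c) are equivalent and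
  imply (a) is true in any ring: \<open>P\<close> is maximal among the ideals without a given element
  if this element is outside \<open>P\<close> and in all larger ideals, and then it is in all larger primes. It remains to show
  that (d) implies (b) and that (a) implies (d).

  Everything rests on the reduction theorem. Let \<open>I\<close> be a graded ideal, \<open>H\<close> the set of vertices in it
  and \<open>U\<close> the set of breaking vertices \<open>v\<close> of \<open>H\<close> with \<open>v\<^sup>H\<close> in it. In \<open>L/I\<close> the edges and vertices of
  the quotient graph have representatives that satisfy the Leavitt relations
  (\<open>quotient_family\<close>), and its vertices are not zero. Multiplication by paths from
  the right and by ghost paths from the left turns any non-zero element of \<open>L/I\<close> into a non-zero
  multiple of a vertex, or into a non-zero polynomial in a cycle without exits (\<open>reduction\<close>). So an
  ideal above \<open>I\<close> contains one of these. If it is graded, it contains a vertex in either case, and it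
  follows that \<open>I\<close> is generated by \<open>H\<close> and the \<open>v\<^sup>H\<close> with \<open>v\<close> in \<open>U\<close> (\<open>graded_ideal_pair\<close>).

  (d) implies (b): let \<open>P\<close> be graded. By Condition (L) every larger ideal contains a vertex of the quotient
  graph. The vertices in it form a hereditary saturated set, which contains the countable set from the
  strong CSP; so any vertex of that set lies in all larger ideals
  (\<open>graded_completely_irreducible\<close>). If \<open>P\<close> is not graded, apply the reduction theorem to the graded part \<open>I\<close>
  of \<open>P\<close>: as \<open>P\<close> contains no vertex outside \<open>I\<close>, it contains a polynomial in a cycle without exits at
  some \<open>v\<close>. The corner \<open>v(L/I)v\<close> is the ring of Laurent polynomials in the cycle, so \<open>v(L/P)v\<close> is a field, and
  \<open>v\<close> lies in all ideals above \<open>P\<close> (\<open>nongraded_prime_completely_irreducible\<close>).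

  (a) implies (d): let \<open>P\<close> be graded and let \<open>a\<close> lie in all larger primes but not in \<open>P\<close>. Primes are
  produced in one way only: an ideal that is maximal among those avoiding a given idempotent is prime
  (\<open>prime_avoiding_idempotent\<close>). At a cycle without exits, \<open>a\<close> would yield a Laurent polynomial
  \<open>f\<close> in all larger primes, but there is a prime that contains \<open>1 + x f\<close> and not the vertex
  (\<open>locally_closed_condition_L\<close>). So Condition (L) holds, and the intersection of the larger primes
  contains a vertex \<open>z\<close>. For each hereditary saturated set \<open>Y\<close> without \<open>z\<close> there is an ideal above \<open>P\<close> that
  contains exactly the vertices in \<open>Y\<close> (\<open>ideal_with_vertices\<close>) and a prime above this ideal that avoids \<open>z\<close>;
  so \<open>Y\<close> is empty. A vertex in all non-empty hereditary saturated sets gives the strong CSP, where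
  countability comes for free (\<open>strong_CSP_if_least_vertex\<close>).

  Two devices keep the computations manageable. A quotient of \<open>L\<close> is embedded into a ring of
  endomorphisms whose type does not depend on the ideal (\<open>quotient_in_endo\<close>), so that one computes with
  equations and not with congruences. And a representation by partial injections, which exists for every
  graph (\<open>branching_representation\<close>), shows that ideals do not contain more vertices than they should.
\<close>


section \<open>Rings of additive endomorphisms\<close>

typedef (overloaded) 'b endo = "{f :: 'b::ab_group_add \<Rightarrow> 'b. \<forall>x y. f (x + y) = f x + f y}"
  morphisms app Endo
  by (rule exI[of _ "\<lambda>x. x"]) simp

setup_lifting type_definition_endo

lemma app_add: "app f (x + y) = app f x + app f y"
  using app[of f] by simp

instantiation endo :: ("{ab_group_add, zero_neq_one}") ring_1
begin

lift_definition zero_endo :: "'a endo" is "\<lambda>x. 0" by simp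
lift_definition one_endo :: "'a endo" is "\<lambda>x. x" by simp
lift_definition plus_endo :: "'a endo \<Rightarrow> 'a endo \<Rightarrow> 'a endo" is "\<lambda>f g x. f x + g x"
  by (simp add: algebra_simps)
lift_definition minus_endo :: "'a endo \<Rightarrow> 'a endo \<Rightarrow> 'a endo" is "\<lambda>f g x. f x - g x"
  by (simp add: algebra_simps)
lift_definition uminus_endo :: "'a endo \<Rightarrow> 'a endo" is "\<lambda>f x. - f x"
  by (simp add: algebra_simps)
lift_definition times_endo :: "'a endo \<Rightarrow> 'a endo \<Rightarrow> 'a endo" is "\<lambda>f g x. f (g x)"
  by simp

instance
proof
  fix a b c :: "'a endo"
  show "(0::'a endo) \<noteq> 1"
  proof
    assume "(0::'a endo) = 1"
    then have "app (0::'a endo) 1 = app 1 1" by simp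
    then show False by (simp add: zero_endo.rep_eq one_endo.rep_eq)
  qed
qed (transfer; simp add: fun_eq_iff algebra_simps)+

end

lemma endo_eqI: "(\<And>x. app f x = app g x) \<Longrightarrow> f = g"
  by (simp add: app_inject[symmetric] fun_eq_iff)

lemmas app_simps = zero_endo.rep_eq one_endo.rep_eq plus_endo.rep_eq minus_endo.rep_eq
  uminus_endo.rep_eq times_endo.rep_eq

lemma (in vector_space) subspace_projection:
  assumes "subspace W"
  obtains f where "\<And>x y. f (x + y) = f x + f y" "\<And>x. f x \<in> W" "\<And>x. x \<in> W \<Longrightarrow> f x = x"
proof -
  interpret vector_space_pair scale scale by unfold_locales
  have "Vector_Spaces.linear scale scale (\<lambda>x. x)"
    by unfold_locales auto
  from linear_exists_left_inverse_on[OF this assms]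
  obtain g where g: "g ` UNIV \<subseteq> W" "Vector_Spaces.linear scale scale g" "\<forall>v\<in>W. g v = v"
    by (auto simp: inj_on_def)
  interpret g: Vector_Spaces.linear scale scale g by fact
  show ?thesis by (rule that[of g]) (use g in \<open>auto simp: g.add\<close>)
qed

text \<open>
  Let \<open>I\<close> be an ideal of a subalgebra \<open>C\<close>. Left multiplication is a faithful action of the quotient
  on itself; composing it with linear projections onto \<open>C\<close> and along \<open>I\<close> realises the quotient
  inside a ring whose type depends on neither \<open>C\<close> nor \<open>I\<close>. This turns congruences modulo \<open>I\<close> into
  equations.
\<close>

lemma quotient_in_endo:
  fixes scl :: "'k::field \<Rightarrow> 'b::ring_1 \<Rightarrow> 'b"
  assumes "vector_space scl" and C: "module.subspace scl C" and I: "module.subspace scl I"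
    and "I \<subseteq> C" "1 \<in> C" and mult: "\<And>x y. x \<in> C \<Longrightarrow> y \<in> C \<Longrightarrow> x * y \<in> C"
    and left: "\<And>x y. x \<in> C \<Longrightarrow> y \<in> I \<Longrightarrow> x * y \<in> I"
    and right: "\<And>x y. x \<in> C \<Longrightarrow> y \<in> I \<Longrightarrow> y * x \<in> I"
  shows "\<exists>\<Phi> :: 'b \<Rightarrow> 'b endo. (\<forall>x y. \<Phi> (x + y) = \<Phi> x + \<Phi> y) \<and>
     (\<forall>x\<in>C. \<forall>y\<in>C. \<Phi> (x * y) = \<Phi> x * \<Phi> y) \<and> (\<forall>x\<in>C. \<Phi> x = 0 \<longleftrightarrow> x \<in> I)"
proof -
  interpret vector_space scl by fact
  obtain q where q: "\<And>x y. q (x + y) = q x + q y" "\<And>x. q x \<in> C" "\<And>x. x \<in> C \<Longrightarrow> q x = x"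
    using subspace_projection[OF C] by blast
  obtain r where r: "\<And>x y. r (x + y) = r x + r y" "\<And>x. r x \<in> I" "\<And>x. x \<in> I \<Longrightarrow> r x = x"
    using subspace_projection[OF I] by blast
  \<comment> \<open>the projection along \<open>I\<close>; it identifies the quotient with a complement of \<open>I\<close>\<close>
  define h where "h x = x - r x" for x
  have h_add: "h (x + y) = h x + h y" for x y by (simp add: h_def r)
  have h_cong: "h x = h y" if "x - y \<in> I" for x y
  proof -
    have "r x = r (x - y) + r y" using r(1)[of "x - y" y] by simp
    then show ?thesis using r(3)[OF that] by (simp add: h_def)
  qed
  have h_eq: "h x - x \<in> I" for x
    using subspace_neg[OF I r(2)[of x]] by (simp add: h_def)
  have h_C: "h x \<in> C" if "x \<in> C" for x
    using that r(2)[of x] \<open>I \<subseteq> C\<close> subspace_diff[OF C] by (auto simp: h_def)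
  define \<Phi> where "\<Phi> x = Endo (\<lambda>z. h (x * q z))" for x
  have app: "app (\<Phi> x) = (\<lambda>z. h (x * q z))" for x
    unfolding \<Phi>_def by (subst Endo_inverse) (auto simp: q h_add distrib_left)
  have "\<Phi> (x + y) = \<Phi> x + \<Phi> y" for x y
    by (rule endo_eqI) (simp add: app app_simps distrib_right h_add)
  moreover have "\<Phi> (x * y) = \<Phi> x * \<Phi> y" if "x \<in> C" "y \<in> C" for x y
  proof (rule endo_eqI)
    fix z
    have "y * q z \<in> C" using mult q that by auto
    then have "q (h (y * q z)) = h (y * q z)" using q h_C by auto
    moreover have "h (x * h (y * q z)) = h (x * (y * q z))"
    proof (rule h_cong)
      have "x * (h (y * q z) - y * q z) \<in> I" using left that h_eq by auto
      then show "x * h (y * q z) - x * (y * q z) \<in> I" by (simp add: right_diff_distrib)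
    qed
    ultimately show "app (\<Phi> (x * y)) z = app (\<Phi> x * \<Phi> y) z"
      by (simp add: app app_simps mult.assoc)
  qed
  moreover have "\<Phi> x = 0 \<longleftrightarrow> x \<in> I" if "x \<in> C" for x
  proof
    assume "\<Phi> x = 0"
    then have "app (\<Phi> x) 1 = 0" by (simp add: app_simps)
    then have "h x = 0" using q(3)[OF \<open>1 \<in> C\<close>] by (simp add: app)
    then show "x \<in> I" using r(2)[of x] by (simp add: h_def)
  next
    assume "x \<in> I"
    show "\<Phi> x = 0"
    proof (rule endo_eqI)
      fix z
      have "x * q z \<in> I" using right q \<open>x \<in> I\<close> by auto
      then show "app (\<Phi> x) z = app 0 z" using r(3) by (simp add: app app_simps h_def)
    qed
  qed
  ultimately show ?thesis by blast
qed


section \<open>The free algebra and its ideals\<close>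

lemma free_algebra_simps [simp]:
  "x \<otimes>\<^bsub>free_algebra E\<^esub> y = x * y" "x \<oplus>\<^bsub>free_algebra E\<^esub> y = x + y" "\<zero>\<^bsub>free_algebra E\<^esub> = 0"
  by (simp_all add: free_algebra_def)

text \<open>
  Splitting off one term at a time gives linear induction over the words that occur.
\<close>

lemma free_induct [consumes 1, case_names zero add]:
  assumes "\<forall>w \<in> Poly_Mapping.keys x. Q w"
    and "P 0" and step: "\<And>w c x. Q w \<Longrightarrow> \<forall>w \<in> Poly_Mapping.keys x. Q w \<Longrightarrow> P x \<Longrightarrow> P (Poly_Mapping.single w c + x)"
  shows "P (x :: 'w \<Rightarrow>\<^sub>0 'k::ab_group_add)"
  using assms(1)
proof (induction "card (Poly_Mapping.keys x)" arbitrary: x)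
  case 0
  then show ?case using \<open>P 0\<close> by simp
next
  case (Suc n)
  then obtain w where w: "w \<in> Poly_Mapping.keys x" by fastforce
  define y where "y = x - Poly_Mapping.single w (Poly_Mapping.lookup x w)"
  have "Poly_Mapping.keys y = Poly_Mapping.keys x - {w}"
    by (auto simp: y_def in_keys_iff lookup_minus lookup_single when_def split: if_splits)
  then have "P y" "\<forall>w \<in> Poly_Mapping.keys y. Q w"
    using Suc w by auto
  then have "P (Poly_Mapping.single w (Poly_Mapping.lookup x w) + y)"
    using step w Suc.prems by blast
  then show ?case by (simp add: y_def)
qed

lemma scale_eq: "scale c x = Poly_Mapping.single 0 c * x"
  by (simp add: scale_def mult_map_scale_conv_mult)

lemma const_commute: "Poly_Mapping.single 0 c * x = x * Poly_Mapping.single 0 c"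
  for x :: "'w::monoid_add \<Rightarrow>\<^sub>0 'k::field"
proof -
  have "\<forall>w \<in> Poly_Mapping.keys x. True" by simp
  then show ?thesis
    by (induction rule: free_induct) (simp_all add: distrib_left distrib_right mult_single mult.commute)
qed

interpretation scale: vector_space "scale :: 'k::field \<Rightarrow> ('v,'e,'k) free_elem \<Rightarrow> _"
  by unfold_locales
    (simp_all add: scale_eq algebra_simps single_add flip: mult.assoc mult_single[where k = 0 and l = 0, simplified])

locale lpa = wf_digraph E for E :: "('v,'e) pre_digraph"
begin

abbreviation C :: "('v,'e,'k::field) free_elem set" where "C \<equiv> carrier (free_algebra E)"
abbreviation R :: "('v,'e,'k::field) free_elem set" where "R \<equiv> relation_ideal E"
abbreviation cls :: "('v,'e,'k::field) free_elem \<Rightarrow> ('v,'e,'k) lpa_elem" where "cls \<equiv> lpa_class E"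
abbreviation L :: "('v,'e,'k::field) lpa_elem ring" where "L \<equiv> leavitt_path_algebra E"

text \<open>
  The free algebra has no identity, but the ambient algebra of all words does. Adjoining the constants
  gives the identity that the embedding of quotients requires, and makes scaling a multiplication.
\<close>

definition unital_hull :: "('v,'e,'k::field) free_elem set" where
  "unital_hull = {x. \<forall>w \<in> Poly_Mapping.keys x. set (letters w) \<subseteq> generators E}"

lemma C_iff: "x \<in> C \<longleftrightarrow> (\<forall>w \<in> Poly_Mapping.keys x. letters w \<noteq> [] \<and> set (letters w) \<subseteq> generators E)"
  by (simp add: free_algebra_def)

lemma letters_plus [simp]: "letters (u + w) = letters u @ letters w"
  by (simp add: plus_gword_def)

lemma letters_zero [simp]: "letters 0 = []"
  by (simp add: zero_gword_def)

lemma hull_add: "x \<in> unital_hull \<Longrightarrow> y \<in> unital_hull \<Longrightarrow> x + y \<in> unital_hull"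
  unfolding unital_hull_def using Poly_Mapping.keys_add[of x y] by blast

lemma hull_mult: "x \<in> unital_hull \<Longrightarrow> y \<in> unital_hull \<Longrightarrow> x * y \<in> unital_hull"
  unfolding unital_hull_def using keys_mult[of x y] by (fastforce dest!: subsetD)

lemma C_hull: "x \<in> C \<Longrightarrow> x \<in> unital_hull"
  by (auto simp: C_iff unital_hull_def)

lemma const_hull: "Poly_Mapping.single 0 c \<in> unital_hull"
  by (auto simp: unital_hull_def)

lemma C_zero: "0 \<in> C" by (simp add: C_iff)

lemma C_add: "x \<in> C \<Longrightarrow> y \<in> C \<Longrightarrow> x + y \<in> C"
  unfolding C_iff using Poly_Mapping.keys_add[of x y] by blast

lemma C_mult_hull: "x \<in> C \<Longrightarrow> y \<in> unital_hull \<Longrightarrow> x * y \<in> C"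
  unfolding C_iff unital_hull_def using keys_mult[of x y] by (fastforce dest!: subsetD)

lemma C_hull_mult: "x \<in> unital_hull \<Longrightarrow> y \<in> C \<Longrightarrow> x * y \<in> C"
  unfolding C_iff unital_hull_def using keys_mult[of x y] by (fastforce dest!: subsetD)

lemma C_mult: "x \<in> C \<Longrightarrow> y \<in> C \<Longrightarrow> x * y \<in> C"
  by (rule C_mult_hull[OF _ C_hull])

lemma C_scale: "x \<in> C \<Longrightarrow> scale c x \<in> C"
  by (simp add: scale_eq C_hull_mult const_hull)

lemma C_uminus: "x \<in> C \<Longrightarrow> - x \<in> C"
  by (simp add: C_iff in_keys_iff)

lemma C_diff: "x \<in> C \<Longrightarrow> y \<in> C \<Longrightarrow> x - y \<in> C"
  using C_add[of x "- y"] C_uminus by auto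

lemma C_sum: "(\<And>i. i \<in> A \<Longrightarrow> f i \<in> C) \<Longrightarrow> sum f A \<in> C"
  by (induction A rule: infinite_finite_induct) (auto simp: C_zero C_add)

lemma C_gens: "v \<in> verts E \<Longrightarrow> vx v \<in> C" "e \<in> arcs E \<Longrightarrow> ed e \<in> C" "e \<in> arcs E \<Longrightarrow> gh e \<in> C"
  by (auto simp: C_iff monomial_def generators_def)

lemma hull_induct [consumes 1, case_names zero add const mult]:
  assumes "x \<in> unital_hull" "P 0" "\<And>x y. P x \<Longrightarrow> P y \<Longrightarrow> P (x + y)" "\<And>c. P (Poly_Mapping.single 0 c)"
    "\<And>g x. g \<in> generators E \<Longrightarrow> x \<in> unital_hull \<Longrightarrow> P x \<Longrightarrow> P (monomial g * x)"
  shows "P (x :: ('v,'e,'k::field) free_elem)"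
proof -
  have *: "P (Poly_Mapping.single w c)" if "set (letters w) \<subseteq> generators E" for w and c :: 'k
    using that
  proof (induction "letters w" arbitrary: w)
    case Nil
    then have "w = 0" by (cases w) (simp add: zero_gword_def)
    then show ?case using assms by simp
  next
    case (Cons g ls)
    have "P (monomial g * Poly_Mapping.single (Word ls) c)"
      using Cons(2)[symmetric] Cons(3) Cons(1)[of "Word ls"]
      by (intro assms(5)) (auto simp: unital_hull_def)
    moreover have "w = Word [g] + Word ls" using Cons(2) by (cases w) (simp add: plus_gword_def)
    ultimately show ?case by (simp add: monomial_def mult_single)
  qed
  have "\<forall>w \<in> Poly_Mapping.keys x. set (letters w) \<subseteq> generators E"
    using assms(1) by (simp add: unital_hull_def)
  then show ?thesis
    by (induction rule: free_induct) (auto intro: assms *)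
qed

lemma C_induct [consumes 1, case_names zero add scale gen mult]:
  assumes "x \<in> C" "P 0" "\<And>x y. P x \<Longrightarrow> P y \<Longrightarrow> P (x + y)" "\<And>c x. x \<in> C \<Longrightarrow> P x \<Longrightarrow> P (Poly_Mapping.single 0 c * x)"
    "\<And>g. g \<in> generators E \<Longrightarrow> P (monomial g)"
    "\<And>g x. g \<in> generators E \<Longrightarrow> x \<in> C \<Longrightarrow> P x \<Longrightarrow> P (monomial g * x)"
  shows "P (x :: ('v,'e,'k::field) free_elem)"
proof -
  have *: "P (Poly_Mapping.single w 1)" if "letters w \<noteq> []" "set (letters w) \<subseteq> generators E" for w
    using that
  proof (induction "letters w" arbitrary: w)
    case (Cons g ls)
    have w: "w = Word [g] + Word ls" using Cons(2) by (cases w) (simp add: plus_gword_def)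
    show ?case
    proof (cases ls)
      case Nil
      then have "w = Word [g]" using Cons(2) by (cases w) simp
      then show ?thesis using assms(5)[of g] Cons(2,4) by (auto simp: monomial_def)
    next
      case (Cons a list)
      then have "P (monomial g * Poly_Mapping.single (Word ls) 1)"
        using \<open>g # ls = letters w\<close>[symmetric] Cons.prems
          \<open>\<And>w. ls = letters w \<Longrightarrow> letters w \<noteq> [] \<Longrightarrow> set (letters w) \<subseteq> generators E \<Longrightarrow> P (Poly_Mapping.single w 1)\<close>[of "Word ls"]
          \<open>set (letters w) \<subseteq> generators E\<close>
        by (intro assms(6)) (auto simp: C_iff)
      then show ?thesis by (simp add: monomial_def mult_single w)
    qed
  qed simp
  have **: "P (Poly_Mapping.single w c)" if "letters w \<noteq> []" "set (letters w) \<subseteq> generators E" for w c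
    using assms(4)[OF _ *[OF that], of c] that by (simp add: mult_single C_iff)
  have "\<forall>w \<in> Poly_Mapping.keys x. letters w \<noteq> [] \<and> set (letters w) \<subseteq> generators E"
    using assms(1) by (simp add: C_iff)
  then show ?thesis
    by (induction rule: free_induct) (auto intro: assms **)
qed

lemma abelian_group_free: "abelian_group (free_algebra E :: ('v,'e,'k::field) free_elem ring)"
  by (rule abelian_groupI) (auto simp: C_add C_zero algebra_simps intro!: bexI[of _ "- _"] C_uminus)

lemma a_inv_free: "x \<in> C \<Longrightarrow> \<ominus>\<^bsub>free_algebra E\<^esub> x = - x"
  using abelian_group.minus_equality[OF abelian_group_free, of "- x" x] C_uminus[of x] by simp

lemma additive_subgroup_iff:
  assumes "abelian_group (A :: 'a ring)"
  shows "additive_subgroup I A \<longleftrightarrow> I \<subseteq> carrier A \<and> \<zero>\<^bsub>A\<^esub> \<in> I \<and>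
     (\<forall>x\<in>I. \<forall>y\<in>I. x \<oplus>\<^bsub>A\<^esub> y \<in> I) \<and> (\<forall>x\<in>I. \<ominus>\<^bsub>A\<^esub> x \<in> I)"
  by (auto simp: additive_subgroup_def subgroup_def a_inv_def)

lemma tsi_free: "two_sided_ideal I (free_algebra E) \<longleftrightarrow> I \<subseteq> C \<and> 0 \<in> I \<and>
   (\<forall>x\<in>I. \<forall>y\<in>I. x - y \<in> I) \<and> (\<forall>a\<in>I. \<forall>x\<in>C. x * a \<in> I \<and> a * x \<in> I)"
  for I :: "('v,'e,'k::field) free_elem set"
proof -
  have "(\<forall>x\<in>I. \<forall>y\<in>I. x + y \<in> I) \<and> (\<forall>x\<in>I. - x \<in> I) \<longleftrightarrow> (\<forall>x\<in>I. \<forall>y\<in>I. x - y \<in> I)"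
    if "0 \<in> I"
  proof (intro iffI conjI ballI)
    assume a: "\<forall>x\<in>I. \<forall>y\<in>I. x - y \<in> I"
    show neg: "- x \<in> I" if "x \<in> I" for x using a \<open>0 \<in> I\<close> that by force
    show "x + y \<in> I" if "x \<in> I" "y \<in> I" for x y
      using a neg[OF that(2)] that by (metis diff_minus_eq_add)
  next
    fix x y assume "(\<forall>x\<in>I. \<forall>y\<in>I. x + y \<in> I) \<and> (\<forall>x\<in>I. - x \<in> I)" "x \<in> I" "y \<in> I"
    then show "x - y \<in> I" by (metis diff_conv_add_uminus)
  qed
  moreover have "(\<forall>x\<in>I. \<ominus>\<^bsub>free_algebra E\<^esub> x \<in> I) \<longleftrightarrow> (\<forall>x\<in>I. - x \<in> I)" if "I \<subseteq> C"
    using that a_inv_free by (metis subsetD)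
  ultimately show ?thesis
    unfolding two_sided_ideal_def additive_subgroup_iff[OF abelian_group_free] by auto
qed

lemma relators_C: "x \<in> leavitt_relators E \<Longrightarrow> x \<in> C"
  by (induction rule: leavitt_relators.induct)
    (auto intro!: C_diff C_mult C_gens C_sum simp: regular_vertex_def out_arcs_def)

lemma R_least:
  assumes "two_sided_ideal I (free_algebra E)" "\<And>c x. x \<in> I \<Longrightarrow> scale c x \<in> I" "leavitt_relators E \<subseteq> I"
  shows "R \<subseteq> I"
  unfolding relation_ideal_def using assms by blast

lemma R_sub: "R \<subseteq> C"
  by (rule R_least) (auto simp: tsi_free C_zero C_mult relators_C intro: C_scale C_diff)

lemma R_relators: "leavitt_relators E \<subseteq> R"
  unfolding relation_ideal_def by blast

lemma R_zero: "0 \<in> R" and R_diff: "x \<in> R \<Longrightarrow> y \<in> R \<Longrightarrow> x - y \<in> R"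
  and R_mult: "x \<in> R \<Longrightarrow> y \<in> C \<Longrightarrow> y * x \<in> R" "x \<in> R \<Longrightarrow> y \<in> C \<Longrightarrow> x * y \<in> R"
  and R_scale: "x \<in> R \<Longrightarrow> scale c x \<in> R"
  unfolding relation_ideal_def tsi_free by blast+

lemma R_uminus: "x \<in> R \<Longrightarrow> - x \<in> R"
  using R_diff[OF R_zero, of x] by simp

lemma R_add: "x \<in> R \<Longrightarrow> y \<in> R \<Longrightarrow> x + y \<in> R"
  using R_diff[of x "- y"] R_uminus[of y] by simp

lemma cls_eq: "cls x = {y. y - x \<in> R}"
proof -
  have "y \<in> cls x \<longleftrightarrow> (\<exists>h\<in>R. y = h + x)" for y
    by (simp add: lpa_class_def a_r_coset_def')
  then show ?thesis
    by (auto simp: set_eq_iff) (metis diff_add_cancel)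
qed

lemma cls_eq_iff: "cls x = cls y \<longleftrightarrow> x - y \<in> R"
proof
  assume "cls x = cls y"
  moreover have "x \<in> cls x" by (simp add: cls_eq R_zero)
  ultimately show "x - y \<in> R" by (simp add: cls_eq)
next
  assume *: "x - y \<in> R"
  have "z - x \<in> R \<longleftrightarrow> z - y \<in> R" for z
    using R_add[OF _ *, of "z - x"] R_diff[OF _ *, of "z - y"] by auto
  then show "cls x = cls y" by (simp add: cls_eq)
qed

lemma L_carrier: "carrier L = cls ` C"
  by (auto simp: leavitt_path_algebra_def FactRing_def A_RCOSETS_def' lpa_class_def)

lemma L_zero: "\<zero>\<^bsub>L\<^esub> = cls 0"
  by (simp add: leavitt_path_algebra_def FactRing_def cls_eq)

lemma L_add: "cls x \<oplus>\<^bsub>L\<^esub> cls y = cls (x + y)"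
proof -
  have "z \<in> cls x \<oplus>\<^bsub>L\<^esub> cls y \<longleftrightarrow> z \<in> cls (x + y)" for z
  proof
    assume "z \<in> cls x \<oplus>\<^bsub>L\<^esub> cls y"
    then obtain a b where "a - x \<in> R" "b - y \<in> R" "z = a + b"
      by (auto simp: leavitt_path_algebra_def FactRing_def set_add_def' cls_eq)
    then show "z \<in> cls (x + y)" using R_add[of "a - x" "b - y"] by (simp add: cls_eq algebra_simps)
  next
    assume "z \<in> cls (x + y)"
    then have "z - y \<in> cls x" "y \<in> cls y" by (simp_all add: cls_eq algebra_simps R_zero)
    then show "z \<in> cls x \<oplus>\<^bsub>L\<^esub> cls y"
      by (force simp: leavitt_path_algebra_def FactRing_def set_add_def')
  qed
  then show ?thesis by blast
qed

lemma L_mult: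
  assumes "x \<in> C" "y \<in> C"
  shows "cls x \<otimes>\<^bsub>L\<^esub> cls y = cls (x * y)"
proof -
  have "cls (a * b) = cls (x * y)" if "a \<in> cls x" "b \<in> cls y" for a b
  proof -
    have ab: "a - x \<in> R" "b - y \<in> R" using that by (auto simp: cls_eq)
    then have "b \<in> C" using R_sub assms C_add[of "b - y" y] by auto
    then have "(a - x) * b + x * (b - y) \<in> R" using ab assms by (intro R_add R_mult) auto
    then show ?thesis by (simp add: cls_eq_iff algebra_simps)
  qed
  moreover have "x \<in> cls x" "y \<in> cls y" by (simp_all add: cls_eq R_zero)
  ultimately have "(\<Union>a\<in>cls x. \<Union>b\<in>cls y. cls (a * b)) = cls (x * y)" by blast
  then show ?thesis
    by (simp add: leavitt_path_algebra_def FactRing_def rcoset_mult_def flip: lpa_class_def)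
qed

lemma abelian_group_L: "abelian_group L"
proof (rule abelian_groupI)
  fix x assume "x \<in> carrier L"
  then obtain a where "a \<in> C" "x = cls a" by (auto simp: L_carrier)
  then show "\<exists>y\<in>carrier L. y \<oplus>\<^bsub>L\<^esub> x = \<zero>\<^bsub>L\<^esub>"
    by (intro bexI[of _ "cls (- a)"]) (auto simp: L_add L_zero L_carrier C_uminus)
qed (auto simp: L_carrier L_add L_zero C_add C_zero algebra_simps)

lemma a_inv_L: "x \<in> C \<Longrightarrow> \<ominus>\<^bsub>L\<^esub> cls x = cls (- x)"
  using abelian_group.minus_equality[OF abelian_group_L, of "cls (- x)" "cls x"] C_uminus[of x]
  by (simp add: L_carrier L_add L_zero)

text \<open>
  The ideals of the Leavitt path algebra correspond to the ideals of the free algebra that contain the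
  relations. Replacing the former by the latter removes the cosets from everything that follows; \<open>lid\<close>
  and \<open>lprime\<close> stand for lifted ideals and lifted primes.
\<close>

definition lid :: "('v,'e,'k::field) free_elem set \<Rightarrow> bool" where
  "lid J \<longleftrightarrow> R \<subseteq> J \<and> J \<subseteq> C \<and> (\<forall>x\<in>J. \<forall>y\<in>J. x - y \<in> J) \<and>
     (\<forall>a\<in>J. \<forall>x\<in>C. x * a \<in> J \<and> a * x \<in> J)"

lemma lid_C: "lid C"
  by (auto simp: lid_def C_diff C_mult R_sub[THEN subsetD])

lemma lid_sub: "lid J \<Longrightarrow> x \<in> J \<Longrightarrow> x \<in> C" and lid_R: "lid J \<Longrightarrow> x \<in> R \<Longrightarrow> x \<in> J"
  and lid_diff: "lid J \<Longrightarrow> x \<in> J \<Longrightarrow> y \<in> J \<Longrightarrow> x - y \<in> J"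
  and lid_mult: "lid J \<Longrightarrow> x \<in> J \<Longrightarrow> y \<in> C \<Longrightarrow> y * x \<in> J" "lid J \<Longrightarrow> x \<in> J \<Longrightarrow> y \<in> C \<Longrightarrow> x * y \<in> J"
  and lid_zero: "lid J \<Longrightarrow> 0 \<in> J"
  using R_zero by (auto simp: lid_def)

lemma lid_uminus: "lid J \<Longrightarrow> x \<in> J \<Longrightarrow> - x \<in> J"
  using lid_diff[OF _ lid_zero, of J x] by simp

lemma lid_add: "lid J \<Longrightarrow> x \<in> J \<Longrightarrow> y \<in> J \<Longrightarrow> x + y \<in> J"
  using lid_diff[of J x "- y"] lid_uminus[of J y] by simp

lemma lid_sum: "lid J \<Longrightarrow> (\<And>i. i \<in> A \<Longrightarrow> f i \<in> J) \<Longrightarrow> sum f A \<in> J"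
  by (induction A rule: infinite_finite_induct) (auto simp: lid_zero lid_add)

lemma lid_cong: "lid J \<Longrightarrow> x - y \<in> J \<Longrightarrow> x \<in> J \<longleftrightarrow> y \<in> J"
  using lid_add[of J "x - y" y] lid_diff[of J x "x - y"] by auto

lemma lid_Inter:
  assumes "\<And>J. J \<in> \<J> \<Longrightarrow> lid J"
  shows "lid (C \<inter> \<Inter>\<J>)"
proof -
  have "R \<subseteq> J" if "J \<in> \<J>" for J using assms[OF that] by (simp add: lid_def)
  then have "R \<subseteq> C \<inter> \<Inter>\<J>" using R_sub by blast
  then show ?thesis using assms by (auto simp: lid_def C_diff C_mult)
qed

lemma lid_Union:
  assumes "\<And>J. J \<in> \<J> \<Longrightarrow> lid J" "\<J> \<noteq> {}" "subset.chain UNIV \<J>"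
  shows "lid (\<Union>\<J>)"
proof -
  have "x - y \<in> \<Union>\<J>" if xy: "x \<in> \<Union>\<J>" "y \<in> \<Union>\<J>" for x y
  proof -
    obtain A B where "A \<in> \<J>" "B \<in> \<J>" "x \<in> A" "y \<in> B" using xy by blast
    moreover have "A \<subseteq> B \<or> B \<subseteq> A" using assms(3) \<open>A \<in> \<J>\<close> \<open>B \<in> \<J>\<close> by (auto simp: subset_chain_def)
    ultimately obtain D where "D \<in> \<J>" "x \<in> D" "y \<in> D" by blast
    then show ?thesis using lid_diff[OF assms(1)] by blast
  qed
  moreover have "R \<subseteq> J" "J \<subseteq> C" if "J \<in> \<J>" for J using assms(1)[OF that] by (simp_all add: lid_def)
  then have "R \<subseteq> \<Union>\<J>" "\<Union>\<J> \<subseteq> C" using assms(2) by blast+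
  moreover have "x * a \<in> \<Union>\<J> \<and> a * x \<in> \<Union>\<J>" if "a \<in> \<Union>\<J>" "x \<in> C" for a x
    using that lid_mult[OF assms(1)] by blast
  ultimately show ?thesis unfolding lid_def by blast
qed

lemma cls_mem_iff: "lid J \<Longrightarrow> cls x \<in> cls ` J \<longleftrightarrow> x \<in> J"
  by (auto simp: cls_eq_iff) (metis lid_R lid_cong)

lemma cls_image_subset_iff: "lid J \<Longrightarrow> lid K \<Longrightarrow> cls ` J \<subseteq> cls ` K \<longleftrightarrow> J \<subseteq> K"
  using cls_mem_iff by blast

lemma cls_image_eq_iff: "lid J \<Longrightarrow> lid K \<Longrightarrow> cls ` J = cls ` K \<longleftrightarrow> J = K"
  using cls_image_subset_iff by (metis subset_antisym order_refl)

lemma cls_image_psubset_iff: "lid J \<Longrightarrow> lid K \<Longrightarrow> cls ` J \<subset> cls ` K \<longleftrightarrow> J \<subset> K"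
  by (auto simp: psubset_eq cls_image_subset_iff cls_image_eq_iff)

lemma tsi_L_iff: "two_sided_ideal I L \<longleftrightarrow> (\<exists>J. lid J \<and> I = cls ` J)"
proof
  assume I: "two_sided_ideal I L"
  define J where "J = {x \<in> C. cls x \<in> I}"
  have sub: "I \<subseteq> cls ` C" and z: "cls 0 \<in> I" and add: "\<And>x y. x \<in> I \<Longrightarrow> y \<in> I \<Longrightarrow> x \<oplus>\<^bsub>L\<^esub> y \<in> I"
    and minus: "\<And>x. x \<in> I \<Longrightarrow> \<ominus>\<^bsub>L\<^esub> x \<in> I"
    and mult: "\<And>a x. a \<in> I \<Longrightarrow> x \<in> C \<Longrightarrow> cls x \<otimes>\<^bsub>L\<^esub> a \<in> I \<and> a \<otimes>\<^bsub>L\<^esub> cls x \<in> I"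
    using I unfolding two_sided_ideal_def additive_subgroup_iff[OF abelian_group_L]
    by (auto simp: L_carrier L_zero)
  have "R \<subseteq> J" using z R_sub by (auto simp: J_def cls_eq_iff[of _ 0, simplified])
    (metis cls_eq_iff diff_zero)
  moreover have "x - y \<in> J" if "x \<in> J" "y \<in> J" for x y
  proof -
    have "cls x \<oplus>\<^bsub>L\<^esub> (\<ominus>\<^bsub>L\<^esub> cls y) \<in> I" using that by (intro add minus) (auto simp: J_def)
    then have "cls (x - y) \<in> I" using that by (simp add: J_def a_inv_L L_add)
    then show ?thesis using that by (auto simp: J_def C_diff)
  qed
  moreover have "x * a \<in> J \<and> a * x \<in> J" if "a \<in> J" "x \<in> C" for a x
    using that mult[of "cls a" x] by (auto simp: J_def C_mult L_mult)
  ultimately have "lid J" by (auto simp: lid_def J_def)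
  moreover have "I = cls ` J" using sub by (auto simp: J_def)
  ultimately show "\<exists>J. lid J \<and> I = cls ` J" by blast
next
  assume "\<exists>J. lid J \<and> I = cls ` J"
  then obtain J where J: "lid J" "I = cls ` J" by blast
  show "two_sided_ideal I L"
    unfolding two_sided_ideal_def additive_subgroup_iff[OF abelian_group_L] L_carrier J(2)
    using lid_sub[OF J(1)] lid_mult[OF J(1)] lid_zero[OF J(1)] lid_add[OF J(1)] lid_uminus[OF J(1)]
    by (auto simp: L_add L_zero a_inv_L L_mult)
qed

definition lprime :: "('v,'e,'k::field) free_elem set \<Rightarrow> bool" where
  "lprime P \<longleftrightarrow> lid P \<and> P \<noteq> C \<and>
     (\<forall>A B. lid A \<longrightarrow> lid B \<longrightarrow> (\<forall>a\<in>A. \<forall>b\<in>B. a * b \<in> P) \<longrightarrow> A \<subseteq> P \<or> B \<subseteq> P)"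

lemma all_tsi_L: "(\<forall>I. two_sided_ideal I L \<longrightarrow> Q I) \<longleftrightarrow> (\<forall>J. lid J \<longrightarrow> Q (cls ` J))"
  by (auto simp: tsi_L_iff)

lemma prime_ideal_iff: "prime_ideal I L \<longleftrightarrow> (\<exists>P. lprime P \<and> I = cls ` P)"
  for I :: "('v,'e,'k::field) lpa_elem set"
proof -
  have "prime_ideal (cls ` P) L \<longleftrightarrow> lprime P" if P: "lid P" for P :: "('v,'e,'k) free_elem set"
  proof -
    have "prime_ideal (cls ` P) L \<longleftrightarrow> P \<noteq> C \<and> (\<forall>A. two_sided_ideal A L \<longrightarrow> (\<forall>B. two_sided_ideal B L \<longrightarrow>
        (\<forall>a\<in>A. \<forall>b\<in>B. a \<otimes>\<^bsub>L\<^esub> b \<in> cls ` P) \<longrightarrow> A \<subseteq> cls ` P \<or> B \<subseteq> cls ` P))"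
      using P cls_image_eq_iff[OF P lid_C] by (auto simp: prime_ideal_def tsi_L_iff L_carrier)
    also have "\<dots> \<longleftrightarrow> P \<noteq> C \<and> (\<forall>A. lid A \<longrightarrow> (\<forall>B. lid B \<longrightarrow>
        (\<forall>a\<in>A. \<forall>b\<in>B. cls a \<otimes>\<^bsub>L\<^esub> cls b \<in> cls ` P) \<longrightarrow> cls ` A \<subseteq> cls ` P \<or> cls ` B \<subseteq> cls ` P))"
      by (simp only: all_tsi_L ball_simps)
    also have "\<dots> \<longleftrightarrow> lprime P"
    proof -
      have "(\<forall>a\<in>A. \<forall>b\<in>B. cls a \<otimes>\<^bsub>L\<^esub> cls b \<in> cls ` P) \<longleftrightarrow> (\<forall>a\<in>A. \<forall>b\<in>B. a * b \<in> P)"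
        if "lid A" "lid B" for A B
        using lid_sub[OF that(1)] lid_sub[OF that(2)] by (simp add: L_mult cls_mem_iff[OF P])
      then show ?thesis using P by (simp add: lprime_def cls_image_subset_iff[OF _ P])
    qed
    finally show ?thesis .
  qed
  moreover have "\<exists>P. lid P \<and> I = cls ` P" if "prime_ideal I L"
    using that by (simp add: prime_ideal_def tsi_L_iff)
  ultimately show ?thesis by (metis lprime_def)
qed

lemma all_prime_L: "(\<forall>I. prime_ideal I L \<and> Q I \<longrightarrow> W I) \<longleftrightarrow> (\<forall>P. lprime P \<and> Q (cls ` P) \<longrightarrow> W (cls ` P))"
  by (auto simp: prime_ideal_iff)

lemma lprimeD_lid: "lprime P \<Longrightarrow> lid P"
  by (simp add: lprime_def)

lemma locally_closed_iff:
  fixes P :: "('v,'e,'k::field) free_elem set"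
  assumes "lid P"
  shows "locally_closed (cls ` P) L \<longleftrightarrow> (\<exists>a\<in>C. a \<notin> P \<and> (\<forall>Q. lprime Q \<and> P \<subset> Q \<longrightarrow> a \<in> Q))"
proof -
  let ?M = "carrier L \<inter> \<Inter> {Q. prime_ideal Q L \<and> cls ` P \<subset> Q}"
  have "cls ` P \<subseteq> ?M" using lid_sub[OF assms] by (auto simp: L_carrier)
  then have "locally_closed (cls ` P) L \<longleftrightarrow> (\<exists>x \<in> ?M. x \<notin> cls ` P)"
    unfolding locally_closed_def by blast
  also have "\<dots> \<longleftrightarrow> (\<exists>a\<in>C. a \<notin> P \<and> cls a \<in> ?M)"
  proof
    assume "\<exists>x \<in> ?M. x \<notin> cls ` P"
    then obtain x where x: "x \<in> ?M" "x \<notin> cls ` P" by blast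
    then obtain a where "a \<in> C" "x = cls a" by (auto simp: L_carrier)
    then show "\<exists>a\<in>C. a \<notin> P \<and> cls a \<in> ?M" using x by blast
  next
    assume "\<exists>a\<in>C. a \<notin> P \<and> cls a \<in> ?M"
    then show "\<exists>x \<in> ?M. x \<notin> cls ` P" using cls_mem_iff[OF assms] by blast
  qed
  also have "\<dots> \<longleftrightarrow> (\<exists>a\<in>C. a \<notin> P \<and> (\<forall>Q. lprime Q \<and> P \<subset> Q \<longrightarrow> a \<in> Q))"
  proof (intro bex_cong refl conj_cong)
    fix a :: "('v,'e,'k) free_elem" assume "a \<in> C"
    have "cls a \<in> ?M \<longleftrightarrow> (\<forall>Q. prime_ideal Q L \<and> cls ` P \<subset> Q \<longrightarrow> cls a \<in> Q)"
      using \<open>a \<in> C\<close> by (auto simp: L_carrier)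
    also have "\<dots> \<longleftrightarrow> (\<forall>Q. lprime Q \<and> cls ` P \<subset> cls ` Q \<longrightarrow> cls a \<in> cls ` Q)"
      by (simp only: all_prime_L)
    also have "\<dots> \<longleftrightarrow> (\<forall>Q. lprime Q \<and> P \<subset> Q \<longrightarrow> a \<in> Q)"
      by (simp add: cls_image_psubset_iff[OF assms] cls_mem_iff lprimeD_lid cong: conj_cong)
    finally show "cls a \<in> ?M \<longleftrightarrow> (\<forall>Q. lprime Q \<and> P \<subset> Q \<longrightarrow> a \<in> Q)" .
  qed
  finally show ?thesis .
qed

lemma maximal_not_containing_iff:
  assumes "lid P" 
  shows "maximal_not_containing (cls ` P) (cls a) L \<longleftrightarrow> a \<notin> P \<and> (\<forall>Q. lid Q \<and> P \<subset> Q \<longrightarrow> a \<in> Q)"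
proof -
  have "maximal_not_containing (cls ` P) (cls a) L \<longleftrightarrow>
    a \<notin> P \<and> (\<forall>J. two_sided_ideal J L \<longrightarrow> cls a \<notin> J \<longrightarrow> cls ` P \<subseteq> J \<longrightarrow> J = cls ` P)"
    using assms cls_mem_iff[OF assms] by (auto simp: maximal_not_containing_def tsi_L_iff)
  also have "\<dots> \<longleftrightarrow> a \<notin> P \<and> (\<forall>J. lid J \<longrightarrow> cls a \<notin> cls ` J \<longrightarrow> cls ` P \<subseteq> cls ` J \<longrightarrow> cls ` J = cls ` P)"
    by (simp only: all_tsi_L)
  also have "\<dots> \<longleftrightarrow> a \<notin> P \<and> (\<forall>Q. lid Q \<and> P \<subset> Q \<longrightarrow> a \<in> Q)"
    by (auto simp: cls_mem_iff cls_image_subset_iff[OF assms] cls_image_eq_iff[OF _ assms])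
  finally show ?thesis .
qed

lemma completely_irreducible_iff:
  fixes P :: "('v,'e,'k::field) free_elem set"
  assumes "lid P"
  shows "completely_irreducible (cls ` P) L \<longleftrightarrow> (\<exists>a\<in>C. a \<notin> P \<and> (\<forall>Q. lid Q \<and> P \<subset> Q \<longrightarrow> a \<in> Q))"
proof -
  let ?M = "carrier L \<inter> \<Inter> {Q. two_sided_ideal Q L \<and> cls ` P \<subset> Q}"
  have "cls ` P \<subseteq> ?M" using lid_sub[OF assms] by (auto simp: L_carrier)
  then have "completely_irreducible (cls ` P) L \<longleftrightarrow> (\<exists>x \<in> ?M. x \<notin> cls ` P)"
    unfolding completely_irreducible_def by blast
  also have "\<dots> \<longleftrightarrow> (\<exists>a\<in>C. a \<notin> P \<and> cls a \<in> ?M)"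
  proof
    assume "\<exists>x \<in> ?M. x \<notin> cls ` P"
    then obtain x where x: "x \<in> ?M" "x \<notin> cls ` P" by blast
    then obtain a where "a \<in> C" "x = cls a" by (auto simp: L_carrier)
    then show "\<exists>a\<in>C. a \<notin> P \<and> cls a \<in> ?M" using x by blast
  next
    assume "\<exists>a\<in>C. a \<notin> P \<and> cls a \<in> ?M"
    then show "\<exists>x \<in> ?M. x \<notin> cls ` P" using cls_mem_iff[OF assms] by blast
  qed
  also have "\<dots> \<longleftrightarrow> (\<exists>a\<in>C. a \<notin> P \<and> (\<forall>Q. lid Q \<and> P \<subset> Q \<longrightarrow> a \<in> Q))"
  proof (intro bex_cong refl conj_cong)
    fix a :: "('v,'e,'k) free_elem" assume "a \<in> C"
    have "cls a \<in> ?M \<longleftrightarrow> (\<forall>Q. lid Q \<and> cls ` P \<subset> cls ` Q \<longrightarrow> cls a \<in> cls ` Q)"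
      using \<open>a \<in> C\<close> unfolding tsi_L_iff by (auto simp: L_carrier)
    also have "\<dots> \<longleftrightarrow> (\<forall>Q. lid Q \<and> P \<subset> Q \<longrightarrow> a \<in> Q)"
      by (simp add: cls_image_psubset_iff[OF assms] cls_mem_iff cong: conj_cong)
    finally show "cls a \<in> ?M \<longleftrightarrow> (\<forall>Q. lid Q \<and> P \<subset> Q \<longrightarrow> a \<in> Q)" .
  qed
  finally show ?thesis .
qed

text \<open>
  If \<open>A\<close> and \<open>B\<close> both contain the idempotent \<open>e\<close> modulo \<open>Q\<close>, then \<open>A * B\<close> contains
  \<open>e * e = e\<close> modulo \<open>Q\<close>; so an ideal that is maximal among those avoiding \<open>e\<close> is prime.
\<close>

lemma prime_avoiding_idempotent:
  assumes J: "lid J" and e: "e \<in> C" "e \<notin> J" "e * e - e \<in> J"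
  obtains Q where "lprime Q" "J \<subseteq> Q" "e \<notin> Q"
proof -
  define \<A> where "\<A> = {Q. lid Q \<and> J \<subseteq> Q \<and> e \<notin> Q}"
  have "\<exists>M\<in>\<A>. \<forall>X\<in>\<A>. M \<subseteq> X \<longrightarrow> X = M"
  proof (rule subset_Zorn_nonempty)
    show "\<A> \<noteq> {}" using J e by (auto simp: \<A>_def)
    fix \<C> assume "\<C> \<noteq> {}" and "subset.chain \<A> \<C>"
    then have "subset.chain UNIV \<C>" "\<C> \<subseteq> \<A>" by (auto simp: subset_chain_def)
    moreover have "lid X" "J \<subseteq> X" "e \<notin> X" if "X \<in> \<C>" for X
      using that \<open>\<C> \<subseteq> \<A>\<close> by (auto simp: \<A>_def)
    ultimately show "\<Union>\<C> \<in> \<A>" using \<open>\<C> \<noteq> {}\<close> lid_Union[of \<C>] unfolding \<A>_def by blast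
  qed
  then obtain Q where QA: "Q \<in> \<A>" and maxA: "\<And>X. X \<in> \<A> \<Longrightarrow> Q \<subseteq> X \<Longrightarrow> X = Q" by blast
  have Q: "lid Q" "J \<subseteq> Q" "e \<notin> Q" using QA by (auto simp: \<A>_def)
  have max: "X = Q" if "lid X" "Q \<subseteq> X" "e \<notin> X" for X
    using that Q(2) by (intro maxA) (auto simp: \<A>_def)
  \<comment> \<open>an ideal \<open>A\<close> outside \<open>Q\<close> makes \<open>Q + A\<close> too large to avoid \<open>e\<close>\<close>
  have sum: "\<exists>q\<in>Q. \<exists>a\<in>A. e = q + a" if A: "lid A" "\<not> A \<subseteq> Q" for A
  proof -
    define X where "X = {q + a | q a. q \<in> Q \<and> a \<in> A}"
    have "x - y \<in> X" if xy: "x \<in> X" "y \<in> X" for x y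
    proof -
      obtain q a q' a' where qa: "x = q + a" "y = q' + a'" "q \<in> Q" "a \<in> A" "q' \<in> Q" "a' \<in> A"
        using xy unfolding X_def by blast
      have "x - y = (q - q') + (a - a')" by (simp add: qa)
      then show ?thesis unfolding X_def using qa lid_diff Q(1) A(1) by blast
    qed
    moreover have "z * x \<in> X \<and> x * z \<in> X" if xz: "x \<in> X" "z \<in> C" for x z
    proof -
      obtain q a where "x = q + a" "q \<in> Q" "a \<in> A" using xz unfolding X_def by blast
      then have "z * x = z * q + z * a" "x * z = q * z + a * z"
        "z * q \<in> Q" "q * z \<in> Q" "z * a \<in> A" "a * z \<in> A"
        using lid_mult Q(1) A(1) xz(2) by (auto simp: algebra_simps)
      then show ?thesis unfolding X_def by blast
    qed
    moreover have QX: "Q \<subseteq> X" "A \<subseteq> X"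
      using lid_zero[OF Q(1)] lid_zero[OF A(1)] unfolding X_def by force+
    moreover have "X \<subseteq> C" unfolding X_def using lid_sub Q(1) A(1) C_add by blast
    ultimately have "lid X" using lid_R[OF Q(1)] unfolding lid_def by blast
    then have "e \<in> X" using max[of X] QX A(2) by blast
    then show ?thesis unfolding X_def by blast
  qed
  have "A \<subseteq> Q \<or> B \<subseteq> Q" if AB: "lid A" "lid B" "\<forall>a\<in>A. \<forall>b\<in>B. a * b \<in> Q" for A B
  proof (rule ccontr)
    assume "\<not> (A \<subseteq> Q \<or> B \<subseteq> Q)"
    then obtain q a q' b where *: "q \<in> Q" "a \<in> A" "e = q + a" "q' \<in> Q" "b \<in> B" "e = q' + b"
      using sum AB by metis
    have "q' + b \<in> C" "a \<in> C" using * e lid_sub AB(1) by auto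
    then have "q * (q' + b) \<in> Q" "a * q' \<in> Q" "a * b \<in> Q"
      using lid_mult[OF Q(1) *(1)] lid_mult[OF Q(1) *(4)] * AB(3) by auto
    then have "q * (q' + b) + (a * q' + a * b) \<in> Q"
      by (intro lid_add Q(1))
    moreover have "e * e = q * (q' + b) + (a * q' + a * b)"
      using arg_cong2[OF *(3) *(6), of "(*)"] by (simp add: algebra_simps)
    ultimately have "e * e \<in> Q" by simp
    then show False using lid_cong[OF Q(1), of "e * e" e] Q e by blast
  qed
  then have "lprime Q" using Q e by (auto simp: lprime_def)
  then show ?thesis using that Q by blast
qed

end

section \<open>Leavitt families\<close>

text \<open>
  Elements of a ring that satisfy the defining relations of the Leavitt path algebra of \<open>G\<close> over a field.
  The scalars act through elements \<open>\<kappa> c\<close> that commute with the family; since \<open>\<kappa> 1\<close> is only required to fix the vertices,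
  the family may generate a subring without identity.
\<close>

locale leavitt_family = wf_digraph G for G :: "('w,'f) pre_digraph" +
  fixes \<kappa> :: "'k::field \<Rightarrow> 'a::ring_1" and p :: "'w \<Rightarrow> 'a" and s t :: "'f \<Rightarrow> 'a"
  assumes \<kappa>_add: "\<kappa> (c + d) = \<kappa> c + \<kappa> d" and \<kappa>_mult: "\<kappa> (c * d) = \<kappa> c * \<kappa> d"
    and \<kappa>_p: "v \<in> verts G \<Longrightarrow> p v * \<kappa> c = \<kappa> c * p v"
    and \<kappa>_s: "e \<in> arcs G \<Longrightarrow> s e * \<kappa> c = \<kappa> c * s e"
    and \<kappa>_t: "e \<in> arcs G \<Longrightarrow> t e * \<kappa> c = \<kappa> c * t e"
    and \<kappa>_one: "v \<in> verts G \<Longrightarrow> \<kappa> 1 * p v = p v"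
    and p_idem: "v \<in> verts G \<Longrightarrow> p v * p v = p v"
    and p_orth: "v \<in> verts G \<Longrightarrow> w \<in> verts G \<Longrightarrow> v \<noteq> w \<Longrightarrow> p v * p w = 0"
    and s_source: "e \<in> arcs G \<Longrightarrow> p (tail G e) * s e = s e"
    and s_range: "e \<in> arcs G \<Longrightarrow> s e * p (head G e) = s e"
    and t_source: "e \<in> arcs G \<Longrightarrow> p (head G e) * t e = t e"
    and t_range: "e \<in> arcs G \<Longrightarrow> t e * p (tail G e) = t e"
    and ts_same: "e \<in> arcs G \<Longrightarrow> t e * s e = p (head G e)"
    and ts_diff: "e \<in> arcs G \<Longrightarrow> f \<in> arcs G \<Longrightarrow> e \<noteq> f \<Longrightarrow> t e * s f = 0"
    and CK2: "regular_vertex G v \<Longrightarrow> p v = (\<Sum>e\<in>out_arcs G v. s e * t e)"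
begin

primrec S :: "'f list \<Rightarrow> 'a" where
  "S [] = 1"
| "S (e # \<alpha>) = s e * S \<alpha>"

primrec T :: "'f list \<Rightarrow> 'a" where
  "T [] = 1"
| "T (e # \<alpha>) = T \<alpha> * t e"

lemma S_append: "S (\<alpha> @ \<beta>) = S \<alpha> * S \<beta>"
  by (induction \<alpha>) (simp_all add: mult.assoc)

lemma T_append: "T (\<alpha> @ \<beta>) = T \<beta> * T \<alpha>"
  by (induction \<alpha>) (simp_all add: mult.assoc)

lemma \<kappa>_zero [simp]: "\<kappa> 0 = 0"
  using \<kappa>_add[of 0 0] by simp

lemma \<kappa>_S: "set \<alpha> \<subseteq> arcs G \<Longrightarrow> S \<alpha> * \<kappa> c = \<kappa> c * S \<alpha>"
proof (induction \<alpha>)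
  case (Cons e \<alpha>)
  have "S (e # \<alpha>) * \<kappa> c = s e * (\<kappa> c * S \<alpha>)" using Cons by (simp add: mult.assoc)
  also have "\<dots> = \<kappa> c * s e * S \<alpha>" using Cons \<kappa>_s[of e c] by (simp add: mult.assoc[symmetric])
  finally show ?case by (simp add: mult.assoc)
qed simp

lemma \<kappa>_T: "set \<alpha> \<subseteq> arcs G \<Longrightarrow> T \<alpha> * \<kappa> c = \<kappa> c * T \<alpha>"
proof (induction \<alpha>)
  case (Cons e \<alpha>)
  have "T (e # \<alpha>) * \<kappa> c = T \<alpha> * (\<kappa> c * t e)" using Cons \<kappa>_t[of e c] by (simp add: mult.assoc)
  also have "\<dots> = \<kappa> c * T \<alpha> * t e" using Cons by (simp add: mult.assoc[symmetric])
  finally show ?case by (simp add: mult.assoc)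
qed simp

lemma p_s: "e \<in> arcs G \<Longrightarrow> v \<in> verts G \<Longrightarrow> p v * s e = (if tail G e = v then s e else 0)"
  using s_source p_orth[of v "tail G e"] by (auto simp: mult.assoc) (metis mult.assoc mult_zero_left tail_in_verts)

lemma s_p: "e \<in> arcs G \<Longrightarrow> v \<in> verts G \<Longrightarrow> s e * p v = (if head G e = v then s e else 0)"
  using s_range p_orth[of "head G e" v] by (auto simp: mult.assoc) (metis mult.assoc mult_zero_right head_in_verts)

lemma p_t: "e \<in> arcs G \<Longrightarrow> v \<in> verts G \<Longrightarrow> p v * t e = (if head G e = v then t e else 0)"
  using t_source p_orth[of v "head G e"] by (auto simp: mult.assoc) (metis mult.assoc mult_zero_left head_in_verts)

lemma t_p: "e \<in> arcs G \<Longrightarrow> v \<in> verts G \<Longrightarrow> t e * p v = (if tail G e = v then t e else 0)"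
  using t_range p_orth[of "tail G e" v] by (auto simp: mult.assoc) (metis mult.assoc mult_zero_right tail_in_verts)

lemma p_p: "v \<in> verts G \<Longrightarrow> w \<in> verts G \<Longrightarrow> p v * p w = (if v = w then p v else 0)"
  using p_idem p_orth by auto

lemma ts: "e \<in> arcs G \<Longrightarrow> f \<in> arcs G \<Longrightarrow> t e * s f = (if e = f then p (head G e) else 0)"
  using ts_same ts_diff by auto

lemma awalk_Cons: "awalk u (e # \<alpha>) w \<longleftrightarrow> e \<in> arcs G \<and> tail G e = u \<and> awalk (head G e) \<alpha> w"
  by (auto simp: awalk_Cons_iff)

lemma S_end: "awalk u \<alpha> w \<Longrightarrow> p u * S \<alpha> * p w = p u * S \<alpha>"
proof (induction \<alpha> arbitrary: u)
  case Nil
  then show ?case by (auto simp: awalk_Nil_iff p_idem)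
next
  case (Cons e \<alpha>)
  then have e: "e \<in> arcs G" "tail G e = u" "awalk (head G e) \<alpha> w" by (auto simp: awalk_Cons)
  have "p u * S (e # \<alpha>) = s e * (p (head G e) * S \<alpha>)"
    using s_source[OF e(1)] s_range[OF e(1)] e by (simp add: mult.assoc[symmetric])
  moreover have "s e * (p (head G e) * S \<alpha> * p w) = s e * (p (head G e) * S \<alpha>)"
    using Cons.IH[OF e(3)] by simp
  ultimately show ?case by (metis mult.assoc)
qed

lemma S_start: "awalk u \<alpha> w \<Longrightarrow> \<alpha> \<noteq> [] \<Longrightarrow> p u * S \<alpha> = S \<alpha>"
  by (cases \<alpha>) (auto simp: awalk_Cons s_source mult.assoc[symmetric])

lemma T_end: "awalk u \<alpha> w \<Longrightarrow> p w * (T \<alpha> * p u) = T \<alpha> * p u"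
proof (induction \<alpha> arbitrary: u)
  case Nil
  then show ?case by (auto simp: awalk_Nil_iff p_idem)
next
  case (Cons e \<alpha>)
  then have e: "e \<in> arcs G" "tail G e = u" "awalk (head G e) \<alpha> w" by (auto simp: awalk_Cons)
  have "T (e # \<alpha>) * p u = (T \<alpha> * p (head G e)) * t e"
    using t_source[OF e(1)] t_range[OF e(1)] e by (simp add: mult.assoc)
  then show ?case using Cons.IH[OF e(3)] by (metis mult.assoc)
qed

lemma T_start: "awalk u \<alpha> w \<Longrightarrow> \<alpha> \<noteq> [] \<Longrightarrow> T \<alpha> * p u = T \<alpha>"
  by (cases \<alpha>) (auto simp: awalk_Cons t_range mult.assoc)

text \<open>
  Ghost paths cancel initial segments: \<open>\<alpha>\<^sup>*\<beta>\<close> is \<open>\<gamma>\<close> if \<open>\<beta> = \<alpha>\<gamma>\<close>, and zero if the two paths part before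
  the end of \<open>\<alpha>\<close>. All products that occur in the reduction are of this kind.
\<close>

lemma T_S:
  assumes "awalk u \<alpha> w" "awalk u \<beta> w'" "length \<alpha> \<le> length \<beta>"
  shows "T \<alpha> * p u * S \<beta> = (if take (length \<alpha>) \<beta> = \<alpha> then p w * S (drop (length \<alpha>) \<beta>) else 0)"
  using assms
proof (induction \<alpha> arbitrary: u \<beta>)
  case Nil
  then show ?case by (simp add: awalk_Nil_iff)
next
  case (Cons a \<alpha>)
  then obtain b \<beta>' where \<beta>: "\<beta> = b # \<beta>'" by (cases \<beta>) auto
  have a: "a \<in> arcs G" "tail G a = u" "awalk (head G a) \<alpha> w" using Cons.prems by (auto simp: awalk_Cons)
  have b: "b \<in> arcs G" "tail G b = u" "awalk (head G b) \<beta>' w'" using Cons.prems by (auto simp: awalk_Cons \<beta>)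
  have "T (a # \<alpha>) * p u * S \<beta> = T \<alpha> * (t a * (p u * s b)) * S \<beta>'"
    by (simp add: \<beta> mult.assoc)
  also have "\<dots> = T \<alpha> * (if a = b then p (head G a) else 0) * S \<beta>'"
    using a b s_source[of b] ts[of a b] by auto
  finally show ?case
    using Cons.IH[of "head G a" \<beta>'] a b Cons.prems(3) by (auto simp: \<beta>)
qed

lemma T_S_same: "awalk u \<alpha> w \<Longrightarrow> T \<alpha> * p u * S \<alpha> = p w"
  using T_S[of u \<alpha> w \<alpha> w] by simp

text \<open>
  \<open>span_upto n\<close> is spanned by the elements \<open>\<alpha>\<beta>\<^sup>*\<close> with \<open>\<beta>\<close> of length at most \<open>n\<close>; in particular
  \<open>span_upto 0\<close> is spanned by the paths.
\<close>

inductive span_upto :: "nat \<Rightarrow> 'a \<Rightarrow> bool" for n where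
  zero: "span_upto n 0"
| add: "span_upto n x \<Longrightarrow> awalk u \<alpha> w \<Longrightarrow> awalk v \<beta> w \<Longrightarrow> length \<beta> \<le> n \<Longrightarrow>
    span_upto n (\<kappa> c * (p u * S \<alpha> * (T \<beta> * p v)) + x)"

lemma span_mono: "span_upto n x \<Longrightarrow> n \<le> m \<Longrightarrow> span_upto m x"
  by (induction rule: span_upto.induct) (auto intro: span_upto.intros)

lemma span_add: "span_upto n x \<Longrightarrow> span_upto n y \<Longrightarrow> span_upto n (x + y)"
  by (induction rule: span_upto.induct) (auto simp: add.assoc intro: span_upto.intros)

lemma span_scale: "span_upto n x \<Longrightarrow> span_upto n (\<kappa> c * x)"
proof (induction rule: span_upto.induct)
  case (add x u \<alpha> w v \<beta> d)
  from span_upto.add[OF add(5,2,3,4), of "c * d"] show ?case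
    by (simp add: \<kappa>_mult distrib_left mult.assoc)
qed (auto intro: span_upto.intros)

lemma span_monomial: "awalk u \<alpha> w \<Longrightarrow> awalk v \<beta> w \<Longrightarrow> length \<beta> \<le> n \<Longrightarrow>
    span_upto n (\<kappa> c * (p u * S \<alpha> * (T \<beta> * p v)))"
  using span_upto.add[OF span_upto.zero] by fastforce

lemma \<kappa>_one_p: "v \<in> verts G \<Longrightarrow> \<kappa> 1 * (p v * x) = p v * x"
  by (simp add: \<kappa>_one mult.assoc[symmetric])

lemma span_monomial_one: "awalk u \<alpha> w \<Longrightarrow> awalk v \<beta> w \<Longrightarrow> length \<beta> \<le> n \<Longrightarrow>
    span_upto n (p u * S \<alpha> * (T \<beta> * p v))"
  using span_monomial[of u \<alpha> w v \<beta> n 1] \<kappa>_one_p[of u] awalk_hd_in_verts[of u \<alpha> w] by (simp add: mult.assoc)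

lemma span_p: "v \<in> verts G \<Longrightarrow> span_upto n (p v)"
  using span_monomial_one[of v "[]" v v "[]" n] by (simp add: awalk_Nil_iff p_idem)

lemma span_s: "e \<in> arcs G \<Longrightarrow> span_upto n (s e)"
  using span_monomial_one[of "tail G e" "[e]" "head G e" "head G e" "[]" n]
  by (simp add: awalk_Nil_iff awalk_Cons s_source s_range)

lemma span_t: "e \<in> arcs G \<Longrightarrow> span_upto 1 (t e)"
  using span_monomial_one[of "head G e" "[]" "head G e" "tail G e" "[e]" 1]
  by (simp add: awalk_Nil_iff awalk_Cons t_source t_range)

lemma span_p_left:
  assumes "span_upto n x" "v \<in> verts G" shows "span_upto n (p v * x)"
  using assms
proof (induction rule: span_upto.induct)
  case (add x u \<alpha> w v' \<beta> c)
  have u: "u \<in> verts G" using add awalk_hd_in_verts by blast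
  have "p v * (\<kappa> c * (p u * S \<alpha> * (T \<beta> * p v'))) = \<kappa> c * ((p v * p u) * S \<alpha> * (T \<beta> * p v'))"
    using \<kappa>_p[OF \<open>v \<in> verts G\<close>] by (simp add: mult.assoc[symmetric])
  then show ?case using add span_upto.add[of n _ u \<alpha> w v' \<beta> c] u
    by (auto simp: distrib_left p_p)
qed (auto intro: span_upto.intros)

lemma span_p_right:
  assumes "span_upto n x" "v \<in> verts G" shows "span_upto n (x * p v)"
  using assms
proof (induction rule: span_upto.induct)
  case (add x u \<alpha> w v' \<beta> c)
  have u: "v' \<in> verts G" using add awalk_hd_in_verts by blast
  have "\<kappa> c * (p u * S \<alpha> * (T \<beta> * p v')) * p v = \<kappa> c * (p u * S \<alpha> * (T \<beta> * (p v' * p v)))"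
    by (simp add: mult.assoc)
  then show ?case using add span_upto.add[of n _ u \<alpha> w v' \<beta> c] u
    by (auto simp: distrib_right p_p)
qed (auto intro: span_upto.intros)

lemma span_s_left:
  assumes "span_upto n x" "e \<in> arcs G" shows "span_upto n (s e * x)"
  using assms
proof (induction rule: span_upto.induct)
  case (add x u \<alpha> w v \<beta> c)
  have u: "u \<in> verts G" using add awalk_hd_in_verts by blast
  have "s e * (\<kappa> c * (p u * S \<alpha> * (T \<beta> * p v))) = \<kappa> c * ((s e * p u) * S \<alpha> * (T \<beta> * p v))"
    using \<kappa>_s[OF \<open>e \<in> arcs G\<close>] by (simp add: mult.assoc[symmetric])
  also have "\<dots> = (if head G e = u then \<kappa> c * (p (tail G e) * S (e # \<alpha>) * (T \<beta> * p v)) else 0)"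
    using s_source[OF \<open>e \<in> arcs G\<close>] s_p[OF \<open>e \<in> arcs G\<close> u] by (simp add: mult.assoc[symmetric])
  finally show ?case
    using add span_upto.add[of n "s e * x" "tail G e" "e # \<alpha>" w v \<beta> c] by (auto simp: distrib_left awalk_Cons)
qed (auto intro: span_upto.intros)

lemma span_t_left:
  assumes "span_upto n x" "e \<in> arcs G" shows "span_upto (Suc n) (t e * x)"
  using assms
proof (induction rule: span_upto.induct)
  case (add x u \<alpha> w v \<beta> c)
  have u: "u \<in> verts G" using add awalk_hd_in_verts by blast
  have eq: "t e * (\<kappa> c * (p u * S \<alpha> * (T \<beta> * p v))) = \<kappa> c * ((t e * p u) * S \<alpha> * (T \<beta> * p v))"
    using \<kappa>_t[OF \<open>e \<in> arcs G\<close>] by (simp add: mult.assoc[symmetric])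
  show ?case
  proof (cases "tail G e = u")
    case True
    show ?thesis
    proof (cases \<alpha>)
      case Nil
      then have "u = w" using add by (simp add: awalk_Nil_iff)
      have "(t e * p u) * S \<alpha> * (T \<beta> * p v) = p (head G e) * S [] * (T (\<beta> @ [e]) * p v)"
        using True Nil t_p[OF add(6) u] t_source[OF add(6)] by (simp add: T_append mult.assoc[symmetric])
      moreover have "awalk v (\<beta> @ [e]) (head G e)"
        using add(3,6) True \<open>u = w\<close> by (intro awalk_appendI[of v \<beta> w]) (auto simp: awalk_Cons awalk_Nil_iff)
      ultimately show ?thesis
        using eq span_upto.add[of "Suc n" "t e * x" "head G e" "[]" "head G e" v "\<beta> @ [e]" c] add
        by (simp add: distrib_left awalk_Nil_iff)
    next
      case (Cons a \<alpha>')
      then have a: "a \<in> arcs G" "tail G a = u" "awalk (head G a) \<alpha>' w" using add by (auto simp: awalk_Cons)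
      have "(t e * p u) * S \<alpha> * (T \<beta> * p v) = (t e * s a) * S \<alpha>' * (T \<beta> * p v)"
        using True Cons t_p[OF add(6) u] by (simp add: mult.assoc[symmetric])
      then show ?thesis using eq ts[OF add(6) a(1)] add a
          span_upto.add[of "Suc n" "t e * x" "head G a" "\<alpha>'" w v "\<beta>" c]
        by (auto simp: distrib_left)
    qed
  next
    case False
    then show ?thesis using add eq t_p[OF add(6) u] by (simp add: distrib_left)
  qed
qed (auto intro: span_upto.intros)

text \<open>
  Sorting the monomials \<open>\<alpha>\<beta>\<^sup>*\<close> by the first edge \<open>e\<close> of \<open>\<beta>\<close> prepares the induction on the length of the
  ghost paths; the normalisation of \<open>b e\<close> makes it recoverable as \<open>b e = (b e) e\<^sup>* e\<close>.
\<close>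

lemma span_decompose:
  assumes "span_upto (Suc n) a"
  obtains F a' b where "finite F" "F \<subseteq> arcs G" "span_upto 0 a'" "\<forall>e. span_upto n (b e)"
    "\<forall>e\<in>arcs G. b e * p (head G e) = b e" "\<forall>e. e \<notin> F \<longrightarrow> b e = 0" "a = a' + (\<Sum>e\<in>F. b e * t e)"
proof -
  have "\<exists>F a' b. finite F \<and> F \<subseteq> arcs G \<and> span_upto 0 a' \<and> (\<forall>e. span_upto n (b e)) \<and>
     (\<forall>e\<in>arcs G. b e * p (head G e) = b e) \<and> (\<forall>e. e \<notin> F \<longrightarrow> b e = 0) \<and> a = a' + (\<Sum>e\<in>F. b e * t e)"
    using assms
  proof (induction rule: span_upto.induct)
    case zero
    show ?case
      by (rule exI[of _ "{}"], rule exI[of _ 0], rule exI[of _ "\<lambda>_. 0"]) (auto intro: span_upto.intros)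
  next
    case (add x u \<alpha> w v \<beta> c)
    then obtain F a' b where *: "finite F" "F \<subseteq> arcs G" "span_upto 0 a'" "\<forall>e. span_upto n (b e)"
      "\<forall>e\<in>arcs G. b e * p (head G e) = b e" "\<forall>e. e \<notin> F \<longrightarrow> b e = 0" "x = a' + (\<Sum>e\<in>F. b e * t e)" by blast
    show ?case
    proof (cases \<beta>)
      case Nil
      have "span_upto 0 (\<kappa> c * (p u * S \<alpha> * (T \<beta> * p v)) + a')"
        using add * Nil by (intro span_upto.add) auto
      then show ?thesis using *
        by (intro exI[of _ F] exI[of _ "\<kappa> c * (p u * S \<alpha> * (T \<beta> * p v)) + a'"] exI[of _ b])
          (auto simp: add.assoc)
    next
      case (Cons e \<beta>')
      then have e: "e \<in> arcs G" "tail G e = v" "awalk (head G e) \<beta>' w" using add by (auto simp: awalk_Cons)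
      define m where "m = \<kappa> c * (p u * S \<alpha> * (T \<beta>' * p (head G e)))"
      have m: "span_upto n m" "m * p (head G e) = m" "m * t e = \<kappa> c * (p u * S \<alpha> * (T \<beta> * p v))"
      proof -
        show "span_upto n m"
          unfolding m_def using add(2,4) e Cons by (intro span_monomial) auto
        show "m * p (head G e) = m" using e by (simp add: m_def mult.assoc p_idem)
        show "m * t e = \<kappa> c * (p u * S \<alpha> * (T \<beta> * p v))"
          using e t_source[OF e(1)] t_range[OF e(1)] by (simp add: m_def mult.assoc Cons)
      qed
      define b' where "b' = b(e := m + b e)"
      have "(\<Sum>f\<in>F. b f * t f) = (\<Sum>f\<in>insert e F. b f * t f)"
        using * by (intro sum.mono_neutral_left) auto
      also have "\<dots> = b e * t e + (\<Sum>f\<in>F - {e}. b f * t f)"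
        using * by (simp add: sum.insert_remove)
      finally have "(\<Sum>f\<in>insert e F. b' f * t f) = m * t e + (\<Sum>f\<in>F. b f * t f)"
        using * by (simp add: sum.insert_remove b'_def distrib_right add.assoc)
      then have eq: "\<kappa> c * (p u * S \<alpha> * (T \<beta> * p v)) + x = a' + (\<Sum>f\<in>insert e F. b' f * t f)"
        using *(7) m(3) by (simp add: algebra_simps)
      have "span_upto n (b' f)" for f using *(4) m(1) by (simp add: b'_def span_add)
      moreover have "b' f * p (head G f) = b' f" if "f \<in> arcs G" for f
        using *(5) m(2) that e by (simp add: b'_def distrib_right)
      moreover have "b' f = 0" if "f \<notin> insert e F" for f using *(6) that by (simp add: b'_def)
      ultimately show ?thesis using *(1-3) e eq
        by (intro exI[of _ "insert e F"] exI[of _ a'] exI[of _ b'] conjI allI ballI impI) auto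
    qed
  qed
  then show ?thesis using that by blast
qed

lemma span_s_right_0:
  assumes "span_upto 0 x" "e \<in> arcs G" shows "span_upto 0 (x * s e)"
  using assms
proof (induction rule: span_upto.induct)
  case (add x u \<alpha> w v \<beta> c)
  have "\<beta> = []" "v = w" using add by (auto simp: awalk_Nil_iff)
  have v: "v \<in> verts G" using add awalk_hd_in_verts by blast
  have "\<kappa> c * (p u * S \<alpha> * (T \<beta> * p v)) * s e = \<kappa> c * (p u * S \<alpha> * (p v * s e))"
    by (simp add: \<open>\<beta> = []\<close> mult.assoc)
  also have "\<dots> = (if tail G e = v then \<kappa> c * (p u * S (\<alpha> @ [e]) * (T [] * p (head G e))) else 0)"
    using v add(6) by (simp add: p_s S_append mult.assoc s_range)
  finally have "\<kappa> c * (p u * S \<alpha> * (T \<beta> * p v)) * s e =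
    (if tail G e = v then \<kappa> c * (p u * S (\<alpha> @ [e]) * (T [] * p (head G e))) else 0)" .
  moreover have "awalk u (\<alpha> @ [e]) (head G e)" if "tail G e = v"
    using add that \<open>v = w\<close> by (intro awalk_appendI[of u \<alpha> w]) (auto simp: awalk_Cons awalk_Nil_iff)
  ultimately show ?case using add span_upto.add[of 0 "x * s e" u "\<alpha> @ [e]" "head G e" "head G e" "[]" c]
    by (auto simp: distrib_right awalk_Nil_iff)
qed (auto intro: span_upto.intros)

text \<open>
  There is no identity, but the sum of the finitely many vertices at which the occurring paths start
  acts as one on a given element.
\<close>

lemma span_local_unit:
  assumes "span_upto n a"
  obtains V where "finite V" "V \<subseteq> verts G" "a * (\<Sum>v\<in>V. p v) = a" "(\<Sum>v\<in>V. p v) * a = a"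
proof -
  have *: "p u * (\<Sum>v\<in>V. p v) = p u" "(\<Sum>v\<in>V. p v) * p u = p u" if "finite V" "V \<subseteq> verts G" "u \<in> V" for u V
  proof -
    have "(\<Sum>v\<in>V. p u * p v) = (\<Sum>v\<in>V. if v = u then p u else 0)"
      "(\<Sum>v\<in>V. p v * p u) = (\<Sum>v\<in>V. if v = u then p u else 0)"
      using that by (auto intro!: sum.cong simp: p_p subset_iff)
    moreover have "(\<Sum>v\<in>V. if v = u then p u else 0) = p u" using that by simp
    ultimately show "p u * (\<Sum>v\<in>V. p v) = p u" "(\<Sum>v\<in>V. p v) * p u = p u"
      using that by (simp_all add: sum_distrib_left sum_distrib_right)
  qed
  have "\<exists>V. finite V \<and> V \<subseteq> verts G \<and>
    (\<forall>V'. finite V' \<longrightarrow> V \<subseteq> V' \<longrightarrow> V' \<subseteq> verts G \<longrightarrow> a * (\<Sum>v\<in>V'. p v) = a \<and> (\<Sum>v\<in>V'. p v) * a = a)"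
    using assms
  proof (induction rule: span_upto.induct)
    case (add x u \<alpha> w v \<beta> c)
    then obtain V where V: "finite V" "V \<subseteq> verts G"
      "\<And>V'. finite V' \<Longrightarrow> V \<subseteq> V' \<Longrightarrow> V' \<subseteq> verts G \<Longrightarrow> x * (\<Sum>v\<in>V'. p v) = x \<and> (\<Sum>v\<in>V'. p v) * x = x" by blast
    have uv: "u \<in> verts G" "v \<in> verts G" using add awalk_hd_in_verts by blast+
    have "\<kappa> c * (p u * S \<alpha> * (T \<beta> * p v)) * (\<Sum>v\<in>V'. p v) = \<kappa> c * (p u * S \<alpha> * (T \<beta> * p v)) \<and>
       (\<Sum>v\<in>V'. p v) * (\<kappa> c * (p u * S \<alpha> * (T \<beta> * p v))) = \<kappa> c * (p u * S \<alpha> * (T \<beta> * p v))"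
      if "finite V'" "insert u (insert v V) \<subseteq> V'" "V' \<subseteq> verts G" for V'
    proof
      show "\<kappa> c * (p u * S \<alpha> * (T \<beta> * p v)) * (\<Sum>v\<in>V'. p v) = \<kappa> c * (p u * S \<alpha> * (T \<beta> * p v))"
        using that by (simp add: mult.assoc *)
      have "(\<Sum>v\<in>V'. p v) * \<kappa> c = \<kappa> c * (\<Sum>v\<in>V'. p v)"
        using that by (auto simp: sum_distrib_left sum_distrib_right \<kappa>_p intro!: sum.cong)
      then have "(\<Sum>v\<in>V'. p v) * (\<kappa> c * (p u * S \<alpha> * (T \<beta> * p v))) = \<kappa> c * (((\<Sum>v\<in>V'. p v) * p u) * S \<alpha> * (T \<beta> * p v))"
        by (metis mult.assoc)
      then show "(\<Sum>v\<in>V'. p v) * (\<kappa> c * (p u * S \<alpha> * (T \<beta> * p v))) = \<kappa> c * (p u * S \<alpha> * (T \<beta> * p v))"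
        using that by (simp add: *)
    qed
    then show ?case using V uv
      by (intro exI[of _ "insert u (insert v V)"]) (auto simp: distrib_left distrib_right)
  qed auto
  then show ?thesis using that by blast
qed

text \<open>
  Collecting equal paths gives each path at most one coefficient, so that coefficients can be compared.
\<close>

lemma paths_normal_form:
  assumes "span_upto 0 a"
  obtains Q k where "finite Q" "\<And>u \<alpha>. (u, \<alpha>) \<in> Q \<Longrightarrow> \<exists>w. awalk u \<alpha> w" "\<And>x. x \<in> Q \<Longrightarrow> k x \<noteq> 0"
    "a = (\<Sum>x\<in>Q. \<kappa> (k x) * (p (fst x) * S (snd x)))"
proof -
  have "\<exists>Q k. finite Q \<and> (\<forall>(u, \<alpha>) \<in> Q. \<exists>w. awalk u \<alpha> w) \<and> (\<forall>x. x \<notin> Q \<longrightarrow> k x = 0) \<and>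
    a = (\<Sum>x\<in>Q. \<kappa> (k x) * (p (fst x) * S (snd x)))"
    using assms
  proof (induction rule: span_upto.induct)
    case zero
    show ?case by (rule exI[of _ "{}"], rule exI[of _ "\<lambda>_. 0"]) auto
  next
    case (add x u \<alpha> w v \<beta> c)
    then obtain Q k where *: "finite Q" "\<forall>(u, \<alpha>) \<in> Q. \<exists>w. awalk u \<alpha> w" "\<forall>x. x \<notin> Q \<longrightarrow> k x = 0"
      "x = (\<Sum>x\<in>Q. \<kappa> (k x) * (p (fst x) * S (snd x)))" by blast
    have "\<beta> = []" "v = w" using add by (auto simp: awalk_Nil_iff)
    let ?x = "(u, \<alpha>)" let ?k = "k(?x := c + k ?x)"
    let ?f = "\<lambda>k x. \<kappa> (k x) * (p (fst x) * S (snd x))"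
    have "x = (\<Sum>x\<in>insert ?x Q. ?f k x)"
      unfolding *(4) using * by (intro sum.mono_neutral_left) auto
    also have "\<dots> = ?f k ?x + (\<Sum>x\<in>Q - {?x}. ?f k x)"
      using * by (simp add: sum.insert_remove)
    finally have "(\<Sum>x\<in>insert ?x Q. ?f ?k x) = \<kappa> c * (p u * S \<alpha>) + x"
      using * by (simp add: sum.insert_remove \<kappa>_add distrib_right add.assoc)
    also have "p u * S \<alpha> = p u * S \<alpha> * (T \<beta> * p v)"
      using S_end[OF add(2)] \<open>\<beta> = []\<close> \<open>v = w\<close> by simp
    finally show ?case using * add by (intro exI[of _ "insert ?x Q"] exI[of _ ?k]) auto
  qed
  then obtain Q k where *: "finite Q" "\<forall>(u, \<alpha>) \<in> Q. \<exists>w. awalk u \<alpha> w"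
    "a = (\<Sum>x\<in>Q. \<kappa> (k x) * (p (fst x) * S (snd x)))" by blast
  have "a = (\<Sum>x\<in>{x \<in> Q. k x \<noteq> 0}. \<kappa> (k x) * (p (fst x) * S (snd x)))"
    unfolding *(3) using *(1) by (intro sum.mono_neutral_right) auto
  moreover have "\<exists>w. awalk u \<alpha> w" if "(u, \<alpha>) \<in> Q" for u \<alpha> using that *(2) by blast
  ultimately show ?thesis using *(1) by (intro that[of "{x \<in> Q. k x \<noteq> 0}" k]) auto
qed

text \<open>
  An element is reduced by multiplying it with generators and scalars, so the reduction takes place
  inside any set of this kind. The examples that matter are \<open>{0}\<close> and images of ideals.
\<close>

definition gen_closed :: "'a set \<Rightarrow> bool" where
  "gen_closed J \<longleftrightarrow> (\<forall>x\<in>J. (\<forall>c. \<kappa> c * x \<in> J) \<and> (\<forall>v\<in>verts G. p v * x \<in> J \<and> x * p v \<in> J) \<and>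
     (\<forall>e\<in>arcs G. s e * x \<in> J \<and> x * s e \<in> J \<and> t e * x \<in> J \<and> x * t e \<in> J))"

lemma gen_closed_S: "gen_closed J \<Longrightarrow> x \<in> J \<Longrightarrow> set \<alpha> \<subseteq> arcs G \<Longrightarrow> x * S \<alpha> \<in> J"
  by (induction \<alpha> arbitrary: x) (auto simp: gen_closed_def mult.assoc[symmetric])

lemma gen_closed_T: "gen_closed J \<Longrightarrow> x \<in> J \<Longrightarrow> set \<alpha> \<subseteq> arcs G \<Longrightarrow> T \<alpha> * x \<in> J"
  by (induction \<alpha> arbitrary: x) (auto simp: gen_closed_def mult.assoc)

lemma gen_closed_p: "gen_closed J \<Longrightarrow> x \<in> J \<Longrightarrow> v \<in> verts G \<Longrightarrow> p v * x \<in> J"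
  "gen_closed J \<Longrightarrow> x \<in> J \<Longrightarrow> v \<in> verts G \<Longrightarrow> x * p v \<in> J"
  by (auto simp: gen_closed_def)

lemma gen_closed_unscale:
  assumes "gen_closed J" "\<kappa> c * p v \<in> J" "c \<noteq> 0" "v \<in> verts G"
  shows "p v \<in> J"
proof -
  have "\<kappa> (1 / c) * (\<kappa> c * p v) \<in> J" using assms by (auto simp: gen_closed_def)
  moreover have "\<kappa> (1 / c) * (\<kappa> c * p v) = p v"
    using \<kappa>_mult[of "1 / c" c] assms \<kappa>_one[of v] by (simp add: mult.assoc[symmetric])
  ultimately show ?thesis by simp
qed

end

section \<open>Cycles without exits\<close>

context wf_digraph
begin

lemma awalk_power: "awalk v c v \<Longrightarrow> awalk v (concat (replicate k c)) v"
  by (induction k) (auto simp: awalk_Nil_iff awalk_hd_in_verts intro: awalk_appendI)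

text \<open>
  A walk without exits leaves no choice: every walk that starts at its base point runs around it,
  and can be completed to a whole number of rounds.
\<close>

lemma walk_along_exitless:
  assumes c: "awalk v c v" "c \<noteq> []" "\<not> has_exit G c" and "awalk v \<alpha> w"
  obtains \<delta> k where "\<alpha> @ \<delta> = concat (replicate k c)" "awalk w \<delta> v"
proof -
  have "\<exists>\<delta> k. \<alpha> @ \<delta> = concat (replicate k c) \<and> awalk w \<delta> v"
    using \<open>awalk v \<alpha> w\<close>
  proof (induction \<alpha> arbitrary: w rule: rev_induct)
    case Nil
    then show ?case by (intro exI[of _ "[]"] exI[of _ 0]) (auto simp: awalk_Nil_iff)
  next
    case (snoc e \<alpha>)
    then have e: "awalk v \<alpha> (tail G e)" "e \<in> arcs G" "w = head G e"
      by (auto simp: awalk_Cons_iff awalk_Nil_iff)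
    from snoc.IH[OF e(1)] obtain \<delta>0 k0 where 0: "\<alpha> @ \<delta>0 = concat (replicate k0 c)" "awalk (tail G e) \<delta>0 v"
      by blast
    obtain \<delta> k where *: "\<alpha> @ \<delta> = concat (replicate k c)" "awalk (tail G e) \<delta> v" "\<delta> \<noteq> []"
    proof (cases "\<delta>0 = []")
      case True
      then have "tail G e = v" using 0 by (simp add: awalk_Nil_iff)
      moreover have "\<alpha> @ c = concat (replicate (Suc k0) c)"
      proof -
        have "concat (replicate (Suc k) c) = concat (replicate k c) @ c" for k by (induction k) auto
        then show ?thesis using 0 True by simp
      qed
      ultimately show ?thesis using that c by blast
    next
      case False
      then show ?thesis using that 0 by blast
    qed
    obtain d \<delta>' where \<delta>: "\<delta> = d # \<delta>'" using *(3) by (cases \<delta>) auto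
    then have d: "tail G d = tail G e" "awalk (head G d) \<delta>' v" using *(2) by (auto simp: awalk_Cons_iff)
    have "d \<in> set (concat (replicate k c))" unfolding *(1)[symmetric] \<delta> by simp
    then have "d \<in> set c" by auto
    then have "d = e" using c(3) d(1) e(2) unfolding has_exit_def by metis
    then show ?case using * \<delta> d e by (intro exI[of _ \<delta>'] exI[of _ k]) auto
  qed
  then show ?thesis using that by blast
qed

lemma cycle_distinct_tails:
  assumes "awalk v c v" "cycle c" shows "distinct (map (tail G) c)"
proof -
  obtain u where u: "awalk u c u" "distinct (tl (awalk_verts u c))" "c \<noteq> []"
    using assms(2) by (auto simp: cycle_def)
  then obtain e c' where c: "c = e # c'" by (cases c) auto
  then have "tail G e = u" "cas (head G e) c' u" using u by (auto simp: awalk_def)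
  then have "tl (awalk_verts u c) = (if c' = [] then [head G e] else map (tail G) c' @ [u])"
    using awlast_if_cas[of "head G e" c' u] by (auto simp: c awalk_verts_conv)
  then show ?thesis using u(2) \<open>tail G e = u\<close> by (auto simp: c split: if_splits)
qed

text \<open>
  Such a walk is an initial segment of a repetition of \<open>c\<close>, or has \<open>c\<close> as an initial segment; as a cycle
  does not return to \<open>v\<close> before its end, one can split off whole rounds.
\<close>

lemma closed_walks_are_powers:
  assumes c: "awalk v c v" "cycle c" "\<not> has_exit G c" and "awalk v \<alpha> v"
  shows "\<exists>k. \<alpha> = concat (replicate k c)"
  using \<open>awalk v \<alpha> v\<close>
proof (induction "length \<alpha>" arbitrary: \<alpha> rule: less_induct)
  case less
  have "c \<noteq> []" using c(2) by (auto simp: cycle_def)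
  show ?case
  proof (cases "\<alpha> = []")
    case True
    then show ?thesis by (intro exI[of _ 0]) simp
  next
    case False
    obtain \<delta> k where *: "\<alpha> @ \<delta> = concat (replicate k c)" "awalk v \<delta> v"
      using walk_along_exitless[OF c(1) \<open>c \<noteq> []\<close> c(3) less.prems] by blast
    then obtain k' where "k = Suc k'" using False by (cases k) auto
    then have eq: "\<alpha> @ \<delta> = c @ concat (replicate k' c)" using * by simp
    then consider \<rho> where "\<alpha> = c @ \<rho>" | \<rho> where "c = \<alpha> @ \<rho>" "\<rho> \<noteq> []"
      by (auto simp: append_eq_append_conv2) blast
    then show ?thesis
    proof cases
      case 1
      then have "awalk v \<rho> v" using less.prems c(1) by (auto dest: awalk_ends_eqD)
      then obtain k where "\<rho> = concat (replicate k c)"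
        using less.hyps[of \<rho>] 1 \<open>c \<noteq> []\<close> by auto
      then show ?thesis using 1 by (intro exI[of _ "Suc k"]) simp
    next
      case 2
      then have "awalk v \<rho> v" using less.prems c(1) by (auto dest: awalk_ends_eqD)
      then have "tail G (hd \<rho>) = v" using 2 by (cases \<rho>) (auto simp: awalk_Cons_iff)
      moreover have "tail G (hd \<alpha>) = v" using less.prems False by (cases \<alpha>) (auto simp: awalk_Cons_iff)
      ultimately have "\<not> distinct (map (tail G) c)"
        using 2 False by (cases \<alpha>; cases \<rho>) auto
      then show ?thesis using cycle_distinct_tails[OF c(1,2)] by blast
    qed
  qed
qed

text \<open>A shortest closed walk at \<open>v\<close> is a cycle; it inherits the absence of exits.\<close>

lemma exitless_cycle_exists:
  assumes x: "awalk v x v" "x \<noteq> []" "\<not> has_exit G x"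
  obtains c where "awalk v c v" "cycle c" "\<not> has_exit G c"
proof -
  define P where "P c \<longleftrightarrow> awalk v c v \<and> c \<noteq> []" for c
  obtain c where c: "P c" and min: "\<And>d. P d \<Longrightarrow> length c \<le> length d"
    using ex_has_least_nat[of P x length] x by (auto simp: P_def)
  then have c': "awalk v c v" "c \<noteq> []" by (auto simp: P_def)
  obtain \<delta> k where "c @ \<delta> = concat (replicate k x)"
    using walk_along_exitless[OF x c'(1)] by blast
  then have "set c \<subseteq> set (concat (replicate k x))" by (metis set_append sup_ge1)
  then have "set c \<subseteq> set x" by auto
  then have "\<not> has_exit G c" using x(3) unfolding has_exit_def by blast
  moreover have "distinct (tl (awalk_verts v c))"
  proof (rule ccontr)
    assume "\<not> distinct (tl (awalk_verts v c))"
    moreover have "tl (awalk_verts v c) = map (head G) c"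
      using c' awalk_verts_conv'[of v c v] by (auto simp: awalk_def)
    ultimately have "\<not> distinct (map (head G) c)" by simp
    from not_distinct_decomp[OF this] obtain xs a ys b zs where
      eq: "c = xs @ a # ys @ b # zs" "head G a = head G b"
      by (auto simp: map_eq_append_conv map_eq_Cons_conv append_eq_map_conv Cons_eq_map_conv)
    then have "awalk v (xs @ [a] @ zs) v" using c' by (auto simp: awalk_Cons_iff)
    then have "length c \<le> length (xs @ [a] @ zs)" by (intro min) (simp add: P_def del: awalk_append_iff)
    then show False using eq by simp
  qed
  ultimately show ?thesis using that c' by (auto simp: cycle_def)
qed

end

context leavitt_family
begin

section \<open>The corner at a cycle without exits\<close>

lemma S_power: "S (concat (replicate k c)) = S c ^ k"
  by (induction k) (simp_all add: S_append)

lemma T_power: "T (concat (replicate k c)) = T c ^ k"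
proof (induction k)
  case (Suc k)
  then show ?case by (simp add: T_append power_commutes)
qed simp

text \<open>
  Evaluation of a polynomial at the cycle \<open>c\<close>, with \<open>v\<close> as the identity of the corner at \<open>v\<close>.
\<close>

definition ev :: "'w \<Rightarrow> 'f list \<Rightarrow> 'k poly \<Rightarrow> 'a" where
  "ev v c f = (\<Sum>i\<le>degree f. \<kappa> (coeff f i) * (p v * S c ^ i))"

lemma ev_bound: "degree f \<le> n \<Longrightarrow> ev v c f = (\<Sum>i\<le>n. \<kappa> (coeff f i) * (p v * S c ^ i))"
  unfolding ev_def by (rule sum.mono_neutral_left) (auto simp: coeff_eq_0)

lemma ev_0 [simp]: "ev v c 0 = 0"
  by (simp add: ev_def)

lemma ev_add: "ev v c (f + g) = ev v c f + ev v c g"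
proof -
  have "degree (f + g) \<le> max (degree f) (degree g)" by (rule degree_add_le_max)
  then show ?thesis
    using ev_bound[of "f + g" "max (degree f) (degree g)"] ev_bound[of f "max (degree f) (degree g)"]
      ev_bound[of g "max (degree f) (degree g)"]
    by (simp add: sum.distrib[symmetric] \<kappa>_add distrib_right)
qed

lemma ev_monom: "ev v c (monom a m) = \<kappa> a * (p v * S c ^ m)"
proof -
  have "ev v c (monom a m) = (\<Sum>i\<le>m. \<kappa> (coeff (monom a m) i) * (p v * S c ^ i))"
    by (rule ev_bound) (rule degree_monom_le)
  also have "\<dots> = (\<Sum>i\<in>{m}. \<kappa> (coeff (monom a m) i) * (p v * S c ^ i))"
    by (rule sum.mono_neutral_right) auto
  finally show ?thesis by simp
qed

lemma ev_const: "ev v c [:a:] = \<kappa> a * p v"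
  by (simp add: ev_def)

lemma ev_smult: "ev v c (smult a f) = \<kappa> a * ev v c f"
  using ev_bound[of "smult a f" "degree f" v c]
  by (simp add: ev_def[of v c f] sum_distrib_left \<kappa>_mult mult.assoc)

end

locale exitless_cycle = leavitt_family G \<kappa> p s t
  for G :: "('w,'f) pre_digraph" and \<kappa> :: "'k::field \<Rightarrow> 'a::ring_1" and p s t +
  fixes v :: 'w and c :: "'f list"
  assumes walk: "awalk v c v" and cyc: "cycle c" and no_exit: "\<not> has_exit G c"
begin

abbreviation x where "x \<equiv> S c"
abbreviation y where "y \<equiv> T c"

lemma ne: "c \<noteq> []" using cyc by (auto simp: cycle_def)
lemma v: "v \<in> verts G" using walk awalk_hd_in_verts by blast
lemma c_arcs: "set c \<subseteq> arcs G" using walk by (auto simp: awalk_def)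

lemma p_x: "p v * x = x" using S_start[OF walk ne] .
lemma x_p: "x * p v = x" using S_end[OF walk] p_x by simp
lemma y_p: "y * p v = y" using T_start[OF walk ne] .
lemma p_y: "p v * y = y" using T_end[OF walk] y_p by simp
lemma y_x: "y * x = p v" using T_S_same[OF walk] y_p by simp

text \<open>
  Without exits every vertex on the cycle is regular with a single edge \<open>e\<close>, so that \<open>e e\<^sup>* = s(e)\<close>.
  This makes the cycle invertible in the corner.
\<close>

lemma range_projection:
  assumes "awalk u \<alpha> w" "set \<alpha> \<subseteq> set c" shows "p u * S \<alpha> * T \<alpha> * p u = p u"
  using assms
proof (induction \<alpha> arbitrary: u)
  case Nil
  then show ?case by (auto simp: awalk_Nil_iff p_idem)
next
  case (Cons e \<alpha>)
  then have e: "e \<in> arcs G" "tail G e = u" "awalk (head G e) \<alpha> w" "e \<in> set c" by (auto simp: awalk_Cons)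
  have "out_arcs G u = {e}"
    using e no_exit unfolding has_exit_def by (auto simp: out_arcs_def)
  moreover have "u \<in> verts G" using e by auto
  ultimately have "s e * t e = p u" using CK2[of u] by (simp add: regular_vertex_def)
  moreover have "p u * S (e # \<alpha>) * T (e # \<alpha>) * p u = s e * (p (head G e) * S \<alpha> * T \<alpha> * p (head G e)) * t e"
  proof -
    have "p u * s e = s e * p (head G e)" "t e * p u = p (head G e) * t e"
      using e s_source s_range t_source t_range by auto
    then show ?thesis by (simp add: mult.assoc) (simp add: mult.assoc[symmetric])
  qed
  ultimately show ?case using Cons.IH[OF e(3)] Cons.prems e by (simp add: s_range)
qed

lemma x_y: "x * y = p v"
  using range_projection[OF walk] p_x y_p by (simp add: mult.assoc)

lemma p_xpow: "p v * x ^ i * p v = p v * x ^ i"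
  by (induction i) (simp_all add: p_idem[OF v] v power_Suc2 mult.assoc x_p del: power_Suc)

lemma ypow_xpow: "p v * y ^ i * (p v * x ^ i) = p v"
proof (induction i)
  case 0
  then show ?case by (simp add: p_idem v)
next
  case (Suc i)
  have "p v * y ^ Suc i * (p v * x ^ Suc i) = p v * y ^ i * (y * p v * x) * x ^ i"
    by (simp add: power_Suc2[of y] mult.assoc del: power_Suc) (simp add: mult.assoc)
  also have "\<dots> = p v * y ^ i * (p v * x ^ i)" by (simp add: y_p y_x mult.assoc)
  finally show ?case using Suc by simp
qed

lemma y_xpow: "y * (p v * x ^ i) = p v * x ^ i * y"
proof (cases i)
  case 0
  then show ?thesis by (simp add: y_p p_y)
next
  case (Suc j)
  have "y * (p v * x ^ i) = (y * p v * x) * x ^ j" by (simp add: Suc mult.assoc)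
  also have "\<dots> = p v * x ^ j" by (simp add: y_p y_x)
  finally have 1: "y * (p v * x ^ i) = p v * x ^ j" .
  have "p v * x ^ i * y = p v * x ^ j * (x * y)" by (simp add: Suc power_Suc2 mult.assoc del: power_Suc)
  then show ?thesis using 1 x_y p_xpow by simp
qed

lemma \<kappa>_x: "x * \<kappa> a = \<kappa> a * x" by (rule \<kappa>_S[OF c_arcs])
lemma \<kappa>_y: "y * \<kappa> a = \<kappa> a * y" by (rule \<kappa>_T[OF c_arcs])

lemma ev_y: "y * ev v c f = ev v c f * y"
  unfolding ev_def sum_distrib_left sum_distrib_right
proof (rule sum.cong[OF refl])
  fix i
  show "y * (\<kappa> (coeff f i) * (p v * x ^ i)) = \<kappa> (coeff f i) * (p v * x ^ i) * y"
    using \<kappa>_y y_xpow by (metis mult.assoc)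
qed

lemma ev_x: "ev v c (pCons 0 f) = x * ev v c f"
proof -
  have "ev v c (pCons 0 f) = (\<Sum>i\<le>Suc (degree f). \<kappa> (coeff (pCons 0 f) i) * (p v * x ^ i))"
    by (rule ev_bound) (rule degree_pCons_le)
  also have "\<dots> = (\<Sum>i\<le>degree f. \<kappa> (coeff f i) * (p v * x ^ Suc i))"
    by (simp add: sum.atMost_Suc_shift del: sum.atMost_Suc)
  also have "\<dots> = x * ev v c f"
    unfolding ev_def sum_distrib_left
  proof (rule sum.cong[OF refl])
    fix i
    have "p v * x ^ Suc i = x * (p v * x ^ i)" using p_x x_p by (simp add: mult.assoc[symmetric])
    then show "\<kappa> (coeff f i) * (p v * x ^ Suc i) = x * (\<kappa> (coeff f i) * (p v * x ^ i))"
      using \<kappa>_x by (metis mult.assoc)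
  qed
  finally show ?thesis .
qed

lemma p_ev: "p v * ev v c f = ev v c f"
  unfolding ev_def sum_distrib_left
  using \<kappa>_p[OF v] p_idem[OF v] by (intro sum.cong refl) (metis mult.assoc)

lemma ev_p: "ev v c f * p v = ev v c f"
  unfolding ev_def sum_distrib_right using p_xpow by (intro sum.cong refl) (simp add: mult.assoc)

lemma ev_mult: "ev v c (f * g) = ev v c f * ev v c g"
proof (induction f)
  case (pCons a f)
  have f: "ev v c (pCons a f) = \<kappa> a * p v + x * ev v c f"
    using ev_add[of v c "[:a:]" "pCons 0 f"] by (simp add: ev_x ev_const)
  have "ev v c (pCons a f * g) = \<kappa> a * ev v c g + x * (ev v c f * ev v c g)"
    using pCons by (simp add: ev_add ev_smult ev_x)
  then show ?case by (simp add: f distrib_right mult.assoc p_ev)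
qed simp

lemma ev_1: "ev v c 1 = p v"
  using ev_const[of v c 1] \<kappa>_one[OF v] by (simp add: one_pCons)

lemma ev_commute: "ev v c f * ev v c g = ev v c g * ev v c f"
  by (simp add: mult.commute flip: ev_mult)

lemma ev_ypow: "y ^ N * ev v c f = ev v c f * y ^ N"
proof (induction N)
  case (Suc N)
  have "y ^ Suc N * ev v c f = y * (ev v c f * y ^ N)" using Suc by (simp add: mult.assoc)
  also have "\<dots> = ev v c f * (y * y ^ N)" by (simp add: mult.assoc[symmetric] ev_y)
  finally show ?case by simp
qed simp

lemma xpow_ypow: "p v * x ^ i * y ^ i = p v"
proof (induction i)
  case (Suc i)
  have "p v * x ^ Suc i * y ^ Suc i = p v * x ^ i * (x * y) * y ^ i"
    by (simp add: power_Suc2[of x] mult.assoc del: power_Suc) (simp add: mult.assoc)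
  then show ?case using Suc p_xpow by (simp add: x_y)
qed simp

lemma ev_monom1: "ev v c (monom 1 m) = p v * x ^ m"
  using \<kappa>_one_p[OF v] by (simp add: ev_monom)

lemma ev_shift: "ev v c f * y ^ N = ev v c (f * monom 1 M) * y ^ (N + M)"
proof -
  have "ev v c (f * monom 1 M) * y ^ (N + M) = ev v c f * (p v * x ^ M * y ^ M) * y ^ N"
    by (simp add: ev_mult ev_monom1 add.commute[of N] power_add mult.assoc)
  then show ?thesis by (simp add: xpow_ypow ev_p)
qed

text \<open>
  The corner at \<open>v\<close> consists of Laurent polynomials in the cycle: a monomial \<open>\<alpha>\<beta>\<^sup>*\<close> in it is
  \<open>\<alpha>\<delta>\<delta>\<^sup>*\<beta>\<^sup>*\<close> for a walk \<open>\<delta>\<close> that completes both \<open>\<alpha>\<close> and \<open>\<beta>\<close> to full rounds.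
\<close>

lemma corner_monomial:
  assumes "awalk v \<alpha> w" "awalk v \<beta> w"
  obtains k l where "p v * S \<alpha> * (T \<beta> * p v) = p v * x ^ k * y ^ l"
proof -
  obtain \<delta> k where \<delta>: "\<alpha> @ \<delta> = concat (replicate k c)" "awalk w \<delta> v"
    using walk_along_exitless[OF walk ne no_exit assms(1)] by blast
  have "awalk v (\<beta> @ \<delta>) v" using assms(2) \<delta>(2) by (rule awalk_appendI)
  then obtain l where l: "\<beta> @ \<delta> = concat (replicate l c)"
    using closed_walks_are_powers[OF walk cyc no_exit] by blast
  have "set \<delta> \<subseteq> set (concat (replicate k c))" unfolding \<delta>(1)[symmetric] by simp
  then have "set \<delta> \<subseteq> set c" by (auto split: if_splits)
  have w: "w \<in> verts G" using assms(1) awalk_last_in_verts by blast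
  have "p v * S \<alpha> * (T \<beta> * p v) = (p v * S \<alpha> * p w) * (p w * (T \<beta> * p v))"
    using S_end[OF assms(1)] T_end[OF assms(2)] by simp
  also have "\<dots> = p v * S \<alpha> * (p w * p w) * T \<beta> * p v" by (simp add: mult.assoc)
  also have "\<dots> = p v * S \<alpha> * (p w * S \<delta> * T \<delta> * p w) * T \<beta> * p v"
    using range_projection[OF \<delta>(2) \<open>set \<delta> \<subseteq> set c\<close>] p_idem[OF w] by simp
  also have "\<dots> = (p v * S \<alpha> * p w) * S \<delta> * (T \<delta> * (p w * (T \<beta> * p v)))" by (simp add: mult.assoc)
  also have "\<dots> = p v * S (\<alpha> @ \<delta>) * (T (\<beta> @ \<delta>) * p v)"
    using S_end[OF assms(1)] T_end[OF assms(2)] by (simp add: S_append T_append mult.assoc)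
  also have "\<dots> = p v * x ^ k * (y ^ l * p v)" by (simp add: \<delta> l S_power T_power)
  also have "\<dots> = p v * x ^ k * y ^ l"
  proof (cases l)
    case 0
    then show ?thesis using p_xpow by simp
  next
    case (Suc m)
    then show ?thesis by (simp add: power_Suc2 mult.assoc y_p del: power_Suc)
  qed
  finally show ?thesis using that by blast
qed

lemma corner_Laurent:
  assumes "span_upto n a"
  obtains f N where "p v * a * p v = ev v c f * y ^ N"
proof -
  have "\<exists>f N. p v * a * p v = ev v c f * y ^ N"
    using assms
  proof (induction rule: span_upto.induct)
    case zero
    show ?case by (intro exI[of _ 0]) simp
  next
    case (add a u \<alpha> w u' \<beta> d)
    then obtain f N where f: "p v * a * p v = ev v c f * y ^ N" by blast
    have u: "u \<in> verts G" "u' \<in> verts G" using add awalk_hd_in_verts by blast+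
    have "p v * (\<kappa> d * (p u * S \<alpha> * (T \<beta> * p u'))) * p v = \<kappa> d * ((p v * p u) * S \<alpha> * (T \<beta> * (p u' * p v)))"
      using \<kappa>_p[OF v] by (simp add: mult.assoc[symmetric])
    moreover have "\<exists>g M. \<kappa> d * ((p v * p u) * S \<alpha> * (T \<beta> * (p u' * p v))) = ev v c g * y ^ M"
    proof (cases "u = v \<and> u' = v")
      case True
      then obtain k l where "p v * S \<alpha> * (T \<beta> * p v) = p v * x ^ k * y ^ l"
        using corner_monomial[of \<alpha> w \<beta>] add by blast
      then have "\<kappa> d * ((p v * p u) * S \<alpha> * (T \<beta> * (p u' * p v))) = ev v c (monom d k) * y ^ l"
        using True by (simp add: p_idem v ev_monom mult.assoc)
      then show ?thesis by blast
    next
      case False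
      then have "\<kappa> d * ((p v * p u) * S \<alpha> * (T \<beta> * (p u' * p v))) = ev v c 0 * y ^ 0"
        using p_orth[OF v, of u] p_orth[of u' v] u v by auto
      then show ?thesis by blast
    qed
    ultimately obtain g M where g: "p v * (\<kappa> d * (p u * S \<alpha> * (T \<beta> * p u'))) * p v = ev v c g * y ^ M" by auto
    have "p v * (\<kappa> d * (p u * S \<alpha> * (T \<beta> * p u')) + a) * p v = ev v c g * y ^ M + ev v c f * y ^ N"
      using f g by (simp add: distrib_left distrib_right)
    also have "\<dots> = ev v c (g * monom 1 N + f * monom 1 M) * y ^ (M + N)"
      using ev_shift[of g M N] ev_shift[of f N M] by (simp add: ev_add distrib_right add.commute[of M N])
    finally show ?case by blast
  qed
  then show ?thesis using that by blast
qed

lemma unshift: "ev v c f * y ^ N * x ^ N = ev v c f"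
proof -
  have "ev v c f * y ^ N * x ^ N = ev v c f * (p v * y ^ N * (p v * x ^ N))"
  proof (cases N)
    case (Suc m)
    then have "y ^ N * p v = y ^ N" by (simp add: power_Suc2 mult.assoc y_p del: power_Suc)
    then have "p v * y ^ N * (p v * x ^ N) = p v * (y ^ N * x ^ N)" by (metis mult.assoc)
    then show ?thesis by (metis ev_p mult.assoc)
  qed (simp add: p_idem[OF v] ev_p)
  then show ?thesis by (simp add: ypow_xpow ev_p)
qed

end


section \<open>Graded families and the reduction theorem\<close>

locale graded_leavitt_family = leavitt_family G \<kappa> p s t
  for G :: "('w,'f) pre_digraph" and \<kappa> :: "'k::field \<Rightarrow> 'a::ring_1" and p s t +
  fixes X :: "int \<Rightarrow> 'a set"
  assumes X_zero: "0 \<in> X n" and X_add: "a \<in> X n \<Longrightarrow> b \<in> X n \<Longrightarrow> a + b \<in> X n"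
    and X_\<kappa>: "a \<in> X n \<Longrightarrow> \<kappa> d * a \<in> X n"
    and X_mult: "a \<in> X m \<Longrightarrow> b \<in> X n \<Longrightarrow> a * b \<in> X (m + n)"
    and X_p: "v \<in> verts G \<Longrightarrow> p v \<in> X 0"
    and X_s: "e \<in> arcs G \<Longrightarrow> s e \<in> X 1"
    and X_t: "e \<in> arcs G \<Longrightarrow> t e \<in> X (-1)"
    and X_independent: "finite N \<Longrightarrow> (\<And>n. n \<in> N \<Longrightarrow> g n \<in> X n) \<Longrightarrow> (\<Sum>n\<in>N. g n) = 0 \<Longrightarrow> n \<in> N \<Longrightarrow> g n = 0"
    and p_nonzero: "v \<in> verts G \<Longrightarrow> p v \<noteq> 0"
begin

text \<open>
  The set contains the homogeneous components of its elements. Components are given by the summands,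
  as the ring need not be graded as a whole.
\<close>

definition graded_set :: "'a set \<Rightarrow> bool" where
  "graded_set J \<longleftrightarrow> (\<forall>N g. finite N \<longrightarrow> (\<forall>n\<in>N. g n \<in> X n) \<longrightarrow> (\<Sum>n\<in>N. g n) \<in> J \<longrightarrow> (\<forall>n\<in>N. g n \<in> J))"

lemma graded_set_zero: "graded_set {0}"
  using X_independent unfolding graded_set_def by blast

lemma X_path: "awalk u \<alpha> w \<Longrightarrow> p u * S \<alpha> \<in> X (int (length \<alpha>))"
proof (induction \<alpha> arbitrary: u)
  case Nil
  then show ?case by (auto simp: awalk_Nil_iff X_p)
next
  case (Cons e \<alpha>)
  then have e: "e \<in> arcs G" "tail G e = u" "awalk (head G e) \<alpha> w" by (auto simp: awalk_Cons)
  have "p u * S (e # \<alpha>) = s e * (p (head G e) * S \<alpha>)"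
    using s_source[OF e(1)] s_range[OF e(1)] e by (simp add: mult.assoc[symmetric])
  then show ?case using X_mult[OF X_s[OF e(1)] Cons.IH[OF e(3)]] by simp
qed

lemma X_sum: "(\<And>i. i \<in> I \<Longrightarrow> g i \<in> X n) \<Longrightarrow> sum g I \<in> X n"
  by (induction I rule: infinite_finite_induct) (auto simp: X_zero X_add)

lemma \<kappa>_p_nonzero: "v \<in> verts G \<Longrightarrow> d \<noteq> 0 \<Longrightarrow> \<kappa> d * p v \<noteq> 0"
proof
  assume "v \<in> verts G" "d \<noteq> 0" "\<kappa> d * p v = 0"
  then have "\<kappa> (1 / d) * (\<kappa> d * p v) = 0" by simp
  moreover have "\<kappa> (1 / d) * (\<kappa> d * p v) = p v"
    using \<kappa>_mult[of "1 / d" d] \<open>d \<noteq> 0\<close> \<kappa>_one[OF \<open>v \<in> verts G\<close>] by (simp add: mult.assoc[symmetric])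
  ultimately show False using p_nonzero[OF \<open>v \<in> verts G\<close>] by simp
qed

text \<open>
  Multiplication by an edge on the right is injective on combinations of paths that end at its
  source: it maps distinct paths to distinct paths, and paths are linearly independent, by the
  grading for different lengths and by multiplication with \<open>\<alpha>\<^sup>*\<close> for equal lengths.
\<close>

lemma paths_cancel_edge:
  assumes a: "span_upto 0 a" and e: "e \<in> arcs G" and z: "a * s e = 0" and ending: "a * p (tail G e) = a"
  shows "a = 0"
proof -
  obtain Q k where Q: "finite Q" "\<And>u \<alpha>. (u, \<alpha>) \<in> Q \<Longrightarrow> \<exists>w. awalk u \<alpha> w" "\<And>z. z \<in> Q \<Longrightarrow> k z \<noteq> 0"
    "a = (\<Sum>z\<in>Q. \<kappa> (k z) * (p (fst z) * S (snd z)))"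
    using paths_normal_form[OF a] by blast
  let ?v = "tail G e"
  have v: "?v \<in> verts G" using e by simp
  \<comment> \<open>only the paths that end at the source of \<open>e\<close> contribute to \<open>a\<close>\<close>
  define Q' where "Q' = {z \<in> Q. awalk (fst z) (snd z) ?v}"
  have "finite Q'" using Q by (simp add: Q'_def)
  have fe: "p (fst z) * S (snd z) * p ?v = (if z \<in> Q' then p (fst z) * S (snd z) else 0)" if "z \<in> Q" for z
  proof -
    obtain w where w: "awalk (fst z) (snd z) w" using Q(2)[of "fst z" "snd z"] \<open>z \<in> Q\<close> by (auto simp: prod.collapse)
    have wv: "w \<in> verts G" using w awalk_last_in_verts by blast
    have "p (fst z) * S (snd z) * p ?v = p (fst z) * S (snd z) * (p w * p ?v)"
      using S_end[OF w] by (simp add: mult.assoc[symmetric])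
    also have "\<dots> = (if w = ?v then p (fst z) * S (snd z) else 0)"
      using S_end[OF w] p_p[OF wv v] by (cases "w = ?v") auto
    moreover have "w = ?v \<longleftrightarrow> z \<in> Q'"
      using w that unfolding Q'_def by (auto simp: awalk_def) (metis awlast_if_cas)
    ultimately show ?thesis by auto
  qed
  have "a = (\<Sum>z\<in>Q. \<kappa> (k z) * (p (fst z) * S (snd z) * p ?v))"
    using ending by (simp add: Q(4) sum_distrib_right mult.assoc)
  also have "\<dots> = (\<Sum>z\<in>Q'. \<kappa> (k z) * (p (fst z) * S (snd z)))"
    using Q(1) fe by (intro sum.mono_neutral_cong_right) (auto simp: Q'_def)
  finally have a': "a = (\<Sum>z\<in>Q'. \<kappa> (k z) * (p (fst z) * S (snd z)))" .
  define h where "h z = \<kappa> (k z) * (p (fst z) * S (snd z)) * s e" for z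
  let ?len = "\<lambda>z. 1 + int (length (snd z))"
  have "Q' = {}"
  proof (rule ccontr)
    assume "Q' \<noteq> {}"
    then obtain z0 where z0: "z0 \<in> Q'" by blast
    obtain u0 \<alpha>0 where z0': "z0 = (u0, \<alpha>0)" by (cases z0)
    have aw: "awalk u0 \<alpha>0 ?v" using z0 by (simp add: Q'_def z0')
    \<comment> \<open>a path in \<open>Q'\<close> of length \<open>n\<close> contributes to degree \<open>n + 1\<close> of \<open>a * s e = 0\<close>\<close>
    have "(\<Sum>n\<in>?len ` Q'. \<Sum>z\<in>{z \<in> Q'. ?len z = n}. h z) = (\<Sum>z\<in>Q'. h z)"
      by (rule sum.image_gen[symmetric]) fact
    also have "\<dots> = a * s e" by (simp add: a' sum_distrib_right h_def)
    finally have sum0: "(\<Sum>n\<in>?len ` Q'. \<Sum>z\<in>{z \<in> Q'. ?len z = n}. h z) = 0" using z by simp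
    have hX: "h z \<in> X (?len z)" if "z \<in> Q'" for z
    proof -
      have "\<kappa> (k z) * (p (fst z) * S (snd z)) \<in> X (int (length (snd z)))"
        using that by (intro X_\<kappa> X_path) (auto simp: Q'_def)
      from X_mult[OF this X_s[OF e]] show ?thesis by (simp add: h_def add.commute)
    qed
    have "(\<Sum>z\<in>{z \<in> Q'. ?len z = n}. h z) \<in> X n" for n
      by (rule X_sum) (use hX in blast)
    from X_independent[OF _ this sum0, of "?len z0"]
    have "(\<Sum>z\<in>{z \<in> Q'. ?len z = ?len z0}. h z) = 0"
      using z0 \<open>finite Q'\<close> by simp
    then have "0 = (\<Sum>z\<in>{z \<in> Q'. ?len z = ?len z0}. T \<alpha>0 * p u0 * h z)"
      by (simp add: sum_distrib_left[symmetric])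
    also have "\<dots> = (\<Sum>z\<in>{z0}. T \<alpha>0 * p u0 * h z)"
    proof (rule sum.mono_neutral_right)
      show "\<forall>z\<in>{z \<in> Q'. ?len z = ?len z0} - {z0}. T \<alpha>0 * p u0 * h z = 0"
      proof
        fix z assume z: "z \<in> {z \<in> Q'. ?len z = ?len z0} - {z0}"
        obtain u \<alpha> where zu: "z = (u, \<alpha>)" by (cases z)
        have "awalk u \<alpha> ?v" "length \<alpha> = length \<alpha>0" "u \<noteq> u0 \<or> \<alpha> \<noteq> \<alpha>0"
          using z by (auto simp: Q'_def zu z0')
        have uv: "u \<in> verts G" "u0 \<in> verts G" using \<open>awalk u \<alpha> ?v\<close> aw awalk_hd_in_verts by blast+
        have arcs0: "set \<alpha>0 \<subseteq> arcs G" using aw by (auto simp: awalk_def)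
        have "T \<alpha>0 * p u0 * h z = (T \<alpha>0 * (p u0 * \<kappa> (k z))) * p u * S \<alpha> * s e"
          by (simp add: h_def zu mult.assoc)
        also have "\<dots> = \<kappa> (k z) * (T \<alpha>0 * (p u0 * p u) * S \<alpha>) * s e"
          using \<kappa>_p[OF uv(2)] \<kappa>_T[OF arcs0] by (simp add: mult.assoc[symmetric])
        also have "T \<alpha>0 * (p u0 * p u) * S \<alpha> = 0"
        proof (cases "u = u0")
          case True
          then show ?thesis
            using T_S[OF aw, of \<alpha> ?v] \<open>awalk u \<alpha> ?v\<close> \<open>length \<alpha> = length \<alpha>0\<close> \<open>u \<noteq> u0 \<or> \<alpha> \<noteq> \<alpha>0\<close> uv
            by (auto simp: p_idem)
        qed (use p_orth uv in auto)
        finally show "T \<alpha>0 * p u0 * h z = 0" by simp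
      qed
    qed (use \<open>finite Q'\<close> z0 in auto)
    also have "\<dots> = T \<alpha>0 * p u0 * h z0" by simp
    also have "\<dots> = \<kappa> (k z0) * (T \<alpha>0 * p u0 * S \<alpha>0) * s e"
    proof -
      have uv: "u0 \<in> verts G" using aw awalk_hd_in_verts by blast
      have arcs0: "set \<alpha>0 \<subseteq> arcs G" using aw by (auto simp: awalk_def)
      have "T \<alpha>0 * p u0 * h z0 = (T \<alpha>0 * (p u0 * \<kappa> (k z0))) * p u0 * S \<alpha>0 * s e"
        by (simp add: h_def z0' mult.assoc)
      also have "\<dots> = \<kappa> (k z0) * (T \<alpha>0 * (p u0 * p u0) * S \<alpha>0) * s e"
        using \<kappa>_p[OF uv] \<kappa>_T[OF arcs0] by (simp add: mult.assoc[symmetric])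
      finally show ?thesis using p_idem[OF uv] by simp
    qed
    also have "\<dots> = \<kappa> (k z0) * s e"
      using T_S_same[OF aw] s_source[OF e] by (simp add: mult.assoc)
    finally have "\<kappa> (k z0) * s e = 0" by simp
    then have "t e * (\<kappa> (k z0) * s e) = 0" by simp
    moreover have "t e * (\<kappa> (k z0) * s e) = \<kappa> (k z0) * p (head G e)"
      using \<kappa>_t[OF e] ts_same[OF e] by (metis mult.assoc)
    moreover have "k z0 \<noteq> 0" using Q(3) z0 by (auto simp: Q'_def)
    ultimately show False using \<kappa>_p_nonzero[of "head G e" "k z0"] e by simp
  qed
  then show ?thesis using a' by simp
qed

text \<open>
  Right multiplication by a suitable path removes all ghost edges without annihilating a non-zero
  element. If every edge \<open>e\<close> at \<open>v\<close> that occurs in \<open>a = a' + \<Sum>b\<^sub>e e\<^sup>*\<close> kills \<open>a\<close>, then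
  \<open>a = a'(v - \<Sum>ee\<^sup>*)\<close>, which vanishes if these are all the edges at \<open>v\<close>; any other edge would kill
  \<open>a'\<close> and hence \<open>a\<close>.
\<close>

lemma remove_ghosts:
  assumes "span_upto n a" "a \<noteq> 0"
  shows "\<exists>v \<beta> w. awalk v \<beta> w \<and> span_upto 0 (a * (p v * S \<beta>)) \<and> a * (p v * S \<beta>) \<noteq> 0"
  using assms
proof (induction n arbitrary: a)
  case 0
  obtain V where V: "finite V" "V \<subseteq> verts G" "a * (\<Sum>v\<in>V. p v) = a" "(\<Sum>v\<in>V. p v) * a = a"
    using span_local_unit[OF 0(1)] .
  then have "(\<Sum>v\<in>V. a * p v) \<noteq> 0" using 0 by (simp add: sum_distrib_left)
  then obtain v where "v \<in> V" "a * p v \<noteq> 0" by (metis sum.not_neutral_contains_not_neutral)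
  then show ?case using V span_p_right[OF 0(1), of v]
    by (intro exI[of _ v] exI[of _ "[]"] exI[of _ v]) (auto simp: awalk_Nil_iff)
next
  case (Suc n)
  obtain V where V: "finite V" "V \<subseteq> verts G" "a * (\<Sum>v\<in>V. p v) = a" "(\<Sum>v\<in>V. p v) * a = a"
    using span_local_unit[OF Suc.prems(1)] .
  then have "(\<Sum>v\<in>V. a * p v) \<noteq> 0" using Suc.prems by (simp add: sum_distrib_left)
  then obtain v where "v \<in> V" "a * p v \<noteq> 0" by (metis sum.not_neutral_contains_not_neutral)
  then have v: "v \<in> verts G" using V by blast
  obtain F a' b where *: "finite F" "F \<subseteq> arcs G" "span_upto 0 a'" "\<forall>e. span_upto n (b e)"
    "\<forall>e\<in>arcs G. b e * p (head G e) = b e" "\<forall>e. e \<notin> F \<longrightarrow> b e = 0" "a = a' + (\<Sum>e\<in>F. b e * t e)"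
    using span_decompose[OF Suc.prems(1)] .
  have as: "a * s e = a' * s e + b e" if e: "e \<in> arcs G" for e
  proof -
    have "(\<Sum>f\<in>F. b f * t f * s e) = (\<Sum>f\<in>F. if f = e then b e else 0)"
      using * e ts[of _ e] by (intro sum.cong refl) (auto simp: mult.assoc subset_iff)
    also have "\<dots> = b e" using * by (auto simp: sum.delta)
    finally show ?thesis by (simp add: *(7) distrib_right sum_distrib_right)
  qed
  show ?case
  proof (cases "\<exists>e\<in>out_arcs G v. a * s e \<noteq> 0")
    case True
    then obtain e where e: "e \<in> arcs G" "tail G e = v" "a * s e \<noteq> 0" by (auto simp: out_arcs_def)
    have "span_upto n (a' * s e)" using span_s_right_0[OF *(3) e(1)] by (rule span_mono) simp
    then have "span_upto n (a * s e)" using as[OF e(1)] *(4) by (simp add: span_add)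
    then obtain u \<beta> w where b: "awalk u \<beta> w" "span_upto 0 (a * s e * (p u * S \<beta>))" "a * s e * (p u * S \<beta>) \<noteq> 0"
      using Suc.IH e(3) by blast
    have u: "u \<in> verts G" using b awalk_hd_in_verts by blast
    have "a * s e * (p u * S \<beta>) = a * (s e * p u) * S \<beta>" by (simp add: mult.assoc)
    then have "s e * p u \<noteq> 0" using b(3) by auto
    then have "head G e = u" using s_p[OF e(1) u] by (auto split: if_splits)
    then have "a * s e * (p u * S \<beta>) = a * (p v * S (e # \<beta>))"
      using e s_source[OF e(1)] s_range[OF e(1)] by (simp add: mult.assoc[symmetric]) (simp add: mult.assoc)
    moreover have "awalk v (e # \<beta>) w" using e b \<open>head G e = u\<close> by (simp add: awalk_Cons)
    ultimately show ?thesis using b by metis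
  next
    case False
    then have zero: "a * s e = 0" if "e \<in> arcs G" "tail G e = v" for e
      using that by (auto simp: out_arcs_def)
    define Fv where "Fv = {e \<in> F. tail G e = v}"
    have Fv: "finite Fv" "Fv \<subseteq> out_arcs G v" using * by (auto simp: Fv_def out_arcs_def)
    have "(\<Sum>e\<in>F. b e * t e * p v) = (\<Sum>e\<in>Fv. b e * t e)"
      using * v t_p by (intro sum.mono_neutral_cong_right) (auto simp: Fv_def mult.assoc subset_iff)
    then have apv: "a * p v = a' * p v + (\<Sum>e\<in>Fv. b e * t e)"
      by (simp add: *(7) distrib_right sum_distrib_right)
    have b: "b e * t e = - (a' * s e * t e)" if "e \<in> Fv" for e
    proof -
      have "e \<in> arcs G" "tail G e = v" using that * by (auto simp: Fv_def)
      then have "a' * s e + b e = 0" using as zero by metis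
      then show ?thesis by (simp add: eq_neg_iff_add_eq_0 flip: distrib_right) (simp add: add.commute)
    qed
    have eq: "a * p v = a' * p v - a' * (\<Sum>e\<in>Fv. s e * t e)"
      unfolding apv using b by (simp add: sum_negf sum_distrib_left mult.assoc)
    show ?thesis
    proof (cases "Fv = out_arcs G v")
      case True
      show ?thesis
      proof (cases "Fv = {}")
        case True
        then have "a * p v = a' * p v" using eq by simp
        then show ?thesis using span_p_right[OF *(3) v] \<open>a * p v \<noteq> 0\<close> v
          by (intro exI[of _ v] exI[of _ "[]"] exI[of _ v]) (auto simp: awalk_Nil_iff)
      next
        case False
        then have "regular_vertex G v" using True Fv v by (auto simp: regular_vertex_def)
        then have "a * p v = 0" using eq CK2 True by (simp add: right_diff_distrib[symmetric])
        then show ?thesis using \<open>a * p v \<noteq> 0\<close> by simp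
      qed
    next
      case False
      then obtain e where e: "e \<in> arcs G" "tail G e = v" "e \<notin> Fv" using Fv by (auto simp: out_arcs_def)
      then have "b e = 0" using *(6) by (auto simp: Fv_def)
      then have "a' * s e = 0" using as[OF e(1)] zero e by simp
      then have "a' * p v * s e = 0" using s_source[OF e(1)] e by (simp add: mult.assoc)
      moreover have "a' * p v * p v = a' * p v" using p_idem[OF v] by (simp add: mult.assoc)
      ultimately have z: "a' * p v = 0"
        using paths_cancel_edge[OF span_p_right[OF *(3) v] e(1)] e by simp
      have "a' * (\<Sum>e\<in>Fv. s e * t e) = (\<Sum>e\<in>Fv. a' * p v * s e * t e)"
        unfolding sum_distrib_left
      proof (rule sum.cong[OF refl])
        fix f assume "f \<in> Fv"
        then have "p v * s f = s f" using Fv s_source by (auto simp: out_arcs_def)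
        then show "a' * (s f * t f) = a' * p v * s f * t f" by (simp add: mult.assoc)
      qed
      then have "a * p v = 0" using eq z by simp
      then show ?thesis using \<open>a * p v \<noteq> 0\<close> by simp
    qed
  qed
qed

text \<open>
  The two outcomes of the reduction. The polynomial in the second one cannot be avoided: the ideals
  of \<open>K[x, 1/x]\<close>, the algebra of a single loop, contain no vertex in general.
\<close>

definition vertex_or_cycle :: "'a set \<Rightarrow> bool" where
  "vertex_or_cycle J \<longleftrightarrow> (\<exists>v\<in>verts G. p v \<in> J) \<or>
     (\<exists>v c f. awalk v c v \<and> cycle c \<and> \<not> has_exit G c \<and> f \<noteq> 0 \<and> ev v c f \<in> J)"

text \<open>
  An exit of one of the closed walks shortens the combination: conjugating by the walk that leaves
  at this exit annihilates the corresponding term and preserves the shape of the others. If there is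
  no exit at all, everything is a polynomial in one cycle.
\<close>

lemma closed_walks_reduce:
  assumes "gen_closed J" "a \<in> J" "a = \<kappa> k0 * p v + (\<Sum>(k, \<alpha>)\<leftarrow>ps. \<kappa> k * S \<alpha>)" "k0 \<noteq> 0" "v \<in> verts G"
    "\<And>k \<alpha>. (k, \<alpha>) \<in> set ps \<Longrightarrow> \<alpha> \<noteq> [] \<and> awalk v \<alpha> v"
  shows "vertex_or_cycle J"
  using assms(2-)
proof (induction "length ps" arbitrary: ps a v rule: less_induct)
  case less
  show ?case
  proof (cases "\<exists>k \<alpha>. (k, \<alpha>) \<in> set ps \<and> has_exit G \<alpha>")
    case False
    show ?thesis
    proof (cases ps)
      case Nil
      then have "\<kappa> k0 * p v \<in> J" using less.prems by simp
      then show ?thesis using gen_closed_unscale[OF assms(1)] less.prems unfolding vertex_or_cycle_def by blast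
    next
      case (Cons q ps')
      obtain k1 \<alpha>1 where "q = (k1, \<alpha>1)" by (cases q)
      then have "awalk v \<alpha>1 v" "\<alpha>1 \<noteq> []" "\<not> has_exit G \<alpha>1" using less.prems(5)[of k1 \<alpha>1] False Cons by auto
      then obtain c where c: "awalk v c v" "cycle c" "\<not> has_exit G c" by (rule exitless_cycle_exists)
      have "\<exists>f. ev v c f = (\<Sum>(k, \<alpha>)\<leftarrow>ps. \<kappa> k * S \<alpha>) \<and> coeff f 0 = 0"
        using less.prems(5)
      proof (induction ps)
        case Nil
        show ?case by (intro exI[of _ 0]) simp
      next
        case (Cons q ps)
        obtain k \<alpha> where q: "q = (k, \<alpha>)" by (cases q)
        obtain f where f: "ev v c f = (\<Sum>(k, \<alpha>)\<leftarrow>ps. \<kappa> k * S \<alpha>)" "coeff f 0 = 0"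
          using Cons.IH Cons.prems by auto
        have \<alpha>: "awalk v \<alpha> v" "\<alpha> \<noteq> []" using Cons.prems[of k \<alpha>] q by auto
        obtain m where m: "\<alpha> = concat (replicate m c)"
          using closed_walks_are_powers[OF c \<alpha>(1)] by blast
        then have "m \<noteq> 0" using \<alpha>(2) by auto
        have "S \<alpha> = p v * S c ^ m" using S_start[OF \<alpha>] m by (simp add: S_power)
        then have "ev v c (monom k m + f) = (\<Sum>(k, \<alpha>)\<leftarrow>q # ps. \<kappa> k * S \<alpha>)"
          using f by (simp add: q ev_add ev_monom)
        moreover have "coeff (monom k m + f) 0 = 0" using f \<open>m \<noteq> 0\<close> by simp
        ultimately show ?case by blast
      qed
      then obtain f where f: "ev v c f = (\<Sum>(k, \<alpha>)\<leftarrow>ps. \<kappa> k * S \<alpha>)" "coeff f 0 = 0" by blast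
      have "ev v c ([:k0:] + f) = a" by (simp only: ev_add ev_const f less.prems(2))
      moreover have "[:k0:] + f \<noteq> 0" using f(2) \<open>k0 \<noteq> 0\<close>
        by (metis add.right_neutral coeff_0 coeff_add coeff_pCons_0)
      ultimately show ?thesis using c less.prems(1) unfolding vertex_or_cycle_def by metis
    qed
  next
    case True
    then obtain k1 \<alpha>1 where 1: "(k1, \<alpha>1) \<in> set ps" "has_exit G \<alpha>1" by blast
    then obtain e f where ef: "e \<in> set \<alpha>1" "f \<in> arcs G" "tail G f = tail G e" "f \<noteq> e"
      by (auto simp: has_exit_def)
    obtain \<beta>1 \<beta>2 where \<alpha>1: "\<alpha>1 = \<beta>1 @ e # \<beta>2" using ef(1) by (meson split_list)
    \<comment> \<open>follow \<open>\<alpha>1\<close> up to its exit \<open>f\<close> and leave; \<open>\<beta>\<close> is not an initial segment of \<open>\<alpha>1\<close>\<close>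
    define \<beta> where "\<beta> = \<beta>1 @ [f]"
    have "awalk v \<alpha>1 v" using less.prems(5) 1 by blast
    then have \<beta>: "awalk v \<beta> (head G f)"
      using ef by (auto simp: \<alpha>1 \<beta>_def awalk_Cons awalk_Nil_iff)
    have \<beta>_arcs: "set \<beta> \<subseteq> arcs G" using \<beta> by (auto simp: awalk_def)
    define b where "b = T \<beta> * (p v * a * (p v * S \<beta>))"
    have "p v * a * p v * S \<beta> \<in> J"
      using assms(1) less.prems(1,4) \<beta>_arcs by (intro gen_closed_S gen_closed_p)
    then have "b \<in> J" unfolding b_def
      using gen_closed_T[OF assms(1) _ \<beta>_arcs] by (simp add: mult.assoc)
    \<comment> \<open>the terms that survive conjugation by \<open>\<beta>\<close> have \<open>\<alpha>\<beta> = \<beta>\<gamma>\<close>, and become \<open>\<gamma>\<close>\<close>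
    define good where "good \<alpha> \<longleftrightarrow> take (length \<beta>) (\<alpha> @ \<beta>) = \<beta>" for \<alpha>
    define \<gamma> where "\<gamma> \<alpha> = drop (length \<beta>) (\<alpha> @ \<beta>)" for \<alpha>
    let ?w = "head G f"
    have \<gamma>: "\<gamma> \<alpha> \<noteq> [] \<and> awalk ?w (\<gamma> \<alpha>) ?w" if "(k, \<alpha>) \<in> set ps" "good \<alpha>" for k \<alpha>
    proof
      have \<alpha>: "\<alpha> \<noteq> []" "awalk v \<alpha> v" using less.prems(5)[OF that(1)] by auto
      have "length (\<gamma> \<alpha>) = length \<alpha>" by (simp add: \<gamma>_def)
      then show "\<gamma> \<alpha> \<noteq> []" using \<alpha>(1) by auto
      have "awalk v (\<alpha> @ \<beta>) ?w" using \<alpha>(2) \<beta> by (rule awalk_appendI)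
      moreover have "\<alpha> @ \<beta> = \<beta> @ \<gamma> \<alpha>"
        using that(2) unfolding good_def \<gamma>_def by (metis append_take_drop_id)
      ultimately have "awalk v (\<beta> @ \<gamma> \<alpha>) ?w" by simp
      then show "awalk ?w (\<gamma> \<alpha>) ?w" using \<beta> by (auto dest: awalk_ends_eqD)
    qed
    have term1: "T \<beta> * (p v * (\<kappa> k * S \<alpha>) * (p v * S \<beta>)) = (if good \<alpha> then \<kappa> k * S (\<gamma> \<alpha>) else 0)"
      if ps: "(k, \<alpha>) \<in> set ps" for k \<alpha>
    proof -
      have \<alpha>: "\<alpha> \<noteq> []" "awalk v \<alpha> v" using less.prems(5)[OF ps] by auto
      have "T \<beta> * (p v * (\<kappa> k * S \<alpha>) * (p v * S \<beta>)) = (T \<beta> * (p v * \<kappa> k)) * (S \<alpha> * p v) * S \<beta>"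
        by (simp add: mult.assoc)
      also have "S \<alpha> * p v = S \<alpha>" using S_end[OF \<alpha>(2)] S_start[OF \<alpha>(2,1)] by simp
      also have "T \<beta> * (p v * \<kappa> k) = \<kappa> k * (T \<beta> * p v)"
        using \<kappa>_p[OF less.prems(4)] \<kappa>_T[OF \<beta>_arcs] by (simp add: mult.assoc[symmetric])
      also have "\<kappa> k * (T \<beta> * p v) * S \<alpha> * S \<beta> = \<kappa> k * (T \<beta> * p v * S (\<alpha> @ \<beta>))"
        by (simp add: S_append mult.assoc)
      also have "T \<beta> * p v * S (\<alpha> @ \<beta>) = (if good \<alpha> then p ?w * S (\<gamma> \<alpha>) else 0)"
        unfolding good_def \<gamma>_def using T_S[OF \<beta> awalk_appendI[OF \<alpha>(2) \<beta>]] by simp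
      finally show ?thesis using \<gamma>[OF ps] S_start by auto
    qed
    have term0: "T \<beta> * (p v * (\<kappa> k0 * p v) * (p v * S \<beta>)) = \<kappa> k0 * p ?w"
    proof -
      have "T \<beta> * (p v * (\<kappa> k0 * p v) * (p v * S \<beta>)) = (T \<beta> * (p v * \<kappa> k0)) * (p v * p v) * S \<beta>"
        by (simp add: mult.assoc)
      also have "T \<beta> * (p v * \<kappa> k0) = \<kappa> k0 * (T \<beta> * p v)"
        using \<kappa>_p[OF less.prems(4)] \<kappa>_T[OF \<beta>_arcs] by (simp add: mult.assoc[symmetric])
      finally show ?thesis using T_S_same[OF \<beta>] p_idem[OF less.prems(4)] by (simp add: mult.assoc)
    qed
    define ps' where "ps' = map (\<lambda>(k, \<alpha>). (k, \<gamma> \<alpha>)) (filter (\<lambda>(k, \<alpha>). good \<alpha>) ps)"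
    have "\<not> good \<alpha>1" using ef(4) by (auto simp: good_def \<alpha>1 \<beta>_def)
    then have "length ps' < length ps"
      unfolding ps'_def length_map using 1 by (intro length_filter_less[of "(k1, \<alpha>1)"]) auto
    moreover have "b = \<kappa> k0 * p ?w + (\<Sum>(k, \<alpha>)\<leftarrow>ps'. \<kappa> k * S \<alpha>)"
    proof -
      have "T \<beta> * (p v * (\<Sum>(k, \<alpha>)\<leftarrow>qs. \<kappa> k * S \<alpha>) * (p v * S \<beta>)) =
        (\<Sum>(k, \<alpha>)\<leftarrow>map (\<lambda>(k, \<alpha>). (k, \<gamma> \<alpha>)) (filter (\<lambda>(k, \<alpha>). good \<alpha>) qs). \<kappa> k * S \<alpha>)" if "set qs \<subseteq> set ps" for qs
        using that
      proof (induction qs)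
        case (Cons q qs)
        then show ?case using term1[of "fst q" "snd q"] by (cases q) (auto simp: distrib_left distrib_right)
      qed simp
      then show ?thesis unfolding b_def less.prems(2) ps'_def by (simp add: distrib_left distrib_right term0)
    qed
    moreover have "\<alpha> \<noteq> [] \<and> awalk ?w \<alpha> ?w" if "(k, \<alpha>) \<in> set ps'" for k \<alpha>
      using that \<gamma> by (auto simp: ps'_def)
    ultimately show ?thesis
      using less.hyps[of ps' b ?w] \<open>b \<in> J\<close> \<open>k0 \<noteq> 0\<close> ef(2) by simp
  qed
qed

text \<open>
  If \<open>\<alpha>\<close> is a shortest path with non-zero coefficient, \<open>\<alpha>\<^sup>*\<close> turns \<open>\<alpha>\<close> into its end vertex \<open>v\<close> and each other
  path into zero or a path of positive length; multiplying by \<open>v\<close> leaves closed paths at \<open>v\<close>.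
\<close>

lemma paths_reduce:
  assumes J: "gen_closed J" and a: "a \<in> J" "span_upto 0 a" "a \<noteq> 0"
  shows "vertex_or_cycle J"
proof -
  obtain Q k where Q: "finite Q" "\<And>u \<alpha>. (u, \<alpha>) \<in> Q \<Longrightarrow> \<exists>w. awalk u \<alpha> w" "\<And>z. z \<in> Q \<Longrightarrow> k z \<noteq> 0"
    "a = (\<Sum>z\<in>Q. \<kappa> (k z) * (p (fst z) * S (snd z)))"
    using paths_normal_form[OF a(2)] by blast
  have "Q \<noteq> {}" using Q(4) a(3) by auto
  then obtain z0 where z0: "z0 \<in> Q" "\<And>z. z \<in> Q \<Longrightarrow> length (snd z0) \<le> length (snd z)"
    using ex_has_least_nat[of "\<lambda>z. z \<in> Q" _ "\<lambda>z. length (snd z)"] by blast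
  obtain u0 \<alpha>0 where z0': "z0 = (u0, \<alpha>0)" by (cases z0)
  obtain v where v: "awalk u0 \<alpha>0 v" using Q(2) z0 z0' by blast
  have vv: "v \<in> verts G" "u0 \<in> verts G" using v awalk_last_in_verts awalk_hd_in_verts by blast+
  have arcs0: "set \<alpha>0 \<subseteq> arcs G" using v by (auto simp: awalk_def)
  define h where "h z = T \<alpha>0 * p u0 * (\<kappa> (k z) * (p (fst z) * S (snd z))) * p v" for z
  have h: "h z = \<kappa> (k z) * (T \<alpha>0 * (p u0 * p (fst z)) * S (snd z) * p v)" for z
  proof -
    have "h z = T \<alpha>0 * (p u0 * \<kappa> (k z)) * (p (fst z) * S (snd z)) * p v" by (simp add: h_def mult.assoc)
    also have "T \<alpha>0 * (p u0 * \<kappa> (k z)) = \<kappa> (k z) * (T \<alpha>0 * p u0)"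
      using \<kappa>_p[OF vv(2)] \<kappa>_T[OF arcs0] by (simp add: mult.assoc[symmetric])
    finally show ?thesis by (simp add: mult.assoc)
  qed
  have h0: "h z0 = \<kappa> (k z0) * p v"
    using T_S_same[OF v] p_idem[OF vv(1)] p_idem[OF vv(2)] by (simp add: h z0')
  have hz: "h z = 0 \<or> (\<exists>\<gamma>. \<gamma> \<noteq> [] \<and> awalk v \<gamma> v \<and> h z = \<kappa> (k z) * S \<gamma>)" if z: "z \<in> Q" "z \<noteq> z0" for z
  proof -
    obtain u \<alpha> where zu: "z = (u, \<alpha>)" by (cases z)
    obtain w where w: "awalk u \<alpha> w" using Q(2) z zu by blast
    have uw: "u \<in> verts G" "w \<in> verts G" using w awalk_last_in_verts awalk_hd_in_verts by blast+
    show ?thesis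
    proof (cases "u = u0 \<and> take (length \<alpha>0) \<alpha> = \<alpha>0")
      case True
      then have split: "\<alpha> = \<alpha>0 @ drop (length \<alpha>0) \<alpha>" by (metis append_take_drop_id)
      let ?\<gamma> = "drop (length \<alpha>0) \<alpha>"
      have ne: "?\<gamma> \<noteq> []" using True z(2) split by (auto simp: zu z0')
      have "awalk u0 (\<alpha>0 @ ?\<gamma>) w" using w True split by simp
      then have \<gamma>: "awalk v ?\<gamma> w" using v by (auto dest: awalk_ends_eqD)
      have "T \<alpha>0 * (p u0 * p u) * S \<alpha> = p v * S ?\<gamma>"
        using T_S[OF v, of \<alpha> w] True w z0(2)[OF z(1)] p_idem[OF vv(2)] by (simp add: zu z0')
      then have "h z = \<kappa> (k z) * (p v * S ?\<gamma> * p v)" by (simp add: h zu)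
      also have "p v * S ?\<gamma> * p v = p v * S ?\<gamma> * (p w * p v)" using S_end[OF \<gamma>] by (simp add: mult.assoc[symmetric])
      also have "\<dots> = (if w = v then S ?\<gamma> else 0)"
        using S_end[OF \<gamma>] S_start[OF \<gamma> ne] p_p[OF uw(2) vv(1)] by auto
      finally have "h z = \<kappa> (k z) * (if w = v then S ?\<gamma> else 0)" .
      then show ?thesis using ne \<gamma> by (cases "w = v") (auto intro!: disjI2 exI[of _ ?\<gamma>])
    next
      case False
      have "T \<alpha>0 * (p u0 * p u) * S \<alpha> = 0"
      proof (cases "u = u0")
        case True
        then show ?thesis using False T_S[OF v, of \<alpha> w] w z0(2)[OF z(1)] p_idem[OF vv(2)] by (simp add: zu z0')
      qed (use p_orth uw vv in auto)
      then show ?thesis by (simp add: h zu)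
    qed
  qed
  have "\<exists>ps. (\<Sum>z\<in>Q'. h z) = (\<Sum>(k, \<alpha>)\<leftarrow>ps. \<kappa> k * S \<alpha>) \<and> (\<forall>k \<alpha>. (k, \<alpha>) \<in> set ps \<longrightarrow> \<alpha> \<noteq> [] \<and> awalk v \<alpha> v)"
    if "finite Q'" "Q' \<subseteq> Q - {z0}" for Q'
    using that
  proof (induction Q' rule: finite_induct)
    case empty
    show ?case by (intro exI[of _ "[]"]) simp
  next
    case (insert z Q')
    then obtain ps where ps: "(\<Sum>z\<in>Q'. h z) = (\<Sum>(k, \<alpha>)\<leftarrow>ps. \<kappa> k * S \<alpha>)"
      "\<forall>k \<alpha>. (k, \<alpha>) \<in> set ps \<longrightarrow> \<alpha> \<noteq> [] \<and> awalk v \<alpha> v" by auto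
    have "z \<in> Q" "z \<noteq> z0" using insert.prems by auto
    from hz[OF this] show ?case
    proof (elim disjE exE conjE)
      assume "h z = 0"
      then show ?thesis using ps insert.hyps by (intro exI[of _ ps]) simp
    next
      fix \<gamma> assume "\<gamma> \<noteq> []" "awalk v \<gamma> v" "h z = \<kappa> (k z) * S \<gamma>"
      then show ?thesis using ps insert.hyps by (intro exI[of _ "(k z, \<gamma>) # ps"]) auto
    qed
  qed
  from this[of "Q - {z0}"] obtain ps where
    ps: "(\<Sum>z\<in>Q - {z0}. h z) = (\<Sum>(k, \<alpha>)\<leftarrow>ps. \<kappa> k * S \<alpha>)" "\<And>k \<alpha>. (k, \<alpha>) \<in> set ps \<Longrightarrow> \<alpha> \<noteq> [] \<and> awalk v \<alpha> v"
    using Q(1) by blast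
  have "T \<alpha>0 * (p u0 * a) * p v = (\<Sum>z\<in>Q. h z)"
    by (simp add: Q(4) h_def sum_distrib_left sum_distrib_right mult.assoc)
  also have "\<dots> = \<kappa> (k z0) * p v + (\<Sum>(k, \<alpha>)\<leftarrow>ps. \<kappa> k * S \<alpha>)"
    using Q(1) z0(1) ps(1) h0 by (simp add: sum.remove[of Q z0])
  finally have eq: "T \<alpha>0 * (p u0 * a) * p v = \<kappa> (k z0) * p v + (\<Sum>(k, \<alpha>)\<leftarrow>ps. \<kappa> k * S \<alpha>)" .
  have "T \<alpha>0 * (p u0 * a) * p v \<in> J"
    using J a(1) vv arcs0 by (auto intro!: gen_closed_T gen_closed_p)
  from closed_walks_reduce[OF J this eq Q(3)[OF z0(1)] vv(1) ps(2)] show ?thesis .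
qed

text \<open>
  This is the reduction theorem for Leavitt path algebras. It is stated for ideals and for arbitrary
  families with non-zero vertices and independent degrees, in order to apply to quotients.
\<close>

theorem reduction:
  assumes J: "gen_closed J" and a: "a \<in> J" "span_upto n a" "a \<noteq> 0"
  shows "vertex_or_cycle J"
proof -
  obtain v \<beta> w where b: "awalk v \<beta> w" "span_upto 0 (a * (p v * S \<beta>))" "a * (p v * S \<beta>) \<noteq> 0"
    using remove_ghosts[OF a(2,3)] by blast
  have "v \<in> verts G" "set \<beta> \<subseteq> arcs G" using b awalk_hd_in_verts by (auto simp: awalk_def)
  then have "a * p v * S \<beta> \<in> J" using gen_closed_S[OF J] gen_closed_p[OF J] a(1) by blast
  then show ?thesis using paths_reduce[OF J _ b(2,3)] by (simp add: mult.assoc)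
qed

text \<open>The powers of a cycle have different degrees, and each of them is invertible in the corner.\<close>

lemma graded_ev:
  assumes J: "gen_closed J" "graded_set J" and c: "awalk v c v" "cycle c" "\<not> has_exit G c"
    and f: "f \<noteq> 0" "ev v c f \<in> J"
  shows "p v \<in> J"
proof -
  interpret exitless_cycle G \<kappa> p s t v c by unfold_locales (use c in auto)
  define g where "g n = \<kappa> (coeff f (nat n div length c)) * (p v * S c ^ (nat n div length c))" for n
  let ?m = "\<lambda>i. int (i * length c)"
  have l: "length c > 0" using ne by simp
  have gm: "g (?m i) = \<kappa> (coeff f i) * (p v * S c ^ i)" for i using l by (simp add: g_def nat_int del: of_nat_mult)
  have inj: "inj_on ?m {..degree f}" using l by (auto simp: inj_on_def)
  have "(\<Sum>n\<in>?m ` {..degree f}. g n) = ev v c f"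
    unfolding sum.reindex[OF inj] by (simp add: ev_def gm del: of_nat_mult)
  moreover have "g n \<in> X n" if n: "n \<in> ?m ` {..degree f}" for n
  proof -
    obtain i where i: "n = ?m i" using n by blast
    have "p v * S (concat (replicate i c)) \<in> X (int (length (concat (replicate i c))))"
      by (rule X_path[OF awalk_power[OF c(1)]])
    moreover have "length (concat (replicate i c)) = i * length c" by (induction i) auto
    ultimately have "p v * S c ^ i \<in> X n" by (simp add: S_power i)
    then show ?thesis unfolding i gm using X_\<kappa> by blast
  qed
  ultimately have "\<forall>n\<in>?m ` {..degree f}. g n \<in> J"
    using J(2) f(2) unfolding graded_set_def by (metis finite_atMost finite_imageI)
  then have "g (?m (degree f)) \<in> J" by blast
  then have "\<kappa> (coeff f (degree f)) * (p v * S c ^ degree f) \<in> J" unfolding gm .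
  then have "T (concat (replicate (degree f) c)) * (p v * (\<kappa> (coeff f (degree f)) * (p v * S c ^ degree f))) \<in> J"
    using c_arcs by (intro gen_closed_T gen_closed_p J v) (auto split: if_splits)
  moreover have "T (concat (replicate (degree f) c)) * (p v * (\<kappa> (coeff f (degree f)) * (p v * S c ^ degree f)))
     = \<kappa> (coeff f (degree f)) * p v"
  proof -
    have arcs: "set (concat (replicate (degree f) c)) \<subseteq> arcs G" using c_arcs by (auto split: if_splits)
    let ?T = "T (concat (replicate (degree f) c))" and ?k = "\<kappa> (coeff f (degree f))"
    have "?T * (p v * (?k * (p v * S c ^ degree f))) = (?T * (p v * ?k)) * (p v * S c ^ degree f)"
      by (simp add: mult.assoc)
    also have "?T * (p v * ?k) = ?k * (?T * p v)"
      using \<kappa>_p[OF v] \<kappa>_T[OF arcs] by (simp add: mult.assoc[symmetric])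
    also have "?k * (?T * p v) * (p v * S c ^ degree f) = ?k * (?T * (p v * p v) * S (concat (replicate (degree f) c)))"
      by (simp add: mult.assoc S_power)
    finally show ?thesis using T_S_same[OF awalk_power[OF c(1)]] p_idem[OF v] by simp
  qed
  ultimately show ?thesis using gen_closed_unscale[OF J(1)] f(1) v by (simp add: leading_coeff_0_iff)
qed

text \<open>
  A polynomial that vanishes at the cycle would force a vertex into the set \<open>{0}\<close>.
\<close>

lemma ev_injective:
  assumes c: "awalk v c v" "cycle c" "\<not> has_exit G c" and "ev v c f = 0"
  shows "f = 0"
proof (rule ccontr)
  assume "f \<noteq> 0"
  have "gen_closed {0}" by (simp add: gen_closed_def)
  from graded_ev[OF this graded_set_zero c \<open>f \<noteq> 0\<close>] have "p v = 0" using assms(4) by simp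
  then show False using p_nonzero awalk_hd_in_verts[OF c(1)] by blast
qed

end

section \<open>Homomorphisms defined by families\<close>

locale lpa_family = lpa E + leavitt_family E \<kappa> p s t
  for E :: "('v,'e) pre_digraph" and \<kappa> :: "'k::field \<Rightarrow> 'a::ring_1" and p s t
begin

primrec gen_value :: "('v,'e) gen \<Rightarrow> 'a" where
  "gen_value (Vertex v) = p v"
| "gen_value (Edge e) = s e"
| "gen_value (Ghost e) = t e"

text \<open>
  The universal property: a family of \<open>E\<close> extends linearly and multiplicatively to the free algebra, and
  this extension annihilates the relations.
\<close>

definition ext :: "('v,'e,'k) free_elem \<Rightarrow> 'a" where
  "ext x = (\<Sum>w\<in>Poly_Mapping.keys x. \<kappa> (Poly_Mapping.lookup x w) * prod_list (map gen_value (letters w)))"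

lemma ext_add: "ext (x + y) = ext x + ext y"
  unfolding ext_def by (rule setsum_keys_plus_distrib) (simp_all add: \<kappa>_add distrib_right)

lemma ext_0 [simp]: "ext 0 = 0"
  by (simp add: ext_def)

lemma ext_diff: "ext (x - y) = ext x - ext y"
  using ext_add[of "x - y" y] by (simp add: eq_diff_eq)

lemma ext_sum: "ext (sum f A) = (\<Sum>i\<in>A. ext (f i))"
  by (induction A rule: infinite_finite_induct) (simp_all add: ext_add)

lemma ext_single: "ext (Poly_Mapping.single w c) = \<kappa> c * prod_list (map gen_value (letters w))"
  by (simp add: ext_def)

lemma gen_value_\<kappa>: "g \<in> generators E \<Longrightarrow> gen_value g * \<kappa> c = \<kappa> c * gen_value g"
  by (auto simp: generators_def \<kappa>_p \<kappa>_s \<kappa>_t)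

lemma ext_const_mult: "ext (Poly_Mapping.single 0 c * x) = \<kappa> c * ext x"
proof -
  have "\<forall>w \<in> Poly_Mapping.keys x. True" by simp
  then show ?thesis
    by (induction rule: free_induct) (simp_all add: distrib_left ext_add mult_single ext_single \<kappa>_mult mult.assoc)
qed

lemma ext_gen_mult:
  assumes "g \<in> generators E" shows "ext (monomial g * x) = gen_value g * ext x"
proof -
  have "\<forall>w \<in> Poly_Mapping.keys x. True" by simp
  then show ?thesis
  proof (induction rule: free_induct)
    case (add w c x)
    have "gen_value g * (\<kappa> c * y) = \<kappa> c * (gen_value g * y)" for y
      using gen_value_\<kappa>[OF assms] by (metis mult.assoc)
    then show ?case using add
      by (simp add: distrib_left ext_add monomial_def mult_single ext_single mult.assoc)
  qed simp
qed

lemma gen_value_one: "g \<in> generators E \<Longrightarrow> \<kappa> 1 * gen_value g = gen_value g"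
  using \<kappa>_one_p[of "tail E e" "s e" for e] \<kappa>_one_p[of "head E e" "t e" for e]
  by (auto simp: generators_def \<kappa>_one) (metis s_source tail_in_verts, metis t_source head_in_verts)

lemma ext_gen: "g \<in> generators E \<Longrightarrow> ext (monomial g) = gen_value g"
  by (simp add: monomial_def ext_single gen_value_one)

lemma ext_gens: "v \<in> verts E \<Longrightarrow> ext (vx v) = p v" "e \<in> arcs E \<Longrightarrow> ext (ed e) = s e" "e \<in> arcs E \<Longrightarrow> ext (gh e) = t e"
  by (simp_all add: ext_gen generators_def)

lemma ext_mult:
  assumes "x \<in> C" shows "ext (x * y) = ext x * ext y"
  using assms
proof (induction rule: C_induct)
  case (mult g x)
  then show ?case by (simp add: mult.assoc ext_gen_mult)
qed (simp_all add: distrib_right ext_add ext_const_mult mult.assoc ext_gen_mult ext_gen)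

definition kernel :: "('v,'e,'k) free_elem set" where
  "kernel = {x \<in> C. ext x = 0}"

lemma relators_kernel: "x \<in> leavitt_relators E \<Longrightarrow> ext x = 0"
proof (induction rule: leavitt_relators.induct)
  case (CK2 v)
  have "ext (\<Sum>e\<in>out_arcs E v. ed e * gh e) = (\<Sum>e\<in>out_arcs E v. s e * t e)"
    unfolding ext_sum by (intro sum.cong refl) (simp add: ext_mult C_gens ext_gens)
  then show ?case using CK2 leavitt_family_axioms
    by (simp add: ext_diff ext_gens leavitt_family.CK2[OF leavitt_family_axioms] regular_vertex_def)
qed (simp_all add: ext_diff ext_mult C_gens ext_gens p_idem p_orth s_source s_range t_source t_range ts_same ts_diff)

lemma kernel_lid: "lid kernel"
proof -
  have "R \<subseteq> kernel"
  proof (rule R_least)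
    show "two_sided_ideal kernel (free_algebra E)"
      by (auto simp: tsi_free kernel_def C_zero C_diff C_mult ext_diff ext_mult)
    show "scale c x \<in> kernel" if "x \<in> kernel" for c x
      using that C_scale by (auto simp: kernel_def scale_eq ext_const_mult)
    show "leavitt_relators E \<subseteq> kernel" using relators_C relators_kernel by (auto simp: kernel_def)
  qed
  then show ?thesis by (auto simp: lid_def kernel_def C_diff C_mult ext_diff ext_mult)
qed

end

section \<open>Quotients of the Leavitt path algebra\<close>

text \<open>
  A homomorphism from the free algebra whose kernel is the lifted ideal \<open>I\<close>, so that its image is the
  quotient of the Leavitt path algebra by an ideal.
\<close>

locale lpa_quotient = lpa E for E :: "('v,'e) pre_digraph" +
  fixes I :: "('v,'e,'k::field) free_elem set" and \<Phi> :: "('v,'e,'k) free_elem \<Rightarrow> 'a::ring_1"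
  assumes I_lid: "lid I"
    and \<Phi>_add: "\<Phi> (x + y) = \<Phi> x + \<Phi> y"
    and \<Phi>_mult: "x \<in> unital_hull \<Longrightarrow> y \<in> unital_hull \<Longrightarrow> \<Phi> (x * y) = \<Phi> x * \<Phi> y"
    and \<Phi>_zero_iff: "x \<in> unital_hull \<Longrightarrow> \<Phi> x = 0 \<longleftrightarrow> x \<in> I"
begin

abbreviation scalar :: "'k \<Rightarrow> 'a" where "scalar c \<equiv> \<Phi> (Poly_Mapping.single 0 c)"

lemma \<Phi>_0 [simp]: "\<Phi> 0 = 0"
  using \<Phi>_add[of 0 0] by simp

lemma \<Phi>_diff: "\<Phi> (x - y) = \<Phi> x - \<Phi> y"
  using \<Phi>_add[of "x - y" y] by (simp add: eq_diff_eq)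

lemma \<Phi>_sum: "\<Phi> (sum f A) = (\<Sum>i\<in>A. \<Phi> (f i))"
  by (induction A rule: infinite_finite_induct) (simp_all add: \<Phi>_add)

lemma \<Phi>_C_mult: "x \<in> C \<Longrightarrow> y \<in> C \<Longrightarrow> \<Phi> (x * y) = \<Phi> x * \<Phi> y"
  by (intro \<Phi>_mult C_hull)

lemma \<Phi>_scalar: "x \<in> C \<Longrightarrow> \<Phi> (Poly_Mapping.single 0 c * x) = scalar c * \<Phi> x"
  by (intro \<Phi>_mult const_hull C_hull)

lemma \<Phi>_scalar_commute: "x \<in> C \<Longrightarrow> \<Phi> x * scalar c = scalar c * \<Phi> x"
  using \<Phi>_mult[OF const_hull C_hull, of x c] \<Phi>_mult[OF C_hull const_hull, of x c] by (simp add: const_commute)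

lemma \<Phi>_eq_iff: "x \<in> C \<Longrightarrow> y \<in> C \<Longrightarrow> \<Phi> x = \<Phi> y \<longleftrightarrow> x - y \<in> I"
  using \<Phi>_zero_iff[OF C_hull[OF C_diff], of x y] by (simp add: \<Phi>_diff)

lemma \<Phi>_relator: "x \<in> leavitt_relators E \<Longrightarrow> \<Phi> x = 0"
  using R_relators lid_R[OF I_lid] \<Phi>_zero_iff[OF C_hull[OF relators_C]] by blast

lemma \<Phi>_relators:
  "v \<in> verts E \<Longrightarrow> \<Phi> (vx v) * \<Phi> (vx v) = \<Phi> (vx v)"
  "v \<in> verts E \<Longrightarrow> w \<in> verts E \<Longrightarrow> v \<noteq> w \<Longrightarrow> \<Phi> (vx v) * \<Phi> (vx w) = 0"
  "e \<in> arcs E \<Longrightarrow> \<Phi> (vx (tail E e)) * \<Phi> (ed e) = \<Phi> (ed e)"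
  "e \<in> arcs E \<Longrightarrow> \<Phi> (ed e) * \<Phi> (vx (head E e)) = \<Phi> (ed e)"
  "e \<in> arcs E \<Longrightarrow> \<Phi> (vx (head E e)) * \<Phi> (gh e) = \<Phi> (gh e)"
  "e \<in> arcs E \<Longrightarrow> \<Phi> (gh e) * \<Phi> (vx (tail E e)) = \<Phi> (gh e)"
  "e \<in> arcs E \<Longrightarrow> \<Phi> (gh e) * \<Phi> (ed e) = \<Phi> (vx (head E e))"
  "e \<in> arcs E \<Longrightarrow> f \<in> arcs E \<Longrightarrow> e \<noteq> f \<Longrightarrow> \<Phi> (gh e) * \<Phi> (ed f) = 0"
  using \<Phi>_relator[OF leavitt_relators.idem[of v]] \<Phi>_relator[OF leavitt_relators.orth[of v _ w]]
    \<Phi>_relator[OF leavitt_relators.edge_source[of e]] \<Phi>_relator[OF leavitt_relators.edge_range[of e]]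
    \<Phi>_relator[OF leavitt_relators.ghost_source[of e]] \<Phi>_relator[OF leavitt_relators.ghost_range[of e]]
    \<Phi>_relator[OF leavitt_relators.CK1_same[of e]] \<Phi>_relator[OF leavitt_relators.CK1_diff[of e _ f]]
  by (simp_all add: \<Phi>_diff \<Phi>_C_mult C_gens)

lemma family: "leavitt_family E scalar (\<lambda>v. \<Phi> (vx v)) (\<lambda>e. \<Phi> (ed e)) (\<lambda>e. \<Phi> (gh e))"
proof unfold_locales
  show "scalar (c * d) = scalar c * scalar d" for c d
    using \<Phi>_mult[OF const_hull const_hull, of c d] by (simp add: mult_single)
  show "scalar 1 * \<Phi> (vx v) = \<Phi> (vx v)" if "v \<in> verts E" for v
    using \<Phi>_scalar[OF C_gens(1)[OF that], of 1] by simp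
  show "\<Phi> (vx v) = (\<Sum>e\<in>out_arcs E v. \<Phi> (ed e) * \<Phi> (gh e))" if "regular_vertex E v" for v
  proof -
    have "(\<Sum>e\<in>out_arcs E v. \<Phi> (ed e) * \<Phi> (gh e)) = \<Phi> (\<Sum>e\<in>out_arcs E v. ed e * gh e)"
      unfolding \<Phi>_sum by (intro sum.cong refl) (simp add: \<Phi>_C_mult C_gens)
    then show ?thesis using \<Phi>_relator[OF leavitt_relators.CK2[OF that]] by (simp add: \<Phi>_diff)
  qed
qed (simp_all add: \<Phi>_add single_add \<Phi>_scalar_commute C_gens \<Phi>_relators)

sublocale fam: leavitt_family E scalar "\<lambda>v. \<Phi> (vx v)" "\<lambda>e. \<Phi> (ed e)" "\<lambda>e. \<Phi> (gh e)"
  by (rule family)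

end

context lpa
begin

lemma quotient_exists':
  assumes "lid I" and sc: "\<And>c x. x \<in> I \<Longrightarrow> scale c x \<in> I"
  shows "\<exists>\<Phi> :: ('v,'e,'k::field) free_elem \<Rightarrow> ('v,'e,'k) free_elem endo. lpa_quotient E I \<Phi>"
proof -
  have hull: "scale.subspace unital_hull"
    unfolding scale.subspace_def by (auto simp: hull_add scale_eq hull_mult const_hull)
      (simp add: unital_hull_def)
  have I: "scale.subspace I"
    unfolding scale.subspace_def using lid_zero[OF assms(1)] lid_add[OF assms(1)] sc by auto
  have mult: "x * y \<in> I \<and> y * x \<in> I" if "x \<in> unital_hull" "y \<in> I" for x y
    using that
  proof (induction arbitrary: y rule: hull_induct)
    case (const c)
    then show ?case using sc[of y c] const_commute[of c y] by (simp add: scale_eq)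
  next
    case (mult g x)
    have "monomial g \<in> C" using mult(1) by (auto simp: generators_def C_gens)
    then have "monomial g * (x * y) \<in> I" "y * monomial g * x \<in> I"
      using mult.IH mult.prems lid_mult[OF assms(1)] by blast+
    then show ?case by (simp add: mult.assoc)
  qed (use lid_zero[OF assms(1)] lid_add[OF assms(1)] in \<open>auto simp: distrib_left distrib_right\<close>)
  have "\<exists>\<Phi> :: ('v,'e,'k) free_elem \<Rightarrow> ('v,'e,'k) free_elem endo. (\<forall>x y. \<Phi> (x + y) = \<Phi> x + \<Phi> y) \<and>
     (\<forall>x\<in>unital_hull. \<forall>y\<in>unital_hull. \<Phi> (x * y) = \<Phi> x * \<Phi> y) \<and> (\<forall>x\<in>unital_hull. \<Phi> x = 0 \<longleftrightarrow> x \<in> I)"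
  proof (rule quotient_in_endo[OF scale.vector_space_axioms hull I])
    show "I \<subseteq> unital_hull" using lid_sub[OF assms(1)] C_hull by blast
    show "1 \<in> unital_hull" using const_hull[of 1] by simp
  qed (use mult hull_mult in auto)
  then obtain \<Phi> :: "('v,'e,'k) free_elem \<Rightarrow> ('v,'e,'k) free_elem endo" where
    \<Phi>: "\<forall>x y. \<Phi> (x + y) = \<Phi> x + \<Phi> y"
      "\<forall>x\<in>unital_hull. \<forall>y\<in>unital_hull. \<Phi> (x * y) = \<Phi> x * \<Phi> y" "\<forall>x\<in>unital_hull. \<Phi> x = 0 \<longleftrightarrow> x \<in> I"
    by (elim exE conjE)
  have "lpa_quotient E I \<Phi>"
    by unfold_locales (use assms(1) \<Phi> in auto)
  then show ?thesis by blast
qed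

end

context lpa_quotient
begin

lemma \<Phi>_span: "x \<in> C \<Longrightarrow> \<exists>n. fam.span_upto n (\<Phi> x)"
proof (induction rule: C_induct)
  case zero
  show ?case using fam.span_upto.zero by auto
next
  case (add x y)
  then obtain n m where "fam.span_upto n (\<Phi> x)" "fam.span_upto m (\<Phi> y)" by blast
  then have "fam.span_upto (max n m) (\<Phi> x)" "fam.span_upto (max n m) (\<Phi> y)"
    using fam.span_mono by auto
  then show ?case using fam.span_add by (auto simp: \<Phi>_add)
next
  case (scale c x)
  then show ?case using fam.span_scale by (auto simp: \<Phi>_scalar)
next
  case (gen g)
  then consider v where "g = Vertex v" "v \<in> verts E" | e where "g = Edge e" "e \<in> arcs E"
    | e where "g = Ghost e" "e \<in> arcs E" by (auto simp: generators_def)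
  then show ?case
  proof cases
    case 1
    then show ?thesis using fam.span_p by blast
  next
    case 2
    then show ?thesis using fam.span_s by blast
  next
    case 3
    then show ?thesis using fam.span_t by blast
  qed
next
  case (mult g x)
  then obtain n where n: "fam.span_upto n (\<Phi> x)" by blast
  from mult(1) consider v where "g = Vertex v" "v \<in> verts E" | e where "g = Edge e" "e \<in> arcs E"
    | e where "g = Ghost e" "e \<in> arcs E" by (auto simp: generators_def)
  then show ?case
  proof cases
    case 1
    then show ?thesis using fam.span_p_left[OF n] mult(2) by (intro exI[of _ n]) (simp add: \<Phi>_C_mult C_gens)
  next
    case 2
    then show ?thesis using fam.span_s_left[OF n] mult(2) by (intro exI[of _ n]) (simp add: \<Phi>_C_mult C_gens)
  next
    case 3
    then show ?thesis using fam.span_t_left[OF n] mult(2) by (intro exI[of _ "Suc n"]) (simp add: \<Phi>_C_mult C_gens)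
  qed
qed

end

context lpa
begin

text \<open>
  Applied to the relations themselves: in the Leavitt path algebra sums of vertices are local units.
\<close>

lemma local_unit:
  assumes "(x :: ('v,'e,'k::field) free_elem) \<in> C"
  obtains u where "u \<in> C" "x * u - x \<in> R" "u * x - x \<in> R"
proof -
  have "lid (R :: ('v,'e,'k) free_elem set)"
    unfolding lid_def using R_sub by (simp add: R_diff R_mult)
  from quotient_exists'[OF this R_scale]
  obtain \<Phi> :: "('v,'e,'k) free_elem \<Rightarrow> ('v,'e,'k) free_elem endo" where "lpa_quotient E R \<Phi>" ..
  then interpret lpa_quotient E R \<Phi> .
  obtain n where "fam.span_upto n (\<Phi> x)" using \<Phi>_span[OF assms] by blast
  then obtain V where V: "finite V" "V \<subseteq> verts E" "\<Phi> x * (\<Sum>v\<in>V. \<Phi> (vx v)) = \<Phi> x" "(\<Sum>v\<in>V. \<Phi> (vx v)) * \<Phi> x = \<Phi> x"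
    by (rule fam.span_local_unit)
  define u :: "('v,'e,'k) free_elem" where "u = (\<Sum>v\<in>V. vx v)"
  have u: "u \<in> C" unfolding u_def using V by (intro C_sum C_gens) auto
  have "\<Phi> (x * u) = \<Phi> x" "\<Phi> (u * x) = \<Phi> x"
    using V assms u by (simp_all add: \<Phi>_C_mult) (simp_all add: u_def \<Phi>_sum)
  then show ?thesis using that[OF u] \<Phi>_eq_iff C_mult assms u by metis
qed

text \<open>
  With a local unit \<open>u\<close> of \<open>x\<close>, scaling \<open>x\<close> amounts to multiplying it by the element \<open>c u\<close>. So ring ideals
  of the Leavitt path algebra are subspaces.
\<close>

lemma lid_scale:
  assumes "lid J" "x \<in> J" shows "scale c x \<in> J"
proof -
  have x: "x \<in> C" using assms lid_sub by blast
  obtain u where u: "u \<in> C" "u * x - x \<in> R" using local_unit[OF x] by blast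
  have "scale c (u * x - x) \<in> J" using u R_scale lid_R[OF assms(1)] by blast
  then have "scale c u * x - scale c x \<in> J" by (simp add: scale_eq algebra_simps)
  moreover have "scale c u * x \<in> J" using u C_scale lid_mult[OF assms] by blast
  ultimately show ?thesis using lid_cong[OF assms(1)] by blast
qed

lemma quotient_exists:
  assumes "lid I"
  obtains \<Phi> :: "('v,'e,'k::field) free_elem \<Rightarrow> ('v,'e,'k) free_elem endo" where "lpa_quotient E I \<Phi>"
proof -
  from quotient_exists'[OF assms lid_scale[OF assms]]
  obtain \<Phi> :: "('v,'e,'k) free_elem \<Rightarrow> ('v,'e,'k) free_elem endo" where "lpa_quotient E I \<Phi>" ..
  then show ?thesis by (rule that)
qed

text \<open>
  The annihilators below are ideals; as there is no identity, primeness only shows at first that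
  \<open>a x\<close> is in \<open>P\<close> for all \<open>x\<close>, and a local unit of \<open>a\<close> is needed to conclude.
\<close>

lemma lprime_element:
  fixes a b :: "('v,'e,'k::field) free_elem" and P :: "('v,'e,'k) free_elem set"
  assumes P: "lprime P" and a: "a \<in> C" "a \<notin> P" and b: "b \<in> C" "b \<notin> P"
  obtains x where "x \<in> C" "a * x * b \<notin> P"
proof -
  have "\<exists>x\<in>C. a * x * b \<notin> P"
  proof (rule ccontr)
    assume "\<not> ?thesis"
    then have *: "a * x * b \<in> P" if "x \<in> C" for x using that by blast
    note lP = lprimeD_lid[OF P]
    define B where "B = {y \<in> C. \<forall>x\<in>C. a * x * y \<in> P}"
    define A where "A = {w \<in> C. \<forall>y\<in>B. w * y \<in> P}"
    have "lid B"
      unfolding lid_def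
    proof (intro conjI ballI subsetI)
      fix y :: "('v,'e,'k) free_elem" assume y: "y \<in> R"
      then have "a * x * y \<in> P" if "x \<in> C" for x
        using that R_mult(1)[OF y] C_mult[OF a(1) that] lid_R[OF lP] by blast
      then show "y \<in> B" using y R_sub by (auto simp: B_def)
    next
      fix y z :: "('v,'e,'k) free_elem" assume "y \<in> B" "z \<in> C"
      then have y: "y \<in> C" "\<And>x. x \<in> C \<Longrightarrow> a * x * y \<in> P" by (auto simp: B_def)
      have "a * (x * z) * y \<in> P" "a * x * y * z \<in> P" if "x \<in> C" for x
        using y(2)[OF C_mult[OF that \<open>z \<in> C\<close>]] lid_mult(2)[OF lP y(2)[OF that] \<open>z \<in> C\<close>] .
      then show "z * y \<in> B" "y * z \<in> B"
        using C_mult[OF y(1) \<open>z \<in> C\<close>] C_mult[OF \<open>z \<in> C\<close> y(1)] by (auto simp: B_def mult.assoc)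
    qed (use lid_diff[OF lP] C_diff in \<open>auto simp: B_def right_diff_distrib\<close>)
    have BC: "\<And>y. y \<in> B \<Longrightarrow> y \<in> C" using \<open>lid B\<close> lid_sub by blast
    have "lid A"
      unfolding lid_def
    proof (intro conjI ballI subsetI)
      fix w :: "('v,'e,'k) free_elem" assume w: "w \<in> R"
      then show "w \<in> A" using R_mult(2)[OF w] BC lid_R[OF lP] R_sub by (auto simp: A_def)
    next
      fix w z :: "('v,'e,'k) free_elem" assume w: "w \<in> A" "z \<in> C"
      then have "w * (z * y) \<in> P" "z * (w * y) \<in> P" if "y \<in> B" for y
        using that lid_mult(1)[OF \<open>lid B\<close>] lid_mult(1)[OF lP] by (auto simp: A_def)
      then show "z * w \<in> A" "w * z \<in> A" using w C_mult by (auto simp: A_def mult.assoc)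
    qed (use lid_diff[OF lP] C_diff in \<open>auto simp: A_def left_diff_distrib\<close>)
    have "\<forall>w\<in>A. \<forall>y\<in>B. w * y \<in> P" by (auto simp: A_def)
    then have "A \<subseteq> P \<or> B \<subseteq> P" using P \<open>lid A\<close> \<open>lid B\<close> by (auto simp: lprime_def)
    moreover have "b \<in> B" using * b by (auto simp: B_def)
    ultimately have "A \<subseteq> P" using b by blast
    obtain u where u: "u \<in> C" "a * u - a \<in> R" using local_unit[OF a(1)] by blast
    then have "a * u \<in> A" using C_mult a(1) by (auto simp: A_def B_def)
    then have "a * u \<in> P" using \<open>A \<subseteq> P\<close> by blast
    then show False using lid_cong[OF lP] u(2) lid_R[OF lP] a(2) by blast
  qed
  then show ?thesis using that by blast
qed

end

section \<open>Graded ideals\<close>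

definition homogeneous :: "int \<Rightarrow> ('v,'e,'k::field) free_elem \<Rightarrow> bool" where
  "homogeneous n x \<longleftrightarrow> (\<forall>w \<in> Poly_Mapping.keys x. word_degree w = n)"

definition component :: "int \<Rightarrow> ('v,'e,'k::field) free_elem \<Rightarrow> ('v,'e,'k) free_elem" where
  "component n x = Poly_Mapping.mapp (\<lambda>w c. if word_degree w = n then c else 0) x"

lemma lookup_component: "Poly_Mapping.lookup (component n x) w = (if word_degree w = n then Poly_Mapping.lookup x w else 0)"
  by (auto simp: component_def lookup_mapp when_def in_keys_iff)

lemma component_add: "component n (x + y) = component n x + component n y"
  by (rule poly_mapping_eqI) (simp add: lookup_component lookup_add)

lemma component_diff: "component n (x - y) = component n x - component n y"
  by (rule poly_mapping_eqI) (simp add: lookup_component lookup_minus)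

lemma component_0 [simp]: "component n 0 = 0"
  by (rule poly_mapping_eqI) (simp add: lookup_component)

lemma component_sum: "component n (sum f A) = (\<Sum>i\<in>A. component n (f i))"
  by (induction A rule: infinite_finite_induct) (simp_all add: component_add)

lemma homogeneous_component: "homogeneous n (component n x)"
  by (auto simp: homogeneous_def in_keys_iff lookup_component split: if_splits)

lemma component_homogeneous: "homogeneous m x \<Longrightarrow> component n x = (if m = n then x else 0)"
  by (rule poly_mapping_eqI) (auto simp: lookup_component homogeneous_def in_keys_iff)

lemma keys_component: "Poly_Mapping.keys (component n x) \<subseteq> Poly_Mapping.keys x"
  by (auto simp: in_keys_iff lookup_component split: if_splits)

lemma sum_components: "(\<Sum>n\<in>word_degree ` Poly_Mapping.keys x. component n x) = x"
proof (rule poly_mapping_eqI)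
  fix w
  have "Poly_Mapping.lookup (\<Sum>n\<in>word_degree ` Poly_Mapping.keys x. component n x) w
    = (\<Sum>n\<in>word_degree ` Poly_Mapping.keys x. if n = word_degree w then Poly_Mapping.lookup x w else 0)"
    unfolding lookup_sum by (intro sum.cong refl) (auto simp: lookup_component)
  also have "\<dots> = Poly_Mapping.lookup x w" by (auto simp: in_keys_iff)
  finally show "Poly_Mapping.lookup (\<Sum>n\<in>word_degree ` Poly_Mapping.keys x. component n x) w = Poly_Mapping.lookup x w" .
qed

lemma word_degree_plus: "word_degree (u + w) = word_degree u + word_degree w"
  by (simp add: word_degree_def plus_gword_def)

lemma homogeneous_0: "homogeneous n 0"
  by (simp add: homogeneous_def)

lemma homogeneous_add: "homogeneous n x \<Longrightarrow> homogeneous n y \<Longrightarrow> homogeneous n (x + y)"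
  unfolding homogeneous_def using Poly_Mapping.keys_add[of x y] by blast

lemma homogeneous_diff: "homogeneous n x \<Longrightarrow> homogeneous n y \<Longrightarrow> homogeneous n (x - y)"
  unfolding homogeneous_def by (auto simp: in_keys_iff lookup_minus)

lemma homogeneous_sum: "(\<And>i. i \<in> A \<Longrightarrow> homogeneous n (f i)) \<Longrightarrow> homogeneous n (sum f A)"
  by (induction A rule: infinite_finite_induct) (auto simp: homogeneous_0 homogeneous_add)

lemma homogeneous_mult: "homogeneous m x \<Longrightarrow> homogeneous n y \<Longrightarrow> homogeneous (m + n) (x * y)"
  unfolding homogeneous_def using keys_mult[of x y] by (fastforce simp: word_degree_plus)

lemma homogeneous_scale: "homogeneous n x \<Longrightarrow> homogeneous n (Poly_Mapping.single 0 c * x)"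
  using homogeneous_mult[of 0 "Poly_Mapping.single 0 c" n x]
  by (simp add: homogeneous_def word_degree_def zero_gword_def)

lemma homogeneous_gens: "homogeneous 0 (vx v)" "homogeneous 1 (ed e)" "homogeneous (-1) (gh e)"
  by (simp_all add: homogeneous_def monomial_def word_degree_def)

lemma component_mult_homogeneous:
  assumes "homogeneous m a"
  shows "component n (a * x) = a * component (n - m) x" "component n (x * a) = component (n - m) x * a"
proof -
  have "component n (a * x) = (\<Sum>i\<in>word_degree ` Poly_Mapping.keys x. component n (a * component i x))"
    by (subst sum_components[of x, symmetric]) (simp only: sum_distrib_left component_sum)
  also have "\<dots> = (\<Sum>i\<in>word_degree ` Poly_Mapping.keys x. a * component (n - m) (component i x))"
  proof (rule sum.cong[OF refl])
    fix i
    show "component n (a * component i x) = a * component (n - m) (component i x)"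
      using component_homogeneous[OF homogeneous_mult[OF assms homogeneous_component[of i x]], of n]
        component_homogeneous[OF homogeneous_component[of i x], of "n - m"] by auto
  qed
  also have "\<dots> = a * component (n - m) x"
    by (simp only: sum_distrib_left[symmetric] component_sum[symmetric] sum_components)
  finally show "component n (a * x) = a * component (n - m) x" .
  have "component n (x * a) = (\<Sum>i\<in>word_degree ` Poly_Mapping.keys x. component n (component i x * a))"
    by (subst sum_components[of x, symmetric]) (simp only: sum_distrib_right component_sum)
  also have "\<dots> = (\<Sum>i\<in>word_degree ` Poly_Mapping.keys x. component (n - m) (component i x) * a)"
  proof (rule sum.cong[OF refl])
    fix i
    show "component n (component i x * a) = component (n - m) (component i x) * a"
      using component_homogeneous[OF homogeneous_mult[OF homogeneous_component[of i x] assms], of n]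
        component_homogeneous[OF homogeneous_component[of i x], of "n - m"] by auto
  qed
  also have "\<dots> = component (n - m) x * a"
    by (simp only: sum_distrib_right[symmetric] component_sum[symmetric] sum_components)
  finally show "component n (x * a) = component (n - m) x * a" .
qed

context lpa
begin

lemma C_component: "x \<in> C \<Longrightarrow> component n x \<in> C"
  using keys_component[of n x] by (auto simp: C_iff)

text \<open>
  The largest graded ideal in \<open>P\<close>: it consists of the elements all of whose components are in \<open>P\<close>.
\<close>

definition gr :: "('v,'e,'k::field) free_elem set \<Rightarrow> ('v,'e,'k) free_elem set" where
  "gr P = {x \<in> C. \<forall>n. component n x \<in> P}"

definition graded_lid :: "('v,'e,'k::field) free_elem set \<Rightarrow> bool" where
  "graded_lid I \<longleftrightarrow> lid I \<and> (\<forall>x\<in>I. \<forall>n. component n x \<in> I)"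

lemma relators_homogeneous: "x \<in> leavitt_relators E \<Longrightarrow> \<exists>n. homogeneous n x"
proof (induction rule: leavitt_relators.induct)
  case (idem v)
  show ?case using homogeneous_mult[OF homogeneous_gens(1) homogeneous_gens(1)] homogeneous_gens(1)
    by (intro exI[of _ 0] homogeneous_diff) auto
next
  case (orth v w)
  show ?case using homogeneous_mult[OF homogeneous_gens(1)[of v] homogeneous_gens(1)[of w]] by blast
next
  case (edge_source e)
  show ?case using homogeneous_mult[OF homogeneous_gens(1) homogeneous_gens(2)] homogeneous_gens(2)
    by (intro exI[of _ 1] homogeneous_diff) auto
next
  case (edge_range e)
  show ?case using homogeneous_mult[OF homogeneous_gens(2) homogeneous_gens(1)] homogeneous_gens(2)
    by (intro exI[of _ 1] homogeneous_diff) auto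
next
  case (ghost_source e)
  show ?case using homogeneous_mult[OF homogeneous_gens(1) homogeneous_gens(3)] homogeneous_gens(3)
    by (intro exI[of _ "-1"] homogeneous_diff) auto
next
  case (ghost_range e)
  show ?case using homogeneous_mult[OF homogeneous_gens(3) homogeneous_gens(1)] homogeneous_gens(3)
    by (intro exI[of _ "-1"] homogeneous_diff) auto
next
  case (CK1_same e)
  show ?case using homogeneous_mult[OF homogeneous_gens(3) homogeneous_gens(2)] homogeneous_gens(1)
    by (intro exI[of _ 0] homogeneous_diff) auto
next
  case (CK1_diff e f)
  show ?case using homogeneous_mult[OF homogeneous_gens(3)[of e] homogeneous_gens(2)[of f]] by blast
next
  case (CK2 v)
  show ?case using homogeneous_mult[OF homogeneous_gens(2) homogeneous_gens(3)] homogeneous_gens(1)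
    by (intro exI[of _ 0] homogeneous_diff homogeneous_sum) auto
qed

lemma component_mult_in:
  assumes mult: "\<And>y z. y \<in> C \<Longrightarrow> z \<in> J \<Longrightarrow> y * z \<in> J \<and> z * y \<in> J"
    and sum: "\<And>(A :: int set) f. (\<And>i. i \<in> A \<Longrightarrow> f i \<in> J) \<Longrightarrow> sum f A \<in> J"
    and "\<And>n. component n x \<in> J" "y \<in> C"
  shows "component n (y * x) \<in> J" "component n (x * y) \<in> J"
proof -
  let ?D = "word_degree ` Poly_Mapping.keys y"
  have "component n (y * x) = (\<Sum>i\<in>?D. component n (component i y * x))"
    by (subst sum_components[of y, symmetric]) (simp only: sum_distrib_right component_sum)
  moreover have "component n (component i y * x) \<in> J" for i
    using mult[OF C_component[OF \<open>y \<in> C\<close>] assms(3)]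
    unfolding component_mult_homogeneous(1)[OF homogeneous_component] by blast
  ultimately show "component n (y * x) \<in> J" using sum[of ?D "\<lambda>i. component n (component i y * x)"] by simp
  have "component n (x * y) = (\<Sum>i\<in>?D. component n (x * component i y))"
    by (subst sum_components[of y, symmetric]) (simp only: sum_distrib_left component_sum)
  moreover have "component n (x * component i y) \<in> J" for i
    using mult[OF C_component[OF \<open>y \<in> C\<close>] assms(3)]
    unfolding component_mult_homogeneous(2)[OF homogeneous_component] by blast
  ultimately show "component n (x * y) \<in> J" using sum[of ?D "\<lambda>i. component n (x * component i y)"] by simp
qed

lemma R_sum: "(\<And>i. i \<in> A \<Longrightarrow> f i \<in> R) \<Longrightarrow> sum f A \<in> R"
  by (induction A rule: infinite_finite_induct) (auto simp: R_zero R_add)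

text \<open>
  The relators are homogeneous, so the relations are a graded ideal. This makes the Leavitt path algebra
  graded: a decomposition into components is unique.
\<close>

lemma R_component:
  assumes "(x :: ('v,'e,'k::field) free_elem) \<in> R" shows "component n x \<in> R"
proof -
  have cm: "component n (y * x) \<in> R" "component n (x * y) \<in> R"
    if "\<And>n. component n x \<in> R" "y \<in> C" for n and x y :: "('v,'e,'k) free_elem"
    by (rule component_mult_in[OF _ R_sum that]; simp add: R_mult)+
  let ?K = "{x \<in> C. \<forall>n. component n x \<in> R} :: ('v,'e,'k) free_elem set"
  have "R \<subseteq> ?K"
  proof (rule R_least)
    show "two_sided_ideal ?K (free_algebra E :: ('v,'e,'k) free_elem ring)"
      by (auto simp: tsi_free C_zero C_diff C_mult component_diff R_zero R_diff cm)
    show "scale c x \<in> ?K" if "x \<in> ?K"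
      for c :: 'k and x :: "('v,'e,'k) free_elem"
    proof -
      have "homogeneous 0 (Poly_Mapping.single 0 c)"
        by (simp add: homogeneous_def word_degree_def zero_gword_def)
      from component_mult_homogeneous(1)[OF this]
      have "component n (scale c x) = scale c (component n x)" for n by (simp add: scale_eq)
      then show ?thesis using that by (simp add: C_scale R_scale)
    qed
    show "leavitt_relators E \<subseteq> ?K"
    proof
      fix x :: "('v,'e,'k) free_elem" assume x: "x \<in> leavitt_relators E"
      then obtain m where "homogeneous m x" using relators_homogeneous by blast
      then show "x \<in> ?K"
        using x R_relators R_zero relators_C by (auto simp: component_homogeneous)
    qed
  qed
  then show ?thesis using assms by blast
qed

lemma gr_graded_lid:
  assumes "lid P" shows "graded_lid (gr P)"
proof -
  have cm: "component n (y * x) \<in> P" "component n (x * y) \<in> P"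
    if "\<And>n. component n x \<in> P" "y \<in> C" for n x y
    by (rule component_mult_in[OF _ lid_sum[OF assms] that]; simp add: lid_mult[OF assms])+
  have "R \<subseteq> gr P" using lid_R[OF assms] R_component R_sub by (auto simp: gr_def)
  then have "lid (gr P)"
    unfolding lid_def
    by (auto simp: gr_def C_diff C_mult component_diff cm lid_diff[OF assms])
  moreover have "component m (component n x) \<in> P" if "component n x \<in> P" for m n x
    using that component_homogeneous[OF homogeneous_component[of n x], of m] lid_zero[OF assms] by auto
  ultimately show ?thesis by (auto simp: graded_lid_def gr_def C_component)
qed

lemma gr_sub: "lid P \<Longrightarrow> gr P \<subseteq> P"
proof
  fix x assume "lid P" "x \<in> gr P"
  then have "(\<Sum>n\<in>word_degree ` Poly_Mapping.keys x. component n x) \<in> P"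
    by (intro lid_sum) (auto simp: gr_def)
  then show "x \<in> P" by (simp add: sum_components)
qed

lemma gr_greatest: "graded_lid I \<Longrightarrow> I \<subseteq> P \<Longrightarrow> I \<subseteq> gr P"
  using lid_sub by (auto simp: gr_def graded_lid_def)

lemma gr_eq_iff: "lid P \<Longrightarrow> gr P = P \<longleftrightarrow> graded_lid P"
  using gr_graded_lid[of P] gr_sub[of P] gr_greatest[of P P] by auto

lemma homogeneous_in_gr: "lid P \<Longrightarrow> homogeneous n x \<Longrightarrow> x \<in> P \<Longrightarrow> x \<in> gr P"
  using lid_sub[of P x] lid_zero[of P] by (auto simp: gr_def component_homogeneous)

lemma finsum_cls:
  assumes "finite A" "\<And>n. n \<in> A \<Longrightarrow> f n \<in> C"
  shows "finsum L (\<lambda>n. cls (f n :: ('v,'e,'k::field) free_elem)) A = cls (\<Sum>n\<in>A. f n)"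
proof -
  interpret L: abelian_group "L :: ('v,'e,'k) lpa_elem ring" by (rule abelian_group_L)
  show ?thesis using assms
  proof (induction A rule: finite_induct)
    case empty
    show ?case by (simp add: L_zero)
  next
    case (insert a A)
    then show ?case by (subst L.finsum_insert) (auto simp: L_carrier L_add)
  qed
qed

lemma lpa_component_eq: "lpa_component E n = cls ` {x \<in> C. homogeneous n x}"
  by (simp add: lpa_component_def homogeneous_def)

lemma homogeneous_decomposition:
  fixes f :: "int \<Rightarrow> ('v,'e,'k::field) lpa_elem"
  assumes f: "\<And>n. f n \<in> lpa_component E n" and fin: "finite {n. f n \<noteq> \<zero>\<^bsub>L\<^esub>}"
    and x: "cls x = finsum L f {n. f n \<noteq> \<zero>\<^bsub>L\<^esub>}"
  shows "f n = cls (component n x)"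
proof -
  have "\<forall>n. \<exists>y. y \<in> C \<and> homogeneous n y \<and> f n = cls y" using f unfolding lpa_component_eq by blast
  then obtain y where y: "\<And>n. y n \<in> C" "\<And>n. homogeneous n (y n)" "\<And>n. f n = cls (y n)" by metis
  let ?A = "{n. f n \<noteq> \<zero>\<^bsub>L\<^esub>}"
  have "cls x = finsum L (\<lambda>n. cls (y n)) ?A" using x y(3) by (metis ext)
  then have "cls x = cls (\<Sum>n\<in>?A. y n)" using finsum_cls[OF fin, of y] y(1) by simp
  then have "component n (x - (\<Sum>n\<in>?A. y n)) \<in> R" unfolding cls_eq_iff by (rule R_component)
  moreover have "component n (\<Sum>n\<in>?A. y n) = (if n \<in> ?A then y n else 0)"
    unfolding component_sum using fin by (simp add: component_homogeneous[OF y(2)])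
  moreover have "y n \<in> R" if "n \<notin> ?A"
    using that y(3)[of n] by (simp add: L_zero cls_eq_iff)
  ultimately have "component n x - y n \<in> R"
    using R_diff by (cases "n \<in> ?A") (auto simp: component_diff)
  then show ?thesis by (simp add: y(3) cls_eq_iff[symmetric])
qed

text \<open>
  Uniqueness of decompositions is automatic, so an ideal is graded as soon as it contains the
  components of its elements.
\<close>

lemma graded_ideal_iff:
  assumes J: "lid (J :: ('v,'e,'k::field) free_elem set)"
  shows "graded_ideal E (cls ` J) \<longleftrightarrow> graded_lid J"
proof
  assume g: "graded_ideal E (cls ` J)"
  have "component n x \<in> J" if x: "x \<in> J" for n x
  proof -
    have "cls x \<in> cls ` J" using x by blast
    from ex1_implies_ex[OF bspec[OF conjunct2[OF g[unfolded graded_ideal_def]] this]]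
    obtain f where f: "\<forall>n. f n \<in> cls ` J \<inter> lpa_component E n"
      "finite {n. f n \<noteq> \<zero>\<^bsub>L\<^esub>}" "cls x = finsum L f {n. f n \<noteq> \<zero>\<^bsub>L\<^esub>}"
      by (elim exE conjE)
    have "f n = cls (component n x)" by (rule homogeneous_decomposition[OF _ f(2,3)]) (use f(1) in blast)
    then show ?thesis using f(1) cls_mem_iff[OF J] by (metis IntD1)
  qed
  then show "graded_lid J" using J by (auto simp: graded_lid_def)
next
  assume g: "graded_lid J"
  have uniq: "\<exists>!f. (\<forall>n. f n \<in> cls ` J \<inter> lpa_component E n) \<and> finite {n. f n \<noteq> \<zero>\<^bsub>L\<^esub>} \<and>
        cls x = finsum L f {n. f n \<noteq> \<zero>\<^bsub>L\<^esub>}" if x: "x \<in> J" for x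
  proof (rule ex1I)
    let ?f = "\<lambda>n. cls (component n x)"
    let ?D = "word_degree ` Poly_Mapping.keys x"
    have sub: "{n. ?f n \<noteq> \<zero>\<^bsub>L\<^esub>} \<subseteq> ?D"
    proof
      fix n assume "n \<in> {n. ?f n \<noteq> \<zero>\<^bsub>L\<^esub>}"
      then have "component n x \<noteq> 0" by (auto simp: L_zero)
      then obtain w where "Poly_Mapping.lookup (component n x) w \<noteq> 0" by (metis poly_mapping_eqI lookup_zero)
      then show "n \<in> ?D" by (auto simp: lookup_component in_keys_iff image_iff split: if_splits)
    qed
    then have fin: "finite {n. ?f n \<noteq> \<zero>\<^bsub>L\<^esub>}" by (rule finite_subset) simp
    have xC: "x \<in> C" using J x lid_sub by blast
    have "x - (\<Sum>n\<in>{n. ?f n \<noteq> \<zero>\<^bsub>L\<^esub>}. component n x) = (\<Sum>n\<in>?D - {n. ?f n \<noteq> \<zero>\<^bsub>L\<^esub>}. component n x)"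
      using sum.subset_diff[OF sub, of "\<lambda>n. component n x"] by (simp add: sum_components diff_eq_eq)
    also have "\<dots> \<in> R" by (rule R_sum) (auto simp: L_zero cls_eq_iff)
    finally have "cls x = cls (\<Sum>n\<in>{n. ?f n \<noteq> \<zero>\<^bsub>L\<^esub>}. component n x)" by (simp add: cls_eq_iff)
    then have "cls x = finsum L ?f {n. ?f n \<noteq> \<zero>\<^bsub>L\<^esub>}"
      using finsum_cls[OF fin, of "\<lambda>n. component n x"] C_component[OF xC] by simp
    moreover have "?f n \<in> cls ` J \<inter> lpa_component E n" for n
      using g x C_component[OF xC] homogeneous_component unfolding lpa_component_eq graded_lid_def by blast
    ultimately show "(\<forall>n. ?f n \<in> cls ` J \<inter> lpa_component E n) \<and> finite {n. ?f n \<noteq> \<zero>\<^bsub>L\<^esub>} \<and>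
        cls x = finsum L ?f {n. ?f n \<noteq> \<zero>\<^bsub>L\<^esub>}" using fin by blast
    fix f assume f: "(\<forall>n. f n \<in> cls ` J \<inter> lpa_component E n) \<and> finite {n. f n \<noteq> \<zero>\<^bsub>L\<^esub>} \<and>
        cls x = finsum L f {n. f n \<noteq> \<zero>\<^bsub>L\<^esub>}"
    show "f = ?f"
    proof
      fix n show "f n = ?f n" by (rule homogeneous_decomposition) (use f in auto)
    qed
  qed
  have "\<forall>a\<in>cls ` J. \<exists>!f. (\<forall>n. f n \<in> cls ` J \<inter> lpa_component E n) \<and> finite {n. f n \<noteq> \<zero>\<^bsub>L\<^esub>} \<and>
        a = finsum L f {n. f n \<noteq> \<zero>\<^bsub>L\<^esub>}"
  proof
    fix a assume "a \<in> cls ` J"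
    then obtain x where x: "x \<in> J" "a = cls x" by blast
    show "\<exists>!f. (\<forall>n. f n \<in> cls ` J \<inter> lpa_component E n) \<and> finite {n. f n \<noteq> \<zero>\<^bsub>L\<^esub>} \<and>
        a = finsum L f {n. f n \<noteq> \<zero>\<^bsub>L\<^esub>}" unfolding x(2) by (rule uniq[OF x(1)])
  qed
  then show "graded_ideal E (cls ` J)" unfolding graded_ideal_def tsi_L_iff using J by blast
qed

lemma graded_part_eq:
  assumes P: "lid P" shows "graded_part E (cls ` P) = cls ` gr P"
  unfolding graded_part_def
proof (rule Greatest_equality)
  have gl: "lid (gr P)" using gr_graded_lid[OF P] by (simp add: graded_lid_def)
  show "graded_ideal E (cls ` gr P) \<and> cls ` gr P \<subseteq> cls ` P"
    using graded_ideal_iff[OF gl] gr_graded_lid[OF P] gr_sub[OF P] by blast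
  fix I assume I: "graded_ideal E I \<and> I \<subseteq> cls ` P"
  then obtain J where J: "lid J" "I = cls ` J" by (auto simp: graded_ideal_def tsi_L_iff)
  then have "graded_lid J" using I graded_ideal_iff[OF J(1)] by simp
  moreover have "J \<subseteq> P" using cls_image_subset_iff[OF J(1) P] I J(2) by simp
  ultimately show "I \<le> cls ` gr P" unfolding J(2) by (intro image_mono gr_greatest)
qed

definition generated :: "('v,'e,'k::field) free_elem set \<Rightarrow> ('v,'e,'k) free_elem set" where
  "generated A = C \<inter> \<Inter> {J. lid J \<and> A \<subseteq> J}"

lemma generated_lid: "lid (generated A)"
  unfolding generated_def by (rule lid_Inter) auto

lemma generated_least: "lid J \<Longrightarrow> A \<subseteq> J \<Longrightarrow> generated A \<subseteq> J"
  by (auto simp: generated_def)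

lemma generated_sub: "A \<subseteq> C \<Longrightarrow> A \<subseteq> generated A"
  by (auto simp: generated_def)

lemma ideal_generated_by_eq:
  assumes "A \<subseteq> C" shows "ideal_generated_by L (cls ` A) = cls ` generated A"
proof
  show "ideal_generated_by L (cls ` A) \<subseteq> cls ` generated A"
    unfolding ideal_generated_by_def tsi_L_iff using generated_lid[of A] generated_sub[OF assms] by blast
  show "cls ` generated A \<subseteq> ideal_generated_by L (cls ` A)"
  proof -
    have "cls ` generated A \<subseteq> I" if I: "two_sided_ideal I L" "cls ` A \<subseteq> I" for I
    proof -
      obtain J where J: "lid J" "I = cls ` J" using I(1) unfolding tsi_L_iff by (elim exE conjE)
      then have "A \<subseteq> J" using I(2) cls_mem_iff[OF J(1)] by blast
      then show ?thesis using generated_least[OF J(1)] J(2) by blast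
    qed
    then show ?thesis unfolding ideal_generated_by_def by blast
  qed
qed

lemma generated_graded:
  assumes "A \<subseteq> C" "\<And>a. a \<in> A \<Longrightarrow> \<exists>n. homogeneous n a"
  shows "graded_lid (generated A)"
proof -
  have "A \<subseteq> gr (generated A)"
    using assms generated_sub[OF assms(1)] homogeneous_in_gr[OF generated_lid[of A]] by blast
  then have "generated A \<subseteq> gr (generated A)"
    using gr_graded_lid[OF generated_lid[of A]] generated_least unfolding graded_lid_def by blast
  then show ?thesis using gr_sub[OF generated_lid[of A]] gr_eq_iff[OF generated_lid[of A]] by blast
qed

end

section \<open>Quotient graphs\<close>

locale admissible = wf_digraph E for E :: "('v,'e) pre_digraph" +
  fixes H U :: "'v set"
  assumes adm: "admissible_pair E H U"
begin

text \<open>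
  \<open>F\<close> is the quotient graph. The vertices in \<open>B\<close> are those that have a copy \<open>v'\<close> in it, and \<open>W v\<close> are the
  edges at \<open>v\<close> that survive in it.
\<close>

definition B :: "'v set" where "B = breaking_vertices E H - U"
definition F :: "('v + 'v, 'e + 'e) pre_digraph" where "F = quotient_graph E H U"
definition W :: "'v \<Rightarrow> 'e set" where "W v = {e. e \<in> out_arcs E v \<and> head E e \<notin> H}"

primrec base :: "'z + 'z \<Rightarrow> 'z" where
  "base (Inl v) = v"
| "base (Inr v) = v"

lemma F_verts [simp]: "Inl v \<in> verts F \<longleftrightarrow> v \<in> verts E \<and> v \<notin> H" "Inr v \<in> verts F \<longleftrightarrow> v \<in> B"
  by (auto simp: F_def quotient_graph_def B_def)

lemma F_arcs [simp]: "Inl e \<in> arcs F \<longleftrightarrow> e \<in> arcs E \<and> head E e \<notin> H"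
  "Inr e \<in> arcs F \<longleftrightarrow> e \<in> arcs E \<and> head E e \<in> B"
  by (auto simp: F_def quotient_graph_def B_def)

lemma F_tail [simp]: "tail F x = Inl (tail E (base x))"
  by (cases x) (auto simp: F_def quotient_graph_def)

lemma F_head [simp]: "head F (Inl e) = Inl (head E e)" "head F (Inr e) = Inr (head E e)"
  by (auto simp: F_def quotient_graph_def)

lemma B_D: "v \<in> B \<Longrightarrow> v \<in> verts E" "v \<in> B \<Longrightarrow> v \<notin> H"
  by (auto simp: B_def breaking_vertices_def)

lemma H_verts: "H \<subseteq> verts E" and U_breaking: "U \<subseteq> breaking_vertices E H"
  using adm by (auto simp: admissible_pair_def hereditary_def)

lemma H_head: "e \<in> arcs E \<Longrightarrow> tail E e \<in> H \<Longrightarrow> head E e \<in> H"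
proof -
  assume e: "e \<in> arcs E" "tail E e \<in> H"
  then have "(tail E e, head E e) \<in> arcs_ends E" by (auto simp: arcs_ends_conv)
  then have "tail E e \<rightarrow>\<^sup>*\<^bsub>E\<^esub> head E e" by (rule reachable_adjI)
  then show ?thesis using adm e unfolding admissible_pair_def hereditary_def by blast
qed

sublocale F: wf_digraph F
proof
  fix x assume "x \<in> arcs F"
  then show "tail F x \<in> verts F" "head F x \<in> verts F"
    using H_head B_D by (cases x; force)+
qed

lemma arcs_F_base: "x \<in> arcs F \<Longrightarrow> base x \<in> arcs E" "x \<in> arcs F \<Longrightarrow> head E (base x) \<notin> H"
  "base (head F x) = head E (base x)"
  using B_D by (cases x; auto)+

lemma out_arcs_Inl: "v \<in> verts E \<Longrightarrow> v \<notin> H \<Longrightarrow> out_arcs F (Inl v) = Inl ` W v \<union> Inr ` {e \<in> W v. head E e \<in> B}"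
  using B_D by (auto simp: out_arcs_def W_def image_iff Bex_def) (metis F_arcs base.simps sum.exhaust)+

lemma out_arcs_Inr: "out_arcs F (Inr v) = {}"
  by (auto simp: out_arcs_def)

text \<open>
  The copies \<open>v'\<close> are sinks. A vertex \<open>v\<close> of \<open>E\<close> is regular in the quotient graph if finitely many edges,
  and at least one, survive; this turns the breaking vertices into regular ones.
\<close>

lemma regular_F_iff: "regular_vertex F x \<longleftrightarrow>
    (\<exists>v. x = Inl v \<and> v \<in> verts E \<and> v \<notin> H \<and> finite (W v) \<and> W v \<noteq> {})"
proof (cases x)
  case (Inl v)
  then show ?thesis by (auto simp: regular_vertex_def out_arcs_Inl finite_image_iff)
next
  case (Inr v)
  then show ?thesis by (auto simp: regular_vertex_def out_arcs_Inr)
qed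

lemma W_breaking: "v \<in> breaking_vertices E H \<Longrightarrow> v \<in> verts E \<and> v \<notin> H \<and> finite (W v) \<and> W v \<noteq> {}"
  by (auto simp: breaking_vertices_def W_def)

lemma W_regular: "regular_vertex E v \<Longrightarrow> v \<notin> H \<Longrightarrow> finite (W v) \<and> W v \<noteq> {}"
proof
  assume r: "regular_vertex E v" "v \<notin> H"
  show "finite (W v)"
    by (rule finite_subset[of _ "out_arcs E v"]) (use r in \<open>auto simp: W_def regular_vertex_def\<close>)
  have "\<not> head E ` out_arcs E v \<subseteq> H"
    using adm r unfolding admissible_pair_def saturated_def by blast
  then show "W v \<noteq> {}" by (auto simp: W_def)
qed

lemma W_cases:
  assumes "v \<in> verts E" "v \<notin> H" "finite (W v)" "W v \<noteq> {}"
  shows "regular_vertex E v \<or> v \<in> breaking_vertices E H"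
  using assms by (auto simp: regular_vertex_def breaking_vertices_def infinite_emitter_def W_def)

lemma B_not_regular: "v \<in> B \<Longrightarrow> \<not> regular_vertex E v"
  by (auto simp: B_def breaking_vertices_def infinite_emitter_def regular_vertex_def)

lemma sum_out_arcs_F:
  assumes "v \<in> verts E" "v \<notin> H" "finite (W v)"
  shows "(\<Sum>x\<in>out_arcs F (Inl v). h x) = (\<Sum>e\<in>W v. h (Inl e) + (if head E e \<in> B then h (Inr e) else (0::'z::comm_monoid_add)))"
proof -
  have "(\<Sum>x\<in>out_arcs F (Inl v). h x) = (\<Sum>x\<in>Inl ` W v. h x) + (\<Sum>x\<in>Inr ` {e \<in> W v. head E e \<in> B}. h x)"
    unfolding out_arcs_Inl[OF assms(1,2)] using assms(3) by (intro sum.union_disjoint) auto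
  also have "\<dots> = (\<Sum>e\<in>W v. h (Inl e)) + (\<Sum>e\<in>W v. if head E e \<in> B then h (Inr e) else 0)"
    using assms(3) by (simp add: sum.reindex sum.inter_filter)
  finally show ?thesis by (simp add: sum.distrib)
qed

end

subsection \<open>From families of the graph to families of the quotient graph\<close>

locale family_over_quotient = admissible E H U + leavitt_family E \<kappa> p s t
  for E :: "('v,'e) pre_digraph" and H U and \<kappa> :: "'k::field \<Rightarrow> 'a::ring_1" and p s t +
  assumes p_H: "v \<in> H \<Longrightarrow> p v = 0"
    and p_U: "v \<in> U \<Longrightarrow> p v = (\<Sum>e\<in>W v. s e * t e)"
begin

text \<open>
  For a breaking vertex, \<open>v\<close> is split into the two orthogonal idempotents \<open>\<sigma> v\<close> and \<open>v - \<sigma> v = v\<^sup>H\<close>, which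
  represent the vertices \<open>v\<close> and \<open>v'\<close> of the quotient graph. An edge into \<open>v\<close> is split accordingly.
\<close>

definition \<sigma> :: "'v \<Rightarrow> 'a" where "\<sigma> v = (\<Sum>e\<in>W v. s e * t e)"

primrec q :: "'v + 'v \<Rightarrow> 'a" where
  "q (Inl v) = (if v \<in> B then \<sigma> v else p v)"
| "q (Inr v) = p v - \<sigma> v"

definition s' :: "'e + 'e \<Rightarrow> 'a" where "s' x = s (base x) * q (head F x)"
definition t' :: "'e + 'e \<Rightarrow> 'a" where "t' x = q (head F x) * t (base x)"

lemma s_H: "e \<in> arcs E \<Longrightarrow> head E e \<in> H \<Longrightarrow> s e = 0"
  using s_range[of e] p_H[of "head E e"] by simp

lemma t_H: "e \<in> arcs E \<Longrightarrow> head E e \<in> H \<Longrightarrow> t e = 0"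
  using t_source[of e] p_H[of "head E e"] by simp

lemma WD: "e \<in> W v \<Longrightarrow> e \<in> arcs E \<and> tail E e = v \<and> head E e \<notin> H"
  by (auto simp: W_def out_arcs_def)

lemma p_\<sigma>: "p v * \<sigma> v = \<sigma> v"
  unfolding \<sigma>_def sum_distrib_left
proof (rule sum.cong[OF refl])
  fix e assume "e \<in> W v"
  then have "p v * s e = s e" using s_source WD by blast
  then show "p v * (s e * t e) = s e * t e" by (simp add: mult.assoc[symmetric])
qed

lemma \<sigma>_p: "\<sigma> v * p v = \<sigma> v"
  unfolding \<sigma>_def sum_distrib_right
proof (rule sum.cong[OF refl])
  fix e assume "e \<in> W v"
  then have "t e * p v = t e" using t_range WD by blast
  then show "s e * t e * p v = s e * t e" by (simp add: mult.assoc)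
qed

lemma \<sigma>_s:
  assumes "finite (W v)" "e \<in> arcs E" "tail E e = v" shows "\<sigma> v * s e = s e"
proof (cases "head E e \<in> H")
  case False
  then have e: "e \<in> W v" using assms by (auto simp: W_def out_arcs_def)
  have "\<sigma> v * s e = (\<Sum>f\<in>W v. s f * (t f * s e))" by (simp add: \<sigma>_def sum_distrib_right mult.assoc)
  also have "\<dots> = (\<Sum>f\<in>W v. if f = e then s e else 0)"
    using assms WD by (intro sum.cong refl) (auto simp: ts s_range)
  also have "\<dots> = s e" using assms(1) e by simp
  finally show ?thesis .
qed (use s_H assms in simp)

lemma t_\<sigma>:
  assumes "finite (W v)" "e \<in> arcs E" "tail E e = v" shows "t e * \<sigma> v = t e"
proof (cases "head E e \<in> H")
  case False
  then have e: "e \<in> W v" using assms by (auto simp: W_def out_arcs_def)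
  have "t e * \<sigma> v = (\<Sum>f\<in>W v. (t e * s f) * t f)" by (simp add: \<sigma>_def sum_distrib_left mult.assoc)
  also have "\<dots> = (\<Sum>f\<in>W v. if f = e then t e else 0)"
    using assms WD by (intro sum.cong refl) (auto simp: ts t_source)
  also have "\<dots> = t e" using assms(1) e by simp
  finally show ?thesis .
qed (use t_H assms in simp)

lemma \<sigma>_idem: "finite (W v) \<Longrightarrow> \<sigma> v * \<sigma> v = \<sigma> v"
proof -
  assume "finite (W v)"
  then have "\<sigma> v * (s e * t e) = s e * t e" if "e \<in> W v" for e
    using \<sigma>_s[of v e] WD[OF that] by (simp add: mult.assoc[symmetric])
  then have "(\<Sum>e\<in>W v. \<sigma> v * (s e * t e)) = \<sigma> v" by (simp add: \<sigma>_def)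
  then show ?thesis by (simp add: \<sigma>_def sum_distrib_left)
qed

lemma \<kappa>_\<sigma>: "\<sigma> v * \<kappa> c = \<kappa> c * \<sigma> v"
  unfolding \<sigma>_def sum_distrib_left sum_distrib_right
proof (rule sum.cong[OF refl])
  fix e assume "e \<in> W v"
  then show "s e * t e * \<kappa> c = \<kappa> c * (s e * t e)"
    using WD[of e v] \<kappa>_s[of e c] \<kappa>_t[of e c] by (metis mult.assoc)
qed

lemma B_finite: "v \<in> B \<Longrightarrow> finite (W v)"
  using W_breaking by (auto simp: B_def)

lemma base_verts: "x \<in> verts F \<Longrightarrow> base x \<in> verts E"
  using B_D by (cases x) auto

lemma p_q: "x \<in> verts F \<Longrightarrow> p (base x) * q x = q x"
  using B_D by (cases x) (auto simp: p_\<sigma> p_idem right_diff_distrib)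

lemma q_p: "x \<in> verts F \<Longrightarrow> q x * p (base x) = q x"
  using B_D by (cases x) (auto simp: \<sigma>_p p_idem left_diff_distrib)

lemma q_idem: "x \<in> verts F \<Longrightarrow> q x * q x = q x"
  using B_D by (cases x) (auto simp: \<sigma>_p p_\<sigma> \<sigma>_idem B_finite p_idem left_diff_distrib right_diff_distrib)

lemma q_orth:
  assumes "x \<in> verts F" "y \<in> verts F" "x \<noteq> y" shows "q x * q y = 0"
proof (cases "base x = base y")
  case True
  then show ?thesis using assms B_D B_finite
    by (cases x; cases y) (auto simp: \<sigma>_p p_\<sigma> \<sigma>_idem left_diff_distrib right_diff_distrib)
next
  case False
  have "q x * q y = q x * (p (base x) * p (base y)) * q y"
    using p_q[OF assms(2)] q_p[OF assms(1)] by (metis mult.assoc)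
  then show ?thesis using p_orth[OF base_verts base_verts False] assms by simp
qed

lemma q_\<kappa>: "x \<in> verts F \<Longrightarrow> q x * \<kappa> c = \<kappa> c * q x"
  using B_D \<kappa>_p[of "base x" c] \<kappa>_\<sigma>[of "base x" c] by (cases x) (auto simp: left_diff_distrib right_diff_distrib)

lemma q_tail: "e \<in> arcs E \<Longrightarrow> q (Inl (tail E e)) * s e = s e" "e \<in> arcs E \<Longrightarrow> t e * q (Inl (tail E e)) = t e"
  using \<sigma>_s t_\<sigma> B_finite s_source t_range by auto

lemma q_decompose: "v \<notin> H \<Longrightarrow> q (Inl v) + (if v \<in> B then q (Inr v) else 0) = p v"
  by simp

lemma head_F_verts: "x \<in> arcs F \<Longrightarrow> head F x \<in> verts F"
  by (rule F.head_in_verts)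

lemma \<sigma>_eq_q:
  assumes "v \<in> verts E" "v \<notin> H" "finite (W v)" "W v \<noteq> {}" shows "\<sigma> v = q (Inl v)"
proof (cases "v \<in> B")
  case False
  from W_cases[OF assms] show ?thesis
  proof
    assume r: "regular_vertex E v"
    have "(\<Sum>e\<in>out_arcs E v. s e * t e) = (\<Sum>e\<in>W v. s e * t e)"
      using r s_H by (intro sum.mono_neutral_right) (auto simp: regular_vertex_def W_def out_arcs_def)
    then show ?thesis using CK2[OF r] False by (simp add: \<sigma>_def)
  next
    assume "v \<in> breaking_vertices E H"
    then have "v \<in> U" using False by (simp add: B_def)
    then show ?thesis using p_U False by (simp add: \<sigma>_def)
  qed
qed simp

text \<open>
  The relation at a regular vertex of the quotient graph is the definition of \<open>\<sigma> v\<close> if \<open>v\<close> is in \<open>B\<close>. For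
  the other breaking vertices it says that \<open>v\<^sup>H\<close> vanishes, and for a vertex that is regular in \<open>E\<close>
  it is the relation of \<open>E\<close>, in which the edges into \<open>H\<close> contribute nothing.
\<close>

theorem quotient_family: "leavitt_family F \<kappa> q s' t'"
proof
  show "\<kappa> (c + d) = \<kappa> c + \<kappa> d" "\<kappa> (c * d) = \<kappa> c * \<kappa> d" for c d by (fact \<kappa>_add, fact \<kappa>_mult)
  show "q x * \<kappa> c = \<kappa> c * q x" if "x \<in> verts F" for x c using q_\<kappa>[OF that] .
  show "s' x * \<kappa> c = \<kappa> c * s' x" "t' x * \<kappa> c = \<kappa> c * t' x" if x: "x \<in> arcs F" for x c
  proof -
    have comm: "a * b * k = k * (a * b)" if "a * k = k * a" "b * k = k * b" for a b k :: 'a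
    proof -
      have "a * b * k = (a * k) * b" using that(2) by (simp add: mult.assoc)
      then show ?thesis using that(1) by (simp add: mult.assoc)
    qed
    show "s' x * \<kappa> c = \<kappa> c * s' x" "t' x * \<kappa> c = \<kappa> c * t' x"
      unfolding s'_def t'_def
      by (intro comm q_\<kappa> head_F_verts \<kappa>_s \<kappa>_t arcs_F_base x)+
  qed
  show "\<kappa> 1 * q x = q x" if x: "x \<in> verts F" for x
    using \<kappa>_one_p[OF base_verts[OF x], of "q x"] p_q[OF x] by simp
  show "q x * q x = q x" if "x \<in> verts F" for x using q_idem[OF that] .
  show "q x * q y = 0" if "x \<in> verts F" "y \<in> verts F" "x \<noteq> y" for x y using q_orth[OF that] .
  show "q (tail F x) * s' x = s' x" "t' x * q (tail F x) = t' x" if x: "x \<in> arcs F" for x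
    using q_tail[OF arcs_F_base(1)[OF x]] unfolding s'_def t'_def F_tail by (metis mult.assoc)+
  show "s' x * q (head F x) = s' x" "q (head F x) * t' x = t' x" if x: "x \<in> arcs F" for x
    using q_idem[OF head_F_verts[OF x]] unfolding s'_def t'_def by (metis mult.assoc)+
  have ts': "t' x * s' y = q (head F x) * (t (base x) * s (base y)) * q (head F y)" for x y
    by (simp add: s'_def t'_def mult.assoc)
  show "t' x * s' x = q (head F x)" if x: "x \<in> arcs F" for x
    unfolding ts' using ts_same[OF arcs_F_base(1)[OF x]] q_p[OF head_F_verts[OF x]] q_idem[OF head_F_verts[OF x]]
    by (simp add: arcs_F_base(3))
  show "t' x * s' y = 0" if xy: "x \<in> arcs F" "y \<in> arcs F" "x \<noteq> y" for x y
  proof (cases "base x = base y")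
    case True
    then have "head F x \<noteq> head F y" using xy(3) by (cases x; cases y) auto
    then show ?thesis unfolding ts'
      using True ts_same[OF arcs_F_base(1)[OF xy(1)]] q_p[OF head_F_verts[OF xy(1)]]
        q_orth[OF head_F_verts[OF xy(1)] head_F_verts[OF xy(2)]]
      by (simp add: arcs_F_base(3))
  next
    case False
    then show ?thesis unfolding ts' using ts_diff[OF arcs_F_base(1)[OF xy(1)] arcs_F_base(1)[OF xy(2)]] by simp
  qed
  show "q x = (\<Sum>y\<in>out_arcs F x. s' y * t' y)" if "regular_vertex F x" for x
  proof -
    obtain v where v: "x = Inl v" "v \<in> verts E" "v \<notin> H" "finite (W v)" "W v \<noteq> {}"
      using \<open>regular_vertex F x\<close> unfolding regular_F_iff by blast
    have st: "s' y * t' y = s (base y) * q (head F y) * t (base y)" if "y \<in> arcs F" for y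
      using q_idem[OF head_F_verts[OF that]] unfolding s'_def t'_def by (metis mult.assoc)
    have "(\<Sum>y\<in>out_arcs F x. s' y * t' y) =
      (\<Sum>e\<in>W v. s' (Inl e) * t' (Inl e) + (if head E e \<in> B then s' (Inr e) * t' (Inr e) else 0))"
      unfolding v(1) by (rule sum_out_arcs_F) fact+
    also have "\<dots> = (\<Sum>e\<in>W v. s e * t e)"
    proof (rule sum.cong[OF refl])
      fix e assume e: "e \<in> W v"
      then have e': "e \<in> arcs E" "head E e \<notin> H" using WD by auto
      have "s' (Inl e) * t' (Inl e) + (if head E e \<in> B then s' (Inr e) * t' (Inr e) else 0)
        = s e * (q (Inl (head E e)) + (if head E e \<in> B then q (Inr (head E e)) else 0)) * t e"
        using e' by (simp add: st distrib_left distrib_right del: q.simps)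
      also have "\<dots> = s e * t e" unfolding q_decompose[OF e'(2)] using s_range[OF e'(1)] by simp
      finally show "s' (Inl e) * t' (Inl e) + (if head E e \<in> B then s' (Inr e) * t' (Inr e) else 0) = s e * t e" .
    qed
    finally show ?thesis using \<sigma>_eq_q[OF v(2-5)] v(1) by (simp add: \<sigma>_def)
  qed
qed

end

subsection \<open>From families of the quotient graph to families of the graph\<close>

locale family_of_quotient = admissible E H U + fam: leavitt_family "quotient_graph E H U" \<kappa> q s' t'
  for E :: "('v,'e) pre_digraph" and H U and \<kappa> :: "'k::field \<Rightarrow> 'a::ring_1" and q s' t'
begin

text \<open>
  The reverse of the splitting: \<open>v\<close> becomes \<open>v + v'\<close> and \<open>e\<close> becomes \<open>e + e'\<close>, with zero for a missing summand.
\<close>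

definition p :: "'v \<Rightarrow> 'a" where
  "p v = (if v \<in> H then 0 else q (Inl v)) + (if v \<in> B then q (Inr v) else 0)"
definition s :: "'e \<Rightarrow> 'a" where
  "s e = (if head E e \<in> H then 0 else s' (Inl e)) + (if head E e \<in> B then s' (Inr e) else 0)"
definition t :: "'e \<Rightarrow> 'a" where
  "t e = (if head E e \<in> H then 0 else t' (Inl e)) + (if head E e \<in> B then t' (Inr e) else 0)"

lemmas F_rules = fam.p_p[folded F_def] fam.p_s[folded F_def] fam.s_p[folded F_def] fam.p_t[folded F_def]
  fam.t_p[folded F_def] fam.ts[folded F_def]

lemma st_W:
  assumes "v \<in> verts E" "v \<notin> H" "finite (W v)" "W v \<noteq> {}"
  shows "(\<Sum>e\<in>W v. s e * t e) = q (Inl v)"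
proof -
  have "regular_vertex F (Inl v)" using assms by (simp add: regular_F_iff)
  then have "q (Inl v) = (\<Sum>x\<in>out_arcs F (Inl v). s' x * t' x)" using fam.CK2 by (simp add: F_def)
  also have "\<dots> = (\<Sum>e\<in>W v. s' (Inl e) * t' (Inl e) + (if head E e \<in> B then s' (Inr e) * t' (Inr e) else 0))"
    by (rule sum_out_arcs_F) fact+
  also have "\<dots> = (\<Sum>e\<in>W v. s e * t e)"
  proof (rule sum.cong[OF refl])
    fix e assume "e \<in> W v"
    then have e: "e \<in> arcs E" "head E e \<notin> H" by (auto simp: W_def out_arcs_def)
    have "s' x * t' y = 0" if "x \<in> arcs F" "y \<in> arcs F" "head F x \<noteq> head F y" for x y
    proof -
      have "s' x * t' y = s' x * q (head F x) * t' y" using fam.s_range that by (simp add: F_def)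
      also have "\<dots> = 0" using fam.p_t[of y "head F x"] that F.head_in_verts[of x] by (simp add: F_def mult.assoc)
      finally show ?thesis .
    qed
    then show "s' (Inl e) * t' (Inl e) + (if head E e \<in> B then s' (Inr e) * t' (Inr e) else 0) = s e * t e"
      using e by (simp add: s_def t_def distrib_left distrib_right)
  qed
  finally show ?thesis by simp
qed

theorem family: "leavitt_family E \<kappa> p s t"
proof
  show "\<kappa> (c + d) = \<kappa> c + \<kappa> d" "\<kappa> (c * d) = \<kappa> c * \<kappa> d" for c d by (fact fam.\<kappa>_add, fact fam.\<kappa>_mult)
  show "p v * \<kappa> c = \<kappa> c * p v" if "v \<in> verts E" for v c
    using that fam.\<kappa>_p[folded F_def, of _ c] by (simp add: p_def distrib_left distrib_right)
  show "s e * \<kappa> c = \<kappa> c * s e" if "e \<in> arcs E" for e c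
    using that fam.\<kappa>_s[folded F_def, of _ c] by (simp add: s_def distrib_left distrib_right)
  show "t e * \<kappa> c = \<kappa> c * t e" if "e \<in> arcs E" for e c
    using that fam.\<kappa>_t[folded F_def, of _ c] by (simp add: t_def distrib_left distrib_right)
  show "\<kappa> 1 * p v = p v" if "v \<in> verts E" for v
    using that fam.\<kappa>_one[folded F_def] by (simp add: p_def distrib_left)
  show "p v * p v = p v" if "v \<in> verts E" for v
    using that by (simp add: p_def distrib_left distrib_right F_rules)
  show "p v * p w = 0" if "v \<in> verts E" "w \<in> verts E" "v \<noteq> w" for v w
    using that by (simp add: p_def distrib_left distrib_right F_rules)
  fix e assume e: "e \<in> arcs E"
  have h: "head E e \<in> B \<Longrightarrow> head E e \<notin> H" "tail E e \<in> H \<Longrightarrow> head E e \<in> H" using B_D H_head[OF e] by blast+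
  show "p (tail E e) * s e = s e" "t e * p (tail E e) = t e"
    using e h by (auto simp: p_def s_def t_def distrib_left distrib_right F_rules)
  show "s e * p (head E e) = s e" "p (head E e) * t e = t e"
    using e h by (auto simp: p_def s_def t_def distrib_left distrib_right F_rules)
  show "t e * s e = p (head E e)"
    using e h by (auto simp: p_def s_def t_def distrib_left distrib_right F_rules)
  show "t e * s f = 0" if "f \<in> arcs E" "e \<noteq> f" for f
    using e that by (simp add: s_def t_def distrib_left distrib_right F_rules)
next
  fix v assume r: "regular_vertex E v"
  show "p v = (\<Sum>e\<in>out_arcs E v. s e * t e)"
  proof (cases "v \<in> H")
    case True
    then have "s e = 0" if "e \<in> out_arcs E v" for e
      using that H_head[of e] B_D by (auto simp: s_def out_arcs_def)
    then show ?thesis using True B_D by (auto simp: p_def)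
  next
    case False
    have "(\<Sum>e\<in>out_arcs E v. s e * t e) = (\<Sum>e\<in>W v. s e * t e)"
      using r B_D by (intro sum.mono_neutral_right) (auto simp: regular_vertex_def W_def out_arcs_def s_def)
    moreover have "v \<notin> B" using B_not_regular r by blast
    moreover have "v \<in> verts E" using r by (simp add: regular_vertex_def)
    ultimately show ?thesis using st_W False W_regular[OF r False] by (simp add: p_def)
  qed
qed

end

section \<open>A representation on branching systems\<close>

lemma card_finite_times_infinite:
  includes cardinal_syntax
  assumes "finite A" "A \<noteq> {}" "infinite (UNIV :: 'z set)"
  obtains b where "bij_betw b (A \<times> (UNIV :: 'z set)) (UNIV :: 'z set)"
proof -
  have "|A| \<le>o |UNIV :: 'z set|" using assms by (metis card_of_ordLeq_infinite card_of_Well_order ordLeq_total)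
  then have "|A \<times> (UNIV :: 'z set)| =o |UNIV :: 'z set|"
    using card_of_Times_infinite[OF assms(3,2)] by blast
  then show ?thesis using that card_of_ordIso by blast
qed

context wf_digraph
begin

text \<open>
  Non-zero vertices are shown to exist by a representation. Over each vertex \<open>u\<close> outside \<open>Y\<close> lies a copy of
  an infinite set \<open>D\<close>, and an edge \<open>f\<close> acts as an injection of the copy over its range into the copy over its
  source. These injections have disjoint images, which cover the copy over \<open>u\<close> if \<open>u\<close> is
  regular; this is possible as finitely many copies of \<open>D\<close> are equipotent with \<open>D\<close>. Taking lists of
  edges for \<open>D\<close> makes it large enough for infinite emitters.
\<close>

lemma branching_representation:
  fixes Y :: "'a set"
  assumes her: "\<And>e. e \<in> arcs G \<Longrightarrow> tail G e \<in> Y \<Longrightarrow> head G e \<in> Y" and sat: "saturated G Y"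
  shows "\<exists>(\<kappa> :: 'k::field \<Rightarrow> ('a \<times> 'b list \<Rightarrow> 'k) endo) q s t.
    leavitt_family G \<kappa> q s t \<and> (\<forall>u\<in>verts G. q u = 0 \<longleftrightarrow> u \<in> Y)"
proof -
  define Out where "Out u = {f \<in> out_arcs G u. head G f \<notin> Y}" for u
  have "\<exists>b. inj_on b (Out u \<times> (UNIV :: 'b list set)) \<and>
    (regular_vertex G u \<longrightarrow> u \<notin> Y \<longrightarrow> b ` (Out u \<times> UNIV) = (UNIV :: 'b list set))" for u
  proof (cases "regular_vertex G u \<and> u \<notin> Y")
    case True
    then have "\<not> head G ` out_arcs G u \<subseteq> Y" "finite (out_arcs G u)"
      using sat by (auto simp: regular_vertex_def saturated_def)
    then have "Out u \<noteq> {}" by (auto simp: Out_def)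
    have "Out u \<subseteq> out_arcs G u" unfolding Out_def by blast
    then have "finite (Out u)" using \<open>finite (out_arcs G u)\<close> by (rule finite_subset)
    obtain b where "bij_betw b (Out u \<times> (UNIV :: 'b list set)) (UNIV :: 'b list set)"
      using card_finite_times_infinite[OF \<open>finite (Out u)\<close> \<open>Out u \<noteq> {}\<close> infinite_UNIV_listI] .
    then show ?thesis by (auto simp: bij_betw_def)
  next
    case False
    then show ?thesis by (intro exI[of _ "\<lambda>(f, d). f # d"]) (auto simp: inj_on_def)
  qed
  then obtain b where inj: "\<And>u. inj_on (b u) (Out u \<times> (UNIV :: 'b list set))"
    and surj: "\<And>u. regular_vertex G u \<Longrightarrow> u \<notin> Y \<Longrightarrow> b u ` (Out u \<times> UNIV) = (UNIV :: 'b list set)"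
    by metis
  \<comment> \<open>\<open>code f\<close> is the injection given by \<open>f\<close>, and \<open>decode f\<close> its inverse\<close>
  define code where "code f d = b (tail G f) (f, d)" for f d
  define decode where "decode f z = (SOME d. code f d = z)" for f z
  \<comment> \<open>edges into \<open>Y\<close> act as zero, as nothing lies over their range\<close>
  define live where "live f \<longleftrightarrow> f \<in> arcs G \<and> head G f \<notin> Y" for f
  have code_inj: "code f d = code f' d' \<longleftrightarrow> f = f' \<and> d = d'" if "live f" "live f'" "tail G f = tail G f'" for f f' d d'
  proof -
    have "(f, d) \<in> Out (tail G f) \<times> UNIV" "(f', d') \<in> Out (tail G f) \<times> UNIV"
      using that by (auto simp: Out_def live_def)
    from inj_on_eq_iff[OF inj this] show ?thesis using that(3) by (simp add: code_def)
  qed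
  have decode [simp]: "decode f (code f d) = d" if "live f" for f d
    unfolding decode_def using code_inj[OF that that refl] by simp
  define K :: "'k \<Rightarrow> ('a \<times> 'b list \<Rightarrow> 'k) endo" where "K c = Endo (\<lambda>\<phi> z. c * \<phi> z)" for c
  define q :: "'a \<Rightarrow> ('a \<times> 'b list \<Rightarrow> 'k) endo" where
    "q u = Endo (\<lambda>\<phi> z. if fst z = u \<and> u \<notin> Y then \<phi> z else 0)" for u
  define s :: "'b \<Rightarrow> ('a \<times> 'b list \<Rightarrow> 'k) endo" where
    "s f = Endo (\<lambda>\<phi> z. if live f \<and> fst z = tail G f \<and> snd z \<in> range (code f)
      then \<phi> (head G f, decode f (snd z)) else 0)" for f
  define t :: "'b \<Rightarrow> ('a \<times> 'b list \<Rightarrow> 'k) endo" where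
    "t f = Endo (\<lambda>\<phi> z. if live f \<and> fst z = head G f then \<phi> (tail G f, code f (snd z)) else 0)" for f
  have K: "app (K c) = (\<lambda>\<phi> z. c * \<phi> z)" for c
    unfolding K_def by (subst Endo_inverse) (auto simp: fun_eq_iff distrib_left)
  have q: "app (q u) = (\<lambda>\<phi> z. if fst z = u \<and> u \<notin> Y then \<phi> z else 0)" for u
    unfolding q_def by (subst Endo_inverse) (auto simp: fun_eq_iff)
  have s: "app (s f) = (\<lambda>\<phi> z. if live f \<and> fst z = tail G f \<and> snd z \<in> range (code f)
      then \<phi> (head G f, decode f (snd z)) else 0)" for f
    unfolding s_def by (subst Endo_inverse) (auto simp: fun_eq_iff)
  have t: "app (t f) = (\<lambda>\<phi> z. if live f \<and> fst z = head G f then \<phi> (tail G f, code f (snd z)) else 0)" for f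
    unfolding t_def by (subst Endo_inverse) (auto simp: fun_eq_iff)
  note app = K q s t app_simps
  have tail_Y: "live f \<Longrightarrow> tail G f \<notin> Y" for f using her by (auto simp: live_def)
  have "leavitt_family G K q s t"
  proof
    show "K (c + d) = K c + K d" "K (c * d) = K c * K d" for c d
      by (rule endo_eqI; simp add: app fun_eq_iff algebra_simps)+
    show "q v * K c = K c * q v" "s e * K c = K c * s e" "t e * K c = K c * t e" for v e c
      by (rule endo_eqI; simp add: app fun_eq_iff)+
    show "K 1 * q v = q v" "q v * q v = q v" for v
      by (rule endo_eqI; simp add: app fun_eq_iff)+
    show "q v * q w = 0" if "v \<noteq> w" for v w
      using that by (intro endo_eqI) (auto simp: app fun_eq_iff)
    fix e assume "e \<in> arcs G"
    show "q (tail G e) * s e = s e" "t e * q (tail G e) = t e"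
      by (rule endo_eqI; simp add: app fun_eq_iff tail_Y)+
    show "s e * q (head G e) = s e" "q (head G e) * t e = t e"
      by (rule endo_eqI; simp add: app fun_eq_iff; simp add: live_def)+
    show "t e * s e = q (head G e)"
      using \<open>e \<in> arcs G\<close> by (intro endo_eqI) (auto simp: app fun_eq_iff live_def)
    show "t e * s f = 0" if "f \<in> arcs G" "e \<noteq> f" for f
      using code_inj[of e f] that by (intro endo_eqI) (auto simp: app fun_eq_iff)
  next
    fix u assume r: "regular_vertex G u"
    have app_sum: "app (\<Sum>e\<in>A. h e) \<phi> z = (\<Sum>e\<in>A. app (h e) \<phi> z)"
      for A and h :: "'b \<Rightarrow> ('a \<times> 'b list \<Rightarrow> 'k) endo" and \<phi> z
      by (induction A rule: infinite_finite_induct) (auto simp: app_simps)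
    show "q u = (\<Sum>e\<in>out_arcs G u. s e * t e)"
    proof (rule endo_eqI, rule ext)
      fix \<phi> and z :: "'a \<times> 'b list"
      have st: "app (s e * t e) \<phi> z = (if live e \<and> fst z = tail G e \<and> snd z \<in> range (code e) then \<phi> z else 0)" for e
        by (cases z) (auto simp: app)
      show "app (q u) \<phi> z = app (\<Sum>e\<in>out_arcs G u. s e * t e) \<phi> z"
      proof (cases "fst z = u \<and> u \<notin> Y")
        case True
        then have "snd z \<in> b u ` (Out u \<times> UNIV)" using surj[OF r] by simp
        then obtain e0 d0 where e0: "e0 \<in> Out u" "snd z = b u (e0, d0)" by blast
        then have l: "live e0" "tail G e0 = u" "snd z = code e0 d0"
          by (auto simp: Out_def live_def out_arcs_def code_def)
        have "(\<Sum>e\<in>out_arcs G u. app (s e * t e) \<phi> z) = (\<Sum>e\<in>out_arcs G u. if e = e0 then \<phi> z else 0)"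
          unfolding st using True l code_inj by (intro sum.cong refl) (auto simp: out_arcs_def)
        also have "\<dots> = \<phi> z" using r e0(1) by (simp add: regular_vertex_def Out_def)
        finally show ?thesis using True by (simp add: app_sum q)
      next
        case False
        have "(\<Sum>e\<in>out_arcs G u. app (s e * t e) \<phi> z) = 0"
        proof (intro sum.neutral ballI)
          fix e assume "e \<in> out_arcs G u"
          then have "\<not> (live e \<and> fst z = tail G e)" using False tail_Y[of e] by auto
          then show "app (s e * t e) \<phi> z = 0" unfolding st by auto
        qed
        then show ?thesis using False by (auto simp: app_sum q)
      qed
    qed
  qed
  moreover have "q u = 0 \<longleftrightarrow> u \<in> Y" for u
  proof
    assume "q u = 0"
    then have "app (q u) (\<lambda>_. 1) (u, []) = 0" by (simp add: app_simps)
    then show "u \<in> Y" by (simp add: q split: if_splits)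
  next
    assume "u \<in> Y"
    then show "q u = 0" by (intro endo_eqI) (auto simp: app fun_eq_iff)
  qed
  ultimately show ?thesis by blast
qed

end

section \<open>Hereditary and saturated sets\<close>

context wf_digraph
begin

lemma hereditary_iff: "hereditary G Y \<longleftrightarrow> Y \<subseteq> verts G \<and> (\<forall>e\<in>arcs G. tail G e \<in> Y \<longrightarrow> head G e \<in> Y)"
proof
  assume h: "hereditary G Y"
  have "head G e \<in> Y" if "e \<in> arcs G" "tail G e \<in> Y" for e
  proof -
    have "(tail G e, head G e) \<in> arcs_ends G" using that by (auto simp: arcs_ends_conv)
    then have "tail G e \<rightarrow>\<^sup>*\<^bsub>G\<^esub> head G e" by (rule reachable_adjI)
    then show ?thesis using h that(2) unfolding hereditary_def by blast
  qed
  then show "Y \<subseteq> verts G \<and> (\<forall>e\<in>arcs G. tail G e \<in> Y \<longrightarrow> head G e \<in> Y)"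
    using h by (auto simp: hereditary_def)
next
  assume Y: "Y \<subseteq> verts G \<and> (\<forall>e\<in>arcs G. tail G e \<in> Y \<longrightarrow> head G e \<in> Y)"
  have "w \<in> Y" if "awalk v \<alpha> w" "v \<in> Y" for v \<alpha> w
    using that Y by (induction \<alpha> arbitrary: v) (auto simp: awalk_Cons_iff awalk_Nil_iff)
  then show "hereditary G Y" using Y unfolding hereditary_def by (auto simp: reachable_awalk)
qed

text \<open>
  The smallest saturated set that contains \<open>D\<close>; its derivations pass through regular vertices only, and
  can be followed inside \<open>regular_orbit\<close>.
\<close>

inductive_set saturation :: "'a set \<Rightarrow> 'a set" for D where
  base: "w \<in> D \<Longrightarrow> w \<in> saturation D"
| step: "regular_vertex G w \<Longrightarrow> (\<And>e. e \<in> out_arcs G w \<Longrightarrow> head G e \<in> saturation D) \<Longrightarrow> w \<in> saturation D"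

inductive_set regular_orbit :: "'a \<Rightarrow> 'a set" for z where
  base: "z \<in> regular_orbit z"
| step: "w \<in> regular_orbit z \<Longrightarrow> regular_vertex G w \<Longrightarrow> e \<in> out_arcs G w \<Longrightarrow> head G e \<in> regular_orbit z"

text \<open>Each regular vertex emits only finitely many edges, so these orbits are countable.\<close>

lemma countable_regular_orbit: "countable (regular_orbit z)"
proof -
  define lev where "lev = rec_nat {z} (\<lambda>_ A. \<Union>w\<in>{w \<in> A. regular_vertex G w}. head G ` out_arcs G w)"
  have lev: "lev 0 = {z}" "lev (Suc n) = (\<Union>w\<in>{w \<in> lev n. regular_vertex G w}. head G ` out_arcs G w)" for n
    by (simp_all add: lev_def)
  have "countable (lev n)" for n
  proof (induction n)
    case (Suc n)
    have "countable (head G ` out_arcs G w)" if "regular_vertex G w" for w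
      using that by (intro countable_finite finite_imageI) (simp add: regular_vertex_def)
    then show ?case unfolding lev using Suc by (intro countable_UN countable_Collect) auto
  qed (simp add: lev)
  moreover have "w \<in> (\<Union>n. lev n)" if "w \<in> regular_orbit z" for w
    using that
  proof (induction rule: regular_orbit.induct)
    case base
    have "z \<in> lev 0" by (simp add: lev)
    then show ?case by blast
  next
    case (step w e)
    then obtain n where "w \<in> lev n" by blast
    then have "head G e \<in> lev (Suc n)" using step by (auto simp: lev)
    then show ?case by blast
  qed
  ultimately show ?thesis by (meson countable_UN countable_subset subsetI uncountable_def UNIV_I countableI_type)
qed

text \<open>
  A vertex \<open>z\<close> in every non-empty hereditary saturated set lies in the saturation of the set of
  vertices reachable from any given \<open>u\<close>. Its derivation there only uses regular vertices, so it
  leads from \<open>z\<close> to a vertex below \<open>u\<close> in the regular orbit of \<open>z\<close>. Hence countability is automatic.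
\<close>

lemma strong_CSP_if_least_vertex:
  assumes z: "z \<in> verts G"
    and least: "\<And>Y. Y \<noteq> {} \<Longrightarrow> hereditary G Y \<Longrightarrow> saturated G Y \<Longrightarrow> z \<in> Y"
  shows "strong_CSP G"
proof -
  have orbit: "regular_orbit z \<subseteq> Y" if "Y \<noteq> {}" "hereditary G Y" "saturated G Y" for Y
  proof
    fix w assume "w \<in> regular_orbit z"
    then show "w \<in> Y"
    proof (induction rule: regular_orbit.induct)
      case base
      show ?case using least that by blast
    next
      case (step w e)
      then show ?case using that(2) by (auto simp: hereditary_iff)
    qed
  qed
  have "\<exists>v\<in>regular_orbit z. u \<rightarrow>\<^sup>*\<^bsub>G\<^esub> v" if u: "u \<in> verts G" for u
  proof -
    let ?D = "{w. u \<rightarrow>\<^sup>*\<^bsub>G\<^esub> w}"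
    have D: "head G e \<in> ?D" if "e \<in> arcs G" "tail G e \<in> ?D" for e
    proof -
      have "(tail G e, head G e) \<in> arcs_ends G" using that by (auto simp: arcs_ends_conv)
      then show ?thesis using that(2) by (auto intro: reachable_adj_trans)
    qed
    have verts: "saturation ?D \<subseteq> verts G"
    proof
      fix w assume "w \<in> saturation ?D"
      then show "w \<in> verts G" by cases (auto simp: regular_vertex_def elim: reachable_in_vertsE)
    qed
    have "head G e \<in> saturation ?D" if "e \<in> arcs G" "tail G e \<in> saturation ?D" for e
      using that(2)
    proof cases
      case base
      then show ?thesis using D that(1) by (intro saturation.base) auto
    next
      case step
      then show ?thesis using that(1) by auto
    qed
    then have "hereditary G (saturation ?D)" using verts by (auto simp: hereditary_iff)
    moreover have "saturated G (saturation ?D)"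
      using verts unfolding saturated_def by (auto intro: saturation.step)
    moreover have "u \<in> saturation ?D" using u by (intro saturation.base) auto
    ultimately have "z \<in> saturation ?D" using least by blast
    moreover have "\<exists>v\<in>regular_orbit z. u \<rightarrow>\<^sup>*\<^bsub>G\<^esub> v" if "w \<in> saturation ?D" "w \<in> regular_orbit z" for w
      using that
    proof (induction rule: saturation.induct)
      case (step w)
      then obtain e where "e \<in> out_arcs G w" unfolding regular_vertex_def by blast
      then show ?case using step regular_orbit.step by blast
    qed auto
    ultimately show ?thesis using regular_orbit.base by blast
  qed
  moreover have "regular_orbit z \<subseteq> verts G"
    using orbit[of "verts G"] z by (auto simp: hereditary_iff saturated_def regular_vertex_def)
  ultimately show ?thesis
    unfolding strong_CSP_def using countable_regular_orbit orbit by (intro exI[of _ "regular_orbit z"]) blast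
qed

end

context leavitt_family
begin

text \<open>
  Hereditary since \<open>r(e) = e\<^sup>* s(e) e\<close>, saturated since \<open>v = \<Sum>e r(e) e\<^sup>*\<close> for regular \<open>v\<close>.
\<close>

lemma vertices_of_ideal:
  assumes J: "gen_closed J" and add: "\<And>a b. a \<in> J \<Longrightarrow> b \<in> J \<Longrightarrow> a + b \<in> J" and "0 \<in> J"
  shows "hereditary G {v \<in> verts G. p v \<in> J}" "saturated G {v \<in> verts G. p v \<in> J}"
proof -
  have "p (head G e) \<in> J" if "e \<in> arcs G" "p (tail G e) \<in> J" for e
  proof -
    have "t e * (p (tail G e) * s e) \<in> J" using J that by (auto simp: gen_closed_def)
    then show ?thesis using s_source ts_same that(1) by simp
  qed
  then show "hereditary G {v \<in> verts G. p v \<in> J}" by (auto simp: hereditary_iff)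
  have "p v \<in> J" if v: "regular_vertex G v" "\<And>e. e \<in> out_arcs G v \<Longrightarrow> p (head G e) \<in> J" for v
  proof -
    have "s e * t e \<in> J" if "e \<in> out_arcs G v" for e
    proof -
      have "s e * p (head G e) * t e \<in> J" using J v(2)[OF that] that by (auto simp: gen_closed_def)
      then show ?thesis using s_range[of e] that by auto
    qed
    then have "(\<Sum>e\<in>A. s e * t e) \<in> J" if "A \<subseteq> out_arcs G v" for A
      using that by (induction A rule: infinite_finite_induct) (auto simp: \<open>0 \<in> J\<close> add)
    then show ?thesis using CK2[OF v(1)] by simp
  qed
  then show "saturated G {v \<in> verts G. p v \<in> J}"
    unfolding saturated_def regular_vertex_def by blast
qed

text \<open>
  Some monomial \<open>\<alpha>\<beta>\<^sup>*\<close> with \<open>\<alpha>\<close> starting at \<open>u\<close> and \<open>\<beta>\<close> at \<open>v\<close> occurs, and the two paths have the same end.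
\<close>

lemma span_connects:
  assumes "span_upto n a" "u \<in> verts G" "v \<in> verts G" "p u * a * p v \<noteq> 0"
  shows "\<exists>w\<in>verts G. u \<rightarrow>\<^sup>*\<^bsub>G\<^esub> w \<and> v \<rightarrow>\<^sup>*\<^bsub>G\<^esub> w"
  using assms
proof (induction rule: span_upto.induct)
  case (add x u' \<alpha> w v' \<beta> c)
  have verts: "u' \<in> verts G" "v' \<in> verts G" "w \<in> verts G" using add awalk_hd_in_verts awalk_last_in_verts by blast+
  show ?case
  proof (cases "u' = u \<and> v' = v")
    case True
    then have "u \<rightarrow>\<^sup>*\<^bsub>G\<^esub> w" "v \<rightarrow>\<^sup>*\<^bsub>G\<^esub> w" using add(2,3) reachable_awalkI by blast+
    then show ?thesis using verts by blast
  next
    case False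
    have "p u * (\<kappa> c * (p u' * S \<alpha> * (T \<beta> * p v'))) * p v = \<kappa> c * ((p u * p u') * S \<alpha> * (T \<beta> * (p v' * p v)))"
      using \<kappa>_p[OF add(6)] by (simp add: mult.assoc[symmetric])
    also have "\<dots> = 0" using False verts add(6,7) p_orth[of u u'] p_orth[of v' v] by auto
    finally have "p u * x * p v \<noteq> 0" using add(8) by (simp add: distrib_left distrib_right)
    then show ?thesis using add by blast
  qed
qed simp

end

section \<open>Graded quotients as algebras of quotient graphs\<close>

context lpa
begin

text \<open>
  The representatives of the vertices of the quotient graph: \<open>vertex_elem H U (Inr v)\<close> is \<open>v\<^sup>H\<close>, and
  \<open>partial_sum H v\<close> is \<open>v - v\<^sup>H\<close>.
\<close>

definition partial_sum :: "'v set \<Rightarrow> 'v \<Rightarrow> ('v,'e,'k::field) free_elem" where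
  "partial_sum H v = (\<Sum>e | e \<in> out_arcs E v \<and> head E e \<notin> H. ed e * gh e)"

definition vertex_elem :: "'v set \<Rightarrow> 'v set \<Rightarrow> 'v + 'v \<Rightarrow> ('v,'e,'k::field) free_elem" where
  "vertex_elem H U x = (case x of
      Inl v \<Rightarrow> if v \<in> breaking_vertices E H - U then partial_sum H v else vx v
    | Inr v \<Rightarrow> vx v - partial_sum H v)"

lemma partial_sum_C: "partial_sum H v \<in> C"
  unfolding partial_sum_def by (intro C_sum C_mult C_gens) auto


lemma partial_sum_homogeneous: "homogeneous 0 (partial_sum H v)"
  unfolding partial_sum_def
  using homogeneous_mult[OF homogeneous_gens(2) homogeneous_gens(3)] by (intro homogeneous_sum) auto

lemma vertex_elem_homogeneous: "homogeneous 0 (vertex_elem H U x)"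
  by (cases x) (auto simp: vertex_elem_def partial_sum_homogeneous homogeneous_gens intro!: homogeneous_diff)

definition pair_lid :: "'v set \<Rightarrow> 'v set \<Rightarrow> ('v,'e,'k::field) free_elem set" where
  "pair_lid H U = generated (vx ` H \<union> (\<lambda>v. vertex_elem H U (Inr v)) ` U)"

lemma pair_gens_C:
  assumes "admissible_pair E H U"
  shows "vx ` H \<union> (\<lambda>v. vertex_elem H U (Inr v)) ` U \<subseteq> C"
proof -
  have "H \<subseteq> verts E" "U \<subseteq> verts E"
    using assms by (auto simp: admissible_pair_def hereditary_def breaking_vertices_def)
  then show ?thesis by (auto simp: vertex_elem_def intro!: C_gens C_diff partial_sum_C)
qed

lemma pair_ideal_eq:
  assumes "admissible_pair E H U"
  shows "pair_ideal E H U = (cls ` pair_lid H U :: ('v,'e,'k::field) lpa_elem set)"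
proof -
  have "(\<lambda>v. cls (vx v :: ('v,'e,'k) free_elem)) ` H \<union> breaking_element E H ` U = cls ` (vx ` H \<union> (\<lambda>v. vertex_elem H U (Inr v)) ` U)"
    by (simp add: image_Un image_image breaking_element_def vertex_elem_def partial_sum_def)
  then show ?thesis
    unfolding pair_ideal_def pair_lid_def using ideal_generated_by_eq[OF pair_gens_C[OF assms]] by simp
qed

lemma pair_lid_graded: "admissible_pair E H U \<Longrightarrow> graded_lid (pair_lid H U)"
  unfolding pair_lid_def
  by (rule generated_graded[OF pair_gens_C]) (auto intro: homogeneous_gens vertex_elem_homogeneous)

lemma pair_lid_lid: "lid (pair_lid H U)"
  unfolding pair_lid_def by (rule generated_lid)

lemma pair_lid_gens:
  assumes "admissible_pair E H U"
  shows "v \<in> H \<Longrightarrow> vx v \<in> pair_lid H U" "v \<in> U \<Longrightarrow> vertex_elem H U (Inr v) \<in> pair_lid H U"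
  using generated_sub[OF pair_gens_C[OF assms]] unfolding pair_lid_def by blast+

end

text \<open>
  Here the quotient by \<open>I\<close> carries a family of the quotient graph. The typical cases are \<open>I = I(H, U)\<close>,
  and a graded ideal \<open>I\<close> that defines \<open>(H, U)\<close> by the vertices and elements \<open>v\<^sup>H\<close> in it.
\<close>

locale quotient_over_pair = lpa_quotient E I \<Phi> + admissible E H U
  for E :: "('v,'e) pre_digraph" and I :: "('v,'e,'k::field) free_elem set"
    and \<Phi> :: "('v,'e,'k) free_elem \<Rightarrow> 'a::ring_1" and H U +
  assumes graded: "graded_lid I"
    and H_I: "v \<in> H \<Longrightarrow> vx v \<in> I" and U_I: "v \<in> U \<Longrightarrow> vertex_elem H U (Inr v) \<in> I"
begin

abbreviation z :: "'v + 'v \<Rightarrow> ('v,'e,'k) free_elem" where "z \<equiv> vertex_elem H U"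

lemma \<Phi>_partial_sum: "\<Phi> (partial_sum H v) = (\<Sum>e\<in>W v. \<Phi> (ed e) * \<Phi> (gh e))"
  unfolding partial_sum_def \<Phi>_sum W_def by (intro sum.cong refl) (auto simp: \<Phi>_C_mult C_gens)

sublocale Q: family_over_quotient E H U scalar "\<lambda>v. \<Phi> (vx v)" "\<lambda>e. \<Phi> (ed e)" "\<lambda>e. \<Phi> (gh e)"
proof
  show "\<Phi> (vx v) = 0" if "v \<in> H" for v
  proof -
    have "v \<in> verts E" using that H_verts by blast
    then show ?thesis using H_I[OF that] \<Phi>_zero_iff[OF C_hull[OF C_gens(1)]] by simp
  qed
  show "\<Phi> (vx v) = (\<Sum>e\<in>W v. \<Phi> (ed e) * \<Phi> (gh e))" if "v \<in> U" for v
  proof -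
    have "z (Inr v) \<in> C" by (rule lid_sub[OF I_lid U_I[OF that]])
    from \<Phi>_zero_iff[OF C_hull[OF this]] have "\<Phi> (z (Inr v)) = 0" using U_I[OF that] by simp
    then show ?thesis by (simp add: vertex_elem_def \<Phi>_diff \<Phi>_partial_sum)
  qed
qed

lemma z_C: "x \<in> verts F \<Longrightarrow> z x \<in> C"
  using B_D by (cases x) (auto simp: vertex_elem_def intro!: C_diff C_gens partial_sum_C)

lemma \<Phi>_z: "\<Phi> (z x) = Q.q x"
  by (cases x) (auto simp: vertex_elem_def \<Phi>_diff \<Phi>_partial_sum Q.\<sigma>_def B_def)

text \<open>
  If \<open>H\<close> and \<open>U\<close> collect everything of their kind in \<open>I\<close>, the vertices of the quotient graph survive. The
  one case that is not immediate is \<open>v - v\<^sup>H\<close>: it fixes each edge \<open>e\<close> from \<open>v\<close> that survives, so if it were in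
  \<open>I\<close>, then so would \<open>e\<close> and \<open>r(e) = e\<^sup>* e\<close>.
\<close>

lemma z_notin_I:
  assumes H_eq: "\<And>v. v \<in> verts E \<Longrightarrow> vx v \<in> I \<Longrightarrow> v \<in> H"
    and U_eq: "\<And>v. v \<in> breaking_vertices E H \<Longrightarrow> z (Inr v) \<in> I \<Longrightarrow> v \<in> U"
    and x: "x \<in> verts F"
  shows "z x \<notin> I"
proof
  assume zx: "z x \<in> I"
  show False
  proof (cases x)
    case (Inr v)
    then show ?thesis using U_eq[of v] zx x by (auto simp: B_def)
  next
    case (Inl v)
    then have v: "v \<in> verts E" "v \<notin> H" using x by auto
    show ?thesis
    proof (cases "v \<in> B")
      case False
      then show ?thesis using H_eq[of v] zx v Inl by (auto simp: vertex_elem_def B_def)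
    next
      case True
      have "\<Phi> (z x) = 0" using zx \<Phi>_zero_iff[OF C_hull[OF z_C[OF x]]] by blast
      then have "Q.\<sigma> v = 0" using \<Phi>_z[of x] Inl True by simp
      have "W v \<noteq> {}" using True W_breaking by (auto simp: B_def)
      then obtain e where "e \<in> W v" by blast
      then have e: "e \<in> arcs E" "tail E e = v" "head E e \<notin> H" using Q.WD by auto
      then have "\<Phi> (ed e) = 0" using Q.\<sigma>_s[OF Q.B_finite[OF True]] \<open>Q.\<sigma> v = 0\<close> by force
      then have "\<Phi> (vx (head E e)) = 0" using fam.ts_same[OF e(1)] by simp
      then have "vx (head E e) \<in> I" using \<Phi>_zero_iff[OF C_hull[OF C_gens(1)], of "head E e"] e(1) by simp
      then show ?thesis using H_eq[of "head E e"] e by simp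
    qed
  qed
qed

end

lemma poly_dvd_pred_power:
  fixes g :: "'k::field poly"
  assumes "g dvd (g - 1) ^ n" shows "g dvd 1"
  using assms
proof (induction n)
  case (Suc n)
  have "(g - 1) ^ n = g * (g - 1) ^ n - (g - 1) ^ Suc n" by (simp add: algebra_simps)
  then have "g dvd (g - 1) ^ n" using Suc.prems by (metis dvd_diff dvd_triv_left)
  then show ?case by (rule Suc.IH)
qed simp

text \<open>\<open>1 + x f\<close> is coprime to \<open>f\<close> and to \<open>x\<close>, and not constant.\<close>

lemma poly_not_dvd_monom:
  fixes f :: "'k::field poly"
  assumes "f \<noteq> 0" shows "\<not> (1 + pCons 0 f) dvd monom 1 N"
proof
  let ?g = "1 + pCons 0 f"
  assume "?g dvd monom 1 N"
  moreover have "monom 1 N dvd (pCons 0 f) ^ N"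
  proof -
    have "pCons 0 f = monom 1 1 * f" by (simp add: monom_Suc one_pCons[symmetric] monom_0)
    then have "(pCons 0 f) ^ N = monom 1 N * f ^ N" by (simp add: power_mult_distrib monom_power)
    then show ?thesis by simp
  qed
  ultimately have "?g dvd (?g - 1) ^ N" by (auto intro: dvd_trans)
  then have "?g dvd 1" by (rule poly_dvd_pred_power)
  then have "degree ?g = 0" by (metis dvd_0_left_iff is_unit_iff_degree one_neq_zero)
  moreover have "degree ?g = Suc (degree f)"
    using assms by (subst degree_add_eq_right) auto
  ultimately show False by simp
qed

text \<open>
  The quotient by \<open>I\<close> is in effect the Leavitt path algebra of the quotient graph: it is graded and
  generated by a family of that graph with non-zero vertices.
\<close>

locale graded_quotient = quotient_over_pair E I \<Phi> H U
  for E :: "('v,'e) pre_digraph" and I :: "('v,'e,'k::field) free_elem set"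
    and \<Phi> :: "('v,'e,'k) free_elem \<Rightarrow> 'a::ring_1" and H U +
  assumes z_nonzero: "x \<in> verts F \<Longrightarrow> z x \<notin> I"
begin

definition X :: "int \<Rightarrow> 'a set" where "X n = \<Phi> ` {x \<in> C. homogeneous n x}"

lemma s'_eq: "x \<in> arcs F \<Longrightarrow> Q.s' x = \<Phi> (ed (base x) * z (head F x))"
  unfolding Q.s'_def
  using \<Phi>_C_mult[OF C_gens(2)[OF arcs_F_base(1)] z_C[OF F.head_in_verts], of x x] by (simp add: \<Phi>_z)

lemma t'_eq: "x \<in> arcs F \<Longrightarrow> Q.t' x = \<Phi> (z (head F x) * gh (base x))"
  unfolding Q.t'_def
  using \<Phi>_C_mult[OF z_C[OF F.head_in_verts] C_gens(3)[OF arcs_F_base(1)], of x x] by (simp add: \<Phi>_z)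

lemma s'_C: "x \<in> arcs F \<Longrightarrow> ed (base x) * z (head F x) \<in> C"
  by (intro C_mult C_gens arcs_F_base z_C F.head_in_verts)

lemma t'_C: "x \<in> arcs F \<Longrightarrow> z (head F x) * gh (base x) \<in> C"
  by (intro C_mult C_gens arcs_F_base z_C F.head_in_verts)

sublocale G: graded_leavitt_family F scalar Q.q Q.s' Q.t' X
proof (intro graded_leavitt_family.intro Q.quotient_family graded_leavitt_family_axioms.intro)
  fix n m :: int and a b :: 'a and d :: 'k
  show "0 \<in> X n" unfolding X_def using C_zero homogeneous_0 by (force intro: image_eqI[of _ _ 0])
  show "a + b \<in> X n" if "a \<in> X n" "b \<in> X n"
    using that unfolding X_def by (auto simp flip: \<Phi>_add intro!: imageI C_add homogeneous_add)
  show "scalar d * a \<in> X n" if a: "a \<in> X n"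
  proof -
    obtain x where x: "x \<in> C" "homogeneous n x" "a = \<Phi> x" using a unfolding X_def by blast
    have "Poly_Mapping.single 0 d * x \<in> C" using C_scale[OF x(1), of d] by (simp add: scale_eq)
    then show ?thesis unfolding X_def x(3) \<Phi>_scalar[OF x(1), symmetric]
      using homogeneous_scale[OF x(2)] by blast
  qed
  show "a * b \<in> X (m + n)" if ab: "a \<in> X m" "b \<in> X n"
  proof -
    obtain x y where x: "x \<in> C" "homogeneous m x" "a = \<Phi> x" and y: "y \<in> C" "homogeneous n y" "b = \<Phi> y"
      using ab unfolding X_def by blast
    show ?thesis unfolding X_def x(3) y(3) \<Phi>_C_mult[OF x(1) y(1), symmetric]
      using C_mult[OF x(1) y(1)] homogeneous_mult[OF x(2) y(2)] by blast
  qed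
  show "Q.q x \<in> X 0" if "x \<in> verts F" for x
    unfolding X_def \<Phi>_z[symmetric] using z_C[OF that] vertex_elem_homogeneous by blast
  show "Q.s' x \<in> X 1" if "x \<in> arcs F" for x
    unfolding X_def s'_eq[OF that] using s'_C[OF that]
      homogeneous_mult[OF homogeneous_gens(2) vertex_elem_homogeneous[of H U "head F x"], of "base x"] by auto
  show "Q.t' x \<in> X (-1)" if "x \<in> arcs F" for x
    unfolding X_def t'_eq[OF that] using t'_C[OF that]
      homogeneous_mult[OF vertex_elem_homogeneous[of H U "head F x"] homogeneous_gens(3), of "base x"] by auto
  show "g n = 0" if N: "finite N" "\<And>n. n \<in> N \<Longrightarrow> g n \<in> X n" "(\<Sum>n\<in>N. g n) = 0" "n \<in> N" for N g and n :: int
  proof -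
    have "\<forall>n\<in>N. \<exists>y. y \<in> C \<and> homogeneous n y \<and> g n = \<Phi> y" using N(2) unfolding X_def by blast
    then obtain y where y: "\<And>n. n \<in> N \<Longrightarrow> y n \<in> C \<and> homogeneous n (y n) \<and> g n = \<Phi> (y n)" by metis
    have "\<Phi> (\<Sum>n\<in>N. y n) = 0" using N(3) y by (simp add: \<Phi>_sum)
    moreover have "(\<Sum>n\<in>N. y n) \<in> C" using y by (intro C_sum) blast
    ultimately have "(\<Sum>n\<in>N. y n) \<in> I" using \<Phi>_zero_iff[OF C_hull] by simp
    then have "component n (\<Sum>n\<in>N. y n) \<in> I" using graded by (auto simp: graded_lid_def)
    moreover have "component n (\<Sum>n\<in>N. y n) = (\<Sum>m\<in>N. if m = n then y m else 0)"
      unfolding component_sum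
    proof (rule sum.cong[OF refl])
      fix m assume "m \<in> N"
      then have "homogeneous m (y m)" using y by blast
      then show "component n (y m) = (if m = n then y m else 0)" by (rule component_homogeneous)
    qed
    ultimately have "y n \<in> I" using N(1,4) by simp
    then show ?thesis using y[OF N(4)] \<Phi>_zero_iff[OF C_hull, of "y n"] by simp
  qed
  show "Q.q x \<noteq> 0" if "x \<in> verts F" for x
    unfolding \<Phi>_z[symmetric] using z_nonzero[OF that] \<Phi>_zero_iff[OF C_hull[OF z_C[OF that]]] by blast
qed

lemma span_max: "G.span_upto n a \<Longrightarrow> G.span_upto m b \<Longrightarrow> \<exists>k. G.span_upto k (a + b)"
  using G.span_add[of "max n m" a b] G.span_mono[of n a "max n m"] G.span_mono[of m b "max n m"] by auto

text \<open>
  Elements whose left multiples stay in the span of the monomials in the family of the quotient graph;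
  the generators of \<open>E\<close> are among them, as they are sums of generators of the quotient graph.
\<close>

definition left_span :: "'a \<Rightarrow> bool" where
  "left_span g \<longleftrightarrow> (\<exists>n. G.span_upto n g) \<and> (\<forall>n a. G.span_upto n a \<longrightarrow> (\<exists>m. G.span_upto m (g * a)))"

lemma left_span_0: "left_span 0"
  unfolding left_span_def using G.span_upto.zero by auto

lemma left_span_add:
  assumes "left_span g" "left_span h" shows "left_span (g + h)"
  unfolding left_span_def
proof (intro conjI allI impI)
  obtain n m where "G.span_upto n g" "G.span_upto m h" using assms unfolding left_span_def by blast
  then show "\<exists>n. G.span_upto n (g + h)" by (rule span_max)
  fix n a assume "G.span_upto n a"
  then obtain k l where "G.span_upto k (g * a)" "G.span_upto l (h * a)" using assms unfolding left_span_def by blast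
  from span_max[OF this] show "\<exists>m. G.span_upto m ((g + h) * a)" by (simp add: distrib_right)
qed

lemma left_span_gens: "x \<in> verts F \<Longrightarrow> left_span (Q.q x)" "e \<in> arcs F \<Longrightarrow> left_span (Q.s' e)"
  "e \<in> arcs F \<Longrightarrow> left_span (Q.t' e)"
  unfolding left_span_def
  using G.span_p G.span_s G.span_t G.span_p_left G.span_s_left G.span_t_left by meson+

lemma generators_left_span:
  assumes "g \<in> generators E" shows "left_span (\<Phi> (monomial g))"
proof -
  consider v where "g = Vertex v" "v \<in> verts E" | e where "g = Edge e" "e \<in> arcs E"
    | e where "g = Ghost e" "e \<in> arcs E" using assms by (auto simp: generators_def)
  then show ?thesis
  proof cases
    case (1 v)
    show ?thesis
    proof (cases "v \<in> H")
      case True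
      then show ?thesis using Q.p_H 1 left_span_0 by simp
    next
      case False
      have "left_span (Q.q (Inl v) + (if v \<in> B then Q.q (Inr v) else 0))"
        using 1 False by (intro left_span_add left_span_gens) (auto intro!: left_span_gens left_span_0 simp del: Q.q.simps)
      then show ?thesis unfolding Q.q_decompose[OF False] 1 .
    qed
  next
    case (2 e)
    show ?thesis
    proof (cases "head E e \<in> H")
      case True
      then show ?thesis using Q.s_H 2 left_span_0 by simp
    next
      case False
      have "Q.s' (Inl e) + (if head E e \<in> B then Q.s' (Inr e) else 0) =
        \<Phi> (ed e) * (Q.q (Inl (head E e)) + (if head E e \<in> B then Q.q (Inr (head E e)) else 0))"
        by (simp add: Q.s'_def distrib_left del: Q.q.simps)
      then have "\<Phi> (ed e) = Q.s' (Inl e) + (if head E e \<in> B then Q.s' (Inr e) else 0)"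
        unfolding Q.q_decompose[OF False] using fam.s_range[OF 2(2)] by simp
      moreover have "left_span (Q.s' (Inl e) + (if head E e \<in> B then Q.s' (Inr e) else 0))"
        using 2 False by (intro left_span_add left_span_gens) (auto intro!: left_span_gens left_span_0)
      ultimately show ?thesis using 2 by simp
    qed
  next
    case (3 e)
    show ?thesis
    proof (cases "head E e \<in> H")
      case True
      then show ?thesis using Q.t_H 3 left_span_0 by simp
    next
      case False
      have "Q.t' (Inl e) + (if head E e \<in> B then Q.t' (Inr e) else 0) =
        (Q.q (Inl (head E e)) + (if head E e \<in> B then Q.q (Inr (head E e)) else 0)) * \<Phi> (gh e)"
        by (simp add: Q.t'_def distrib_right del: Q.q.simps)
      then have "\<Phi> (gh e) = Q.t' (Inl e) + (if head E e \<in> B then Q.t' (Inr e) else 0)"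
        unfolding Q.q_decompose[OF False] using fam.t_source[OF 3(2)] by simp
      moreover have "left_span (Q.t' (Inl e) + (if head E e \<in> B then Q.t' (Inr e) else 0))"
        using 3 False by (intro left_span_add left_span_gens) (auto intro!: left_span_gens left_span_0)
      ultimately show ?thesis using 3 by simp
    qed
  qed
qed

lemma \<Phi>_spanF: "x \<in> C \<Longrightarrow> \<exists>n. G.span_upto n (\<Phi> x)"
proof (induction rule: C_induct)
  case zero
  show ?case using G.span_upto.zero by auto
next
  case (add x y)
  then show ?case using span_max by (auto simp: \<Phi>_add)
next
  case (scale c x)
  then obtain n where "G.span_upto n (\<Phi> x)" by blast
  from G.span_scale[OF this, of c] show ?case using scale(1) by (auto simp: \<Phi>_scalar)
next
  case (gen g)
  then show ?case using generators_left_span by (auto simp: left_span_def)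
next
  case (mult g x)
  have "monomial g \<in> C" using mult(1) by (auto simp: generators_def C_gens)
  then have "\<Phi> (monomial g * x) = \<Phi> (monomial g) * \<Phi> x" using mult(2) by (rule \<Phi>_C_mult)
  then show ?case using generators_left_span[OF mult(1)] mult(3) unfolding left_span_def by metis
qed

definition A :: "'a set" where "A = \<Phi> ` C"

lemma A_add: "a \<in> A \<Longrightarrow> b \<in> A \<Longrightarrow> a + b \<in> A"
  unfolding A_def by (auto simp flip: \<Phi>_add intro!: imageI C_add)

lemma A_mult: "a \<in> A \<Longrightarrow> b \<in> A \<Longrightarrow> a * b \<in> A"
  unfolding A_def by (auto simp flip: \<Phi>_C_mult intro!: imageI C_mult)

lemma A_scale: "a \<in> A \<Longrightarrow> scalar c * a \<in> A"
proof -
  assume "a \<in> A"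
  then obtain x where x: "x \<in> C" "a = \<Phi> x" by (auto simp: A_def)
  have "Poly_Mapping.single 0 c * x \<in> C" using C_scale[OF x(1), of c] by (simp add: scale_eq)
  then show ?thesis unfolding A_def x(2) \<Phi>_scalar[OF x(1), symmetric] by blast
qed

lemma A_zero: "0 \<in> A"
  unfolding A_def using C_zero by (force intro: image_eqI[of _ _ 0])

lemma A_sum: "(\<And>i. i \<in> N \<Longrightarrow> f i \<in> A) \<Longrightarrow> sum f N \<in> A"
  by (induction N rule: infinite_finite_induct) (auto simp: A_zero A_add)

lemma A_gens: "x \<in> verts F \<Longrightarrow> Q.q x \<in> A" "e \<in> arcs F \<Longrightarrow> Q.s' e \<in> A" "e \<in> arcs F \<Longrightarrow> Q.t' e \<in> A"
  unfolding A_def using z_C s'_C t'_C by (auto simp: s'_eq t'_eq simp flip: \<Phi>_z)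

lemma A_gen_closed: "G.gen_closed A"
  unfolding G.gen_closed_def using A_gens A_mult A_scale by blast

lemma A_ev:
  assumes "F.awalk v c v" shows "G.ev v c f \<in> A"
proof -
  have v: "v \<in> verts F" using assms F.awalk_hd_in_verts by blast
  have "Q.q v * G.S c ^ i \<in> A" for i
  proof -
    have "set (concat (replicate i c)) \<subseteq> arcs F" using assms by (auto simp: F.awalk_def split: if_splits)
    then have "Q.q v * G.S (concat (replicate i c)) \<in> A"
      by (rule G.gen_closed_S[OF A_gen_closed A_gens(1)[OF v]])
    then show ?thesis by (simp add: G.S_power)
  qed
  then show ?thesis unfolding G.ev_def by (intro A_sum A_scale)
qed

lemma mem_image_iff:
  assumes "lid J" "I \<subseteq> J" "a \<in> C" shows "\<Phi> a \<in> \<Phi> ` J \<longleftrightarrow> a \<in> J"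
proof
  assume "\<Phi> a \<in> \<Phi> ` J"
  then obtain b where "b \<in> J" "\<Phi> a = \<Phi> b" by blast
  then have "a - b \<in> J" using \<Phi>_eq_iff[OF assms(3) lid_sub[OF assms(1)]] assms(2) by blast
  then show "a \<in> J" using \<open>b \<in> J\<close> lid_cong[OF assms(1)] by blast
qed blast

lemma image_mult:
  assumes "lid J" "j \<in> \<Phi> ` J" "a \<in> A" shows "a * j \<in> \<Phi> ` J" "j * a \<in> \<Phi> ` J"
proof -
  obtain x y where "x \<in> J" "j = \<Phi> x" "y \<in> C" "a = \<Phi> y" using assms by (auto simp: A_def)
  then show "a * j \<in> \<Phi> ` J" "j * a \<in> \<Phi> ` J"
    using lid_mult[OF assms(1), of x y] lid_sub[OF assms(1), of x] by (auto simp flip: \<Phi>_C_mult)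
qed

lemma image_add:
  assumes "lid J" "a \<in> \<Phi> ` J" "b \<in> \<Phi> ` J" shows "a + b \<in> \<Phi> ` J"
  using assms(2,3) lid_add[OF assms(1)] by (auto simp flip: \<Phi>_add)

lemma image_diff:
  assumes "lid J" "a \<in> \<Phi> ` J" "b \<in> \<Phi> ` J" shows "a - b \<in> \<Phi> ` J"
  using assms(2,3) lid_diff[OF assms(1)] by (auto simp flip: \<Phi>_diff)

lemma image_zero: "lid J \<Longrightarrow> 0 \<in> \<Phi> ` J"
  using lid_zero[of J] by (force intro: image_eqI[of _ _ 0])

lemma image_gen_closed:
  assumes "lid J" shows "G.gen_closed (\<Phi> ` J)"
proof -
  have sc: "scalar c * a \<in> \<Phi> ` J" if a: "a \<in> \<Phi> ` J" for c a
  proof -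
    obtain x where x: "x \<in> J" "a = \<Phi> x" using a by blast
    then have "\<Phi> (Poly_Mapping.single 0 c * x) = scalar c * a" using \<Phi>_scalar lid_sub[OF assms] by blast
    moreover have "Poly_Mapping.single 0 c * x \<in> J" using lid_scale[OF assms x(1), of c] by (simp add: scale_eq)
    ultimately show ?thesis by (metis imageI)
  qed
  show ?thesis unfolding G.gen_closed_def by (simp add: sc image_mult[OF assms] A_gens)
qed

lemma image_graded:
  assumes "graded_lid J" "I \<subseteq> J" shows "G.graded_set (\<Phi> ` J)"
  unfolding G.graded_set_def
proof (intro allI impI ballI)
  fix N g n assume N: "finite N" "\<forall>n\<in>N. g n \<in> X n" "(\<Sum>n\<in>N. g n) \<in> \<Phi> ` J" "n \<in> N"
  have J: "lid J" using assms(1) by (simp add: graded_lid_def)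
  have "\<forall>n\<in>N. \<exists>y. y \<in> C \<and> homogeneous n y \<and> g n = \<Phi> y" using N(2) unfolding X_def by blast
  then obtain y where y: "\<And>n. n \<in> N \<Longrightarrow> y n \<in> C \<and> homogeneous n (y n) \<and> g n = \<Phi> (y n)" by metis
  have "\<Phi> (\<Sum>n\<in>N. y n) \<in> \<Phi> ` J" using N(3) y by (simp add: \<Phi>_sum)
  moreover have "(\<Sum>n\<in>N. y n) \<in> C" using y by (intro C_sum) blast
  ultimately have "(\<Sum>n\<in>N. y n) \<in> J" using mem_image_iff[OF J assms(2)] by blast
  then have "component n (\<Sum>n\<in>N. y n) \<in> J" using assms(1) by (auto simp: graded_lid_def)
  moreover have "component n (\<Sum>n\<in>N. y n) = (\<Sum>m\<in>N. if m = n then y m else 0)"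
    unfolding component_sum
  proof (rule sum.cong[OF refl])
    fix m assume "m \<in> N"
    then have "homogeneous m (y m)" using y by blast
    then show "component n (y m) = (if m = n then y m else 0)" by (rule component_homogeneous)
  qed
  ultimately have "y n \<in> J" using N(1,4) by simp
  then show "g n \<in> \<Phi> ` J" using y[OF N(4)] by blast
qed

lemma z_mem_iff: "lid J \<Longrightarrow> I \<subseteq> J \<Longrightarrow> x \<in> verts F \<Longrightarrow> Q.q x \<in> \<Phi> ` J \<longleftrightarrow> z x \<in> J"
  using mem_image_iff[OF _ _ z_C] by (simp add: \<Phi>_z)

text \<open>
  The form in which the reduction theorem is used: an ideal above \<open>I\<close> contains a vertex of the quotient
  graph or a polynomial in a cycle without exits.
\<close>

lemma image_reduction:
  assumes "lid J" "I \<subset> J" shows "G.vertex_or_cycle (\<Phi> ` J)"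
proof -
  obtain a where a: "a \<in> J" "a \<notin> I" using assms(2) by blast
  then have "a \<in> C" using lid_sub[OF assms(1)] by blast
  obtain n where "G.span_upto n (\<Phi> a)" using \<Phi>_spanF[OF \<open>a \<in> C\<close>] by blast
  moreover have "\<Phi> a \<noteq> 0" using a \<Phi>_zero_iff[OF C_hull[OF \<open>a \<in> C\<close>]] by blast
  ultimately show ?thesis using G.reduction[OF image_gen_closed[OF assms(1)]] a(1) by blast
qed

lemma vertices_of_lid:
  assumes "lid J" "I \<subseteq> J"
  shows "hereditary F {x \<in> verts F. z x \<in> J}" "saturated F {x \<in> verts F. z x \<in> J}"
proof -
  have "{x \<in> verts F. z x \<in> J} = {x \<in> verts F. Q.q x \<in> \<Phi> ` J}"
    using z_mem_iff[OF assms] by blast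
  then show "hereditary F {x \<in> verts F. z x \<in> J}" "saturated F {x \<in> verts F. z x \<in> J}"
    using G.vertices_of_ideal[OF image_gen_closed image_add image_zero, OF assms(1) assms(1) _ _ assms(1)] by simp_all
qed

text \<open>
  A prime is determined by its corner at any vertex outside it, so an element outside \<open>P\<close> can be moved
  into that corner.
\<close>

lemma prime_corner:
  assumes P: "lprime P" "I \<subseteq> P" and v: "v \<in> verts F" "z v \<notin> P" and b: "b \<in> C" "b \<notin> P"
  obtains x y where "x \<in> C" "y \<in> C" "z v * (x * b * y) * z v \<in> C" "z v * (x * b * y) * z v \<notin> P"
    "\<Phi> (z v * (x * b * y) * z v) = Q.q v * \<Phi> (x * b * y) * Q.q v"
proof -
  note zC = z_C[OF v(1)]
  obtain x where x: "x \<in> C" "z v * x * b \<notin> P" using lprime_element[OF P(1) zC v(2) b] .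
  have "z v * x * b \<in> C" using zC x b C_mult by blast
  from lprime_element[OF P(1) this x(2) zC v(2)]
  obtain y where y: "y \<in> C" "z v * x * b * y * z v \<notin> P" .
  have xby: "x * b * y \<in> C" using x y b C_mult by blast
  show ?thesis
  proof (rule that[OF x(1) y(1)])
    show "z v * (x * b * y) * z v \<in> C" using zC xby C_mult by blast
    show "z v * (x * b * y) * z v \<notin> P" using y(2) by (simp add: mult.assoc)
    show "\<Phi> (z v * (x * b * y) * z v) = Q.q v * \<Phi> (x * b * y) * Q.q v"
      using zC xby C_mult[OF zC xby] by (simp add: \<Phi>_C_mult \<Phi>_z del: Q.q.simps)
  qed
qed

end

section \<open>Completely irreducible and locally closed primes\<close>

context graded_quotient
begin

lemma image_ev_shift:
  assumes J: "lid J" and c: "exitless_cycle F scalar Q.q Q.s' Q.t' v c"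
    and "G.ev v c f * G.T c ^ N \<in> \<Phi> ` J"
  shows "G.ev v c f \<in> \<Phi> ` J"
proof -
  interpret exitless_cycle F scalar Q.q Q.s' Q.t' v c by (rule c)
  have "set (concat (replicate N c)) \<subseteq> arcs F" using c_arcs by (auto split: if_splits)
  from G.gen_closed_S[OF image_gen_closed[OF J] assms(3) this]
  show ?thesis by (simp add: G.S_power unshift)
qed

text \<open>
  Modulo the non-graded prime \<open>P\<close>, the corner at the cycle is the quotient of a Laurent polynomial
  ring by a non-zero prime ideal, a field. Every ideal that properly contains \<open>P\<close> has an element
  outside \<open>P\<close> in this corner, hence contains the vertex.
\<close>

lemma nongraded_prime_completely_irreducible:
  assumes P: "lprime P" and I: "I = gr P" "I \<noteq> P"
  shows "\<exists>a\<in>C. a \<notin> P \<and> (\<forall>J. lid J \<and> P \<subset> J \<longrightarrow> a \<in> J)"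
proof -
  note lP = lprimeD_lid[OF P]
  have IP: "I \<subset> P" using I gr_sub[OF lP] by blast
  have z_P: "z x \<notin> P" if "x \<in> verts F" for x
    using homogeneous_in_gr[OF lP vertex_elem_homogeneous] z_nonzero[OF that] I(1) by blast
  have "\<not> (\<exists>x\<in>verts F. Q.q x \<in> \<Phi> ` P)" using z_P z_mem_iff[OF lP] IP by blast
  then obtain v c f0 where c: "F.awalk v c v" "F.cycle c" "\<not> has_exit F c" and f0: "f0 \<noteq> 0" "G.ev v c f0 \<in> \<Phi> ` P"
    using image_reduction[OF lP IP] unfolding G.vertex_or_cycle_def by blast
  have cyc: "exitless_cycle F scalar Q.q Q.s' Q.t' v c" by unfold_locales (use c in auto)
  interpret cyc: exitless_cycle F scalar Q.q Q.s' Q.t' v c by (rule cyc)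
  have v: "v \<in> verts F" using c(1) F.awalk_hd_in_verts by blast
  \<comment> \<open>a generator of the ideal of polynomials that vanish modulo \<open>P\<close> at the cycle; it is irreducible\<close>
  obtain p0 where p0: "p0 \<noteq> 0" "G.ev v c p0 \<in> \<Phi> ` P"
    and min: "\<And>f. f \<noteq> 0 \<Longrightarrow> G.ev v c f \<in> \<Phi> ` P \<Longrightarrow> degree p0 \<le> degree f"
    using ex_has_least_nat[of "\<lambda>f. f \<noteq> 0 \<and> G.ev v c f \<in> \<Phi> ` P" f0 degree] f0 by blast
  have prime: "G.ev v c f \<in> \<Phi> ` P \<or> G.ev v c g \<in> \<Phi> ` P" if fg: "G.ev v c (f * g) \<in> \<Phi> ` P" for f g
  proof (rule ccontr)
    assume n: "\<not> (G.ev v c f \<in> \<Phi> ` P \<or> G.ev v c g \<in> \<Phi> ` P)"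
    obtain f' g' where f': "f' \<in> C" "G.ev v c f = \<Phi> f'" and g': "g' \<in> C" "G.ev v c g = \<Phi> g'"
      using A_ev[OF c(1)] unfolding A_def by blast
    have "f' \<notin> P" "g' \<notin> P" using n f' g' by auto
    then obtain x where x: "x \<in> C" "f' * x * g' \<notin> P" using lprime_element[OF P f'(1) _ g'(1)] by blast
    obtain n where "G.span_upto n (\<Phi> x)" using \<Phi>_spanF[OF x(1)] by blast
    then obtain h N where h: "Q.q v * \<Phi> x * Q.q v = G.ev v c h * G.T c ^ N" by (rule cyc.corner_Laurent)
    have "\<Phi> (f' * x * g') = G.ev v c f * \<Phi> x * G.ev v c g"
      using f' g' x(1) C_mult[OF f'(1) x(1)] by (simp add: \<Phi>_C_mult)
    also have "\<dots> = (G.ev v c f * Q.q v) * \<Phi> x * (Q.q v * G.ev v c g)" by (simp only: cyc.ev_p cyc.p_ev)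
    also have "\<dots> = G.ev v c f * (Q.q v * \<Phi> x * Q.q v) * G.ev v c g" by (simp only: mult.assoc)
    also have "\<dots> = G.ev v c f * G.ev v c h * (G.T c ^ N * G.ev v c g)" unfolding h by (simp only: mult.assoc)
    also have "\<dots> = G.ev v c f * (G.ev v c h * G.ev v c g) * G.T c ^ N" unfolding cyc.ev_ypow by (simp only: mult.assoc)
    also have "G.ev v c h * G.ev v c g = G.ev v c g * G.ev v c h" by (rule cyc.ev_commute)
    also have "G.ev v c f * (G.ev v c g * G.ev v c h) * G.T c ^ N = G.ev v c (f * g) * (G.ev v c h * G.T c ^ N)"
      by (simp only: cyc.ev_mult mult.assoc)
    also have "\<dots> = G.ev v c (f * g) * (Q.q v * \<Phi> x * Q.q v)" by (simp only: h)
    also have "\<dots> \<in> \<Phi> ` P"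
      using x(1) by (intro image_mult[OF lP fg] A_mult A_gens v) (auto simp: A_def)
    finally have m: "\<Phi> (f' * x * g') \<in> \<Phi> ` P" .
    have "f' * x * g' \<in> C" using x(1) f'(1) g'(1) C_mult by blast
    from mem_image_iff[OF lP psubset_imp_subset[OF IP] this] show False using m x(2) by simp
  qed
  have "z v \<in> J" if J: "lid J" "P \<subset> J" for J
  proof -
    have IJ: "I \<subseteq> J" using IP J by blast
    obtain b where b: "b \<in> J" "b \<notin> P" using J by blast
    have "b \<in> C" using lid_sub[OF J(1) b(1)] .
    obtain x y where xy: "x \<in> C" "y \<in> C" "z v * (x * b * y) * z v \<in> C" "z v * (x * b * y) * z v \<notin> P"
      "\<Phi> (z v * (x * b * y) * z v) = Q.q v * \<Phi> (x * b * y) * Q.q v"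
      using prime_corner[OF P psubset_imp_subset[OF IP] v z_P[OF v] \<open>b \<in> C\<close> b(2)] .
    have "x * b * y \<in> J" by (rule lid_mult(2)[OF J(1) lid_mult(1)[OF J(1) b(1) xy(1)] xy(2)])
    then have "z v * (x * b * y) * z v \<in> J"
      by (rule lid_mult(2)[OF J(1) lid_mult(1)[OF J(1) _ z_C[OF v]] z_C[OF v]])
    then have mJ: "Q.q v * \<Phi> (x * b * y) * Q.q v \<in> \<Phi> ` J" using xy(5) by (metis imageI)
    have "x * b * y \<in> C" using xy \<open>b \<in> C\<close> C_mult by blast
    then obtain n where "G.span_upto n (\<Phi> (x * b * y))" using \<Phi>_spanF by blast
    then obtain f N where f: "Q.q v * \<Phi> (x * b * y) * Q.q v = G.ev v c f * G.T c ^ N" by (rule cyc.corner_Laurent)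
    have fJ: "G.ev v c f \<in> \<Phi> ` J" using image_ev_shift[OF J(1) cyc] mJ f by simp
    have fP: "G.ev v c f \<notin> \<Phi> ` P"
    proof
      assume *: "G.ev v c f \<in> \<Phi> ` P"
      have arcs: "set (concat (replicate N c)) \<subseteq> arcs F" using cyc.c_arcs by (auto split: if_splits)
      have "G.T (concat (replicate N c)) * G.ev v c f \<in> \<Phi> ` P"
        by (rule G.gen_closed_T[OF image_gen_closed[OF lP] * arcs])
      then have "\<Phi> (z v * (x * b * y) * z v) \<in> \<Phi> ` P" using f xy(5) by (simp add: G.T_power cyc.ev_ypow)
      then show False using mem_image_iff[OF lP _ xy(3)] xy(4) IP by blast
    qed
    have "f \<noteq> 0" using fP image_zero[OF lP] by auto
    \<comment> \<open>a generator of the corresponding, strictly larger ideal for \<open>J\<close>; as \<open>d\<close> divides \<open>p0\<close>, it is constant\<close>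
    obtain d where d: "d \<noteq> 0" "G.ev v c d \<in> \<Phi> ` J"
      and dmin: "\<And>g. g \<noteq> 0 \<Longrightarrow> G.ev v c g \<in> \<Phi> ` J \<Longrightarrow> degree d \<le> degree g"
      using ex_has_least_nat[of "\<lambda>f. f \<noteq> 0 \<and> G.ev v c f \<in> \<Phi> ` J" f degree] \<open>f \<noteq> 0\<close> fJ by blast
    have dvd: "d dvd g" if g: "G.ev v c g \<in> \<Phi> ` J" for g
    proof -
      have "G.ev v c (d * (g div d)) \<in> \<Phi> ` J"
        unfolding cyc.ev_mult by (rule image_mult[OF J(1) d(2) A_ev[OF c(1)]])
      then have "G.ev v c g - G.ev v c (d * (g div d)) \<in> \<Phi> ` J" using image_diff[OF J(1) g] by blast
      moreover have "G.ev v c g = G.ev v c (g mod d) + G.ev v c (d * (g div d))"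
        by (simp flip: G.ev_add)
      ultimately have "G.ev v c (g mod d) \<in> \<Phi> ` J" by simp
      then have "g mod d = 0" using dmin[of "g mod d"] degree_mod_less'[OF d(1), of g] by fastforce
      then show ?thesis by auto
    qed
    have "d dvd p0" using dvd p0(2) J(2) by blast
    then obtain h where h: "p0 = d * h" by (rule dvdE)
    have "d dvd f" using dvd fJ by blast
    then obtain f' where f': "f = d * f'" by (rule dvdE)
    have "G.ev v c d \<notin> \<Phi> ` P"
      using fP image_mult(2)[OF lP _ A_ev[OF c(1)]] unfolding f' cyc.ev_mult by blast
    then have hP: "G.ev v c h \<in> \<Phi> ` P" using prime[of d h] p0(2) h by simp
    have "h \<noteq> 0" using p0(1) h by auto
    then have "degree p0 \<le> degree h" using min hP by blast
    then have "degree d = 0" using h d(1) \<open>h \<noteq> 0\<close> by (simp add: degree_mult_eq)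
    then obtain k where k: "d = [:k:]" by (rule degree_eq_zeroE)
    then have "scalar k * Q.q v \<in> \<Phi> ` J" using d(2) by (simp add: G.ev_const)
    then have "Q.q v \<in> \<Phi> ` J" using G.gen_closed_unscale[OF image_gen_closed[OF J(1)]] k d(1) v by auto
    then show ?thesis using z_mem_iff[OF J(1) IJ v] by simp
  qed
  then show ?thesis using z_P[OF v] z_C[OF v] by blast
qed

text \<open>
  By Condition (L) each larger ideal contains a vertex, so the vertices in it form a non-empty hereditary
  saturated set; the strong CSP provides a vertex that all of these sets have in common.
\<close>

lemma graded_completely_irreducible:
  assumes ne: "verts F \<noteq> {}" and L: "condition_L F" and CSP: "strong_CSP F"
  shows "\<exists>a\<in>C. a \<notin> I \<and> (\<forall>J. lid J \<and> I \<subset> J \<longrightarrow> a \<in> J)"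
proof -
  obtain D where D: "D \<subseteq> verts F" "\<forall>u\<in>verts F. \<exists>v\<in>D. u \<rightarrow>\<^sup>*\<^bsub>F\<^esub> v"
    "\<forall>Y. Y \<noteq> {} \<longrightarrow> hereditary F Y \<longrightarrow> saturated F Y \<longrightarrow> D \<subseteq> Y"
    using CSP unfolding strong_CSP_def by blast
  then obtain x where x: "x \<in> D" using ne by blast
  have "z x \<in> J" if J: "lid J" "I \<subset> J" for J
  proof -
    have "I \<subseteq> J" using J by blast
    obtain w where "w \<in> verts F" "Q.q w \<in> \<Phi> ` J"
      using image_reduction[OF J] L unfolding G.vertex_or_cycle_def condition_L_def by blast
    then have "{x \<in> verts F. z x \<in> J} \<noteq> {}" using z_mem_iff[OF J(1) \<open>I \<subseteq> J\<close>] by blast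
    from D(3)[rule_format, OF this vertices_of_lid[OF J(1) \<open>I \<subseteq> J\<close>]] show ?thesis using x by blast
  qed
  then show ?thesis using x D(1) z_nonzero z_C by blast
qed

text \<open>
  For vertices \<open>u\<close> and \<open>v\<close> primeness yields \<open>u x v\<close> outside the ideal, hence a monomial that joins \<open>u\<close> and \<open>v\<close>.
\<close>

lemma prime_downward_directed:
  assumes "lprime I" shows "downward_directed F"
proof -
  have "verts F \<noteq> {}"
  proof
    assume empty: "verts F = {}"
    obtain b where b: "b \<in> C" "b \<notin> I" using assms lid_sub[OF I_lid] by (auto simp: lprime_def)
    obtain n where "G.span_upto n (\<Phi> b)" using \<Phi>_spanF[OF b(1)] by blast
    then obtain V where "V \<subseteq> verts F" "\<Phi> b * (\<Sum>v\<in>V. Q.q v) = \<Phi> b" by (rule G.span_local_unit)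
    then have "\<Phi> b = 0" using empty by simp
    then show False using b \<Phi>_zero_iff[OF C_hull[OF b(1)]] by simp
  qed
  moreover have "\<exists>w\<in>verts F. u \<rightarrow>\<^sup>*\<^bsub>F\<^esub> w \<and> v \<rightarrow>\<^sup>*\<^bsub>F\<^esub> w" if uv: "u \<in> verts F" "v \<in> verts F" for u v
  proof -
    obtain x where x: "x \<in> C" "z u * x * z v \<notin> I"
      using lprime_element[OF assms z_C[OF uv(1)] z_nonzero[OF uv(1)] z_C[OF uv(2)] z_nonzero[OF uv(2)]] .
    have C: "z u * x \<in> C" "z u * x * z v \<in> C" using x(1) z_C uv C_mult by blast+
    have "\<Phi> (z u * x * z v) = Q.q u * \<Phi> x * Q.q v"
      using x(1) z_C uv C by (simp add: \<Phi>_C_mult \<Phi>_z del: Q.q.simps)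
    then have nz: "Q.q u * \<Phi> x * Q.q v \<noteq> 0" using x(2) \<Phi>_zero_iff[OF C_hull[OF C(2)]] by simp
    obtain n where "G.span_upto n (\<Phi> x)" using \<Phi>_spanF[OF x(1)] by blast
    then show ?thesis using G.span_connects[OF _ uv nz] by blast
  qed
  ultimately show ?thesis by (auto simp: downward_directed_def downward_directed_set_def)
qed

text \<open>
  At a cycle without exits, an element of all larger primes would yield a non-zero Laurent polynomial
  \<open>f\<close> in all of them. Some ideal contains \<open>1 + x f\<close> but not the vertex; a prime above it that avoids the
  vertex cannot contain \<open>f\<close>.
\<close>

lemma locally_closed_condition_L:
  assumes P: "lprime I" and a: "a \<in> C" "a \<notin> I" and all: "\<And>Q. lprime Q \<Longrightarrow> I \<subset> Q \<Longrightarrow> a \<in> Q"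
  shows "condition_L F"
  unfolding condition_L_def
proof (intro allI impI, rule ccontr)
  fix c assume c: "F.cycle c" "\<not> has_exit F c"
  then obtain v where walk: "F.awalk v c v" by (auto simp: F.cycle_def)
  have cyc: "exitless_cycle F scalar Q.q Q.s' Q.t' v c" by unfold_locales (use c walk in auto)
  interpret cyc: exitless_cycle F scalar Q.q Q.s' Q.t' v c by (rule cyc)
  have v: "v \<in> verts F" using walk F.awalk_hd_in_verts by blast
  note zC = z_C[OF v]
  obtain x y where xy: "x \<in> C" "y \<in> C" "z v * (x * a * y) * z v \<in> C" "z v * (x * a * y) * z v \<notin> I"
    "\<Phi> (z v * (x * a * y) * z v) = Q.q v * \<Phi> (x * a * y) * Q.q v"
    using prime_corner[OF P order_refl v z_nonzero[OF v] a] .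
  have xay: "x * a * y \<in> C" using xy a C_mult by blast
  then obtain n where "G.span_upto n (\<Phi> (x * a * y))" using \<Phi>_spanF by blast
  then obtain f N where f: "Q.q v * \<Phi> (x * a * y) * Q.q v = G.ev v c f * G.T c ^ N" by (rule cyc.corner_Laurent)
  have "\<Phi> (z v * (x * a * y) * z v) \<noteq> 0" using xy \<Phi>_zero_iff[OF C_hull[OF xy(3)]] by simp
  then have "f \<noteq> 0" using f xy(5) by auto
  define g where "g = 1 + pCons 0 f"
  have g_ndvd: "\<not> g dvd monom 1 M" for M unfolding g_def by (rule poly_not_dvd_monom[OF \<open>f \<noteq> 0\<close>])
  have "coeff g 0 = 1" by (simp add: g_def)
  then have "g \<noteq> 0" by auto
  define cor where "cor u = Q.q v * u * Q.q v" for u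
  have cor_span: "\<exists>h M. cor (\<Phi> u) = G.ev v c h * G.T c ^ M" if "u \<in> C" for u
    unfolding cor_def using \<Phi>_spanF[OF that] cyc.corner_Laurent by metis
  have cor_commute: "cor (\<Phi> u) * G.ev v c h = G.ev v c h * cor (\<Phi> u)" if u: "u \<in> C" for u h
  proof -
    obtain k M where k: "cor (\<Phi> u) = G.ev v c k * G.T c ^ M" using cor_span[OF u] by blast
    have "cor (\<Phi> u) * G.ev v c h = G.ev v c k * (G.T c ^ M * G.ev v c h)" unfolding k by (simp only: mult.assoc)
    also have "\<dots> = (G.ev v c k * G.ev v c h) * G.T c ^ M" unfolding cyc.ev_ypow by (simp only: mult.assoc)
    also have "\<dots> = (G.ev v c h * G.ev v c k) * G.T c ^ M" using cyc.ev_commute by simp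
    finally show ?thesis unfolding k by (simp only: mult.assoc)
  qed
  define D where "D = {G.ev v c g * cor (\<Phi> u) | u. u \<in> C}"
  \<comment> \<open>the largest ideal whose corner lies in \<open>D\<close>, the principal ideal of \<open>1 + x f\<close> in the corner at \<open>v\<close>\<close>
  define J where "J = {b \<in> C. \<forall>x\<in>C. \<forall>y\<in>C. cor (\<Phi> (x * b * y)) \<in> D}"
  have D0: "0 \<in> D" unfolding D_def using C_zero by (force simp: cor_def)
  have D_diff: "a - b \<in> D" if ab: "a \<in> D" "b \<in> D" for a b
  proof -
    obtain u w where uw: "u \<in> C" "a = G.ev v c g * cor (\<Phi> u)" "w \<in> C" "b = G.ev v c g * cor (\<Phi> w)"
      using ab unfolding D_def by blast
    have "a - b = G.ev v c g * cor (\<Phi> (u - w))"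
      by (simp add: uw \<Phi>_diff cor_def left_diff_distrib right_diff_distrib)
    then show ?thesis unfolding D_def using C_diff uw by blast
  qed
  have IJ: "b \<in> J" if b: "b \<in> I" for b
  proof -
    have "\<Phi> (x * b * y) = 0" if "x \<in> C" "y \<in> C" for x y
    proof -
      have "x * b * y \<in> I" by (rule lid_mult(2)[OF I_lid lid_mult(1)[OF I_lid b that(1)] that(2)])
      then show ?thesis using \<Phi>_zero_iff[OF C_hull[OF lid_sub[OF I_lid]]] by blast
    qed
    then show ?thesis using D0 lid_sub[OF I_lid b] by (simp add: J_def cor_def)
  qed
  have J: "lid J"
    unfolding lid_def
  proof (intro conjI ballI)
    show "R \<subseteq> J" using IJ lid_R[OF I_lid] by blast
    show "J \<subseteq> C" by (auto simp: J_def)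
    show "b - b' \<in> J" if b: "b \<in> J" "b' \<in> J" for b b'
    proof -
      have "cor (\<Phi> (x * (b - b') * y)) = cor (\<Phi> (x * b * y)) - cor (\<Phi> (x * b' * y))" for x y
        by (simp add: \<Phi>_diff cor_def left_diff_distrib right_diff_distrib)
      then show ?thesis using b D_diff C_diff by (auto simp: J_def)
    qed
    fix b w :: "('v,'e,'k) free_elem" assume b: "b \<in> J" and w: "w \<in> C"
    have "cor (\<Phi> (x * (w * b) * y)) \<in> D" if "x \<in> C" "y \<in> C" for x y
    proof -
      have "cor (\<Phi> ((x * w) * b * y)) \<in> D" using b C_mult[OF that(1) w] that(2) unfolding J_def by blast
      then show ?thesis by (simp add: mult.assoc)
    qed
    then show "w * b \<in> J" using b w by (simp add: J_def C_mult)
    have "cor (\<Phi> (x * (b * w) * y)) \<in> D" if "x \<in> C" "y \<in> C" for x y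
    proof -
      have "cor (\<Phi> (x * b * (w * y))) \<in> D" using b C_mult[OF w that(2)] that(1) unfolding J_def by blast
      then show ?thesis by (simp add: mult.assoc)
    qed
    then show "b * w \<in> J" using b w by (simp add: J_def C_mult)
  qed
  obtain g' where g': "g' \<in> C" "G.ev v c g = \<Phi> g'" using A_ev[OF walk, of g] unfolding A_def by blast
  have "g' \<in> J"
    unfolding J_def
  proof (intro CollectI conjI ballI g'(1))
    fix x y :: "('v,'e,'k) free_elem" assume xy: "x \<in> C" "y \<in> C"
    have xg: "x * g' \<in> C" and zy: "z v * y \<in> C" and xzy: "x * (z v * y) \<in> C"
      using xy g' zC C_mult by blast+
    have "cor (\<Phi> (x * g' * y)) = Q.q v * \<Phi> x * (Q.q v * G.ev v c g * Q.q v) * \<Phi> y * Q.q v"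
    proof -
      have "\<Phi> (x * g' * y) = \<Phi> x * G.ev v c g * \<Phi> y" using xy g' xg by (simp add: \<Phi>_C_mult)
      moreover have "Q.q v * G.ev v c g * Q.q v = G.ev v c g" by (simp only: cyc.p_ev cyc.ev_p)
      ultimately show ?thesis by (simp only: cor_def mult.assoc)
    qed
    also have "\<dots> = (cor (\<Phi> x) * G.ev v c g) * (Q.q v * \<Phi> y * Q.q v)"
      by (simp only: cor_def mult.assoc)
    also have "\<dots> = G.ev v c g * (cor (\<Phi> x) * (Q.q v * \<Phi> y * Q.q v))"
      unfolding cor_commute[OF xy(1)] by (simp only: mult.assoc)
    also have "cor (\<Phi> x) * (Q.q v * \<Phi> y * Q.q v) = cor (\<Phi> (x * (z v * y)))"
    proof -
      have "cor (\<Phi> x) * (Q.q v * \<Phi> y * Q.q v) = Q.q v * \<Phi> x * (Q.q v * Q.q v) * \<Phi> y * Q.q v"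
        by (simp only: cor_def mult.assoc)
      then show ?thesis using xy zC zy G.p_idem[OF v] by (simp add: cor_def \<Phi>_C_mult \<Phi>_z mult.assoc del: Q.q.simps)
    qed
    finally show "cor (\<Phi> (x * g' * y)) \<in> D" unfolding D_def using xzy by blast
  qed
  have "z v \<notin> J"
  proof
    assume "z v \<in> J"
    then have "cor (\<Phi> (z v * z v * z v)) \<in> D" using zC unfolding J_def by blast
    moreover have "cor (\<Phi> (z v * z v * z v)) = Q.q v"
      using zC C_mult[OF zC zC] G.p_idem[OF v] by (simp add: cor_def \<Phi>_C_mult \<Phi>_z del: Q.q.simps)
    ultimately obtain u where u: "u \<in> C" "Q.q v = G.ev v c g * cor (\<Phi> u)" unfolding D_def by auto
    obtain h M where h: "cor (\<Phi> u) = G.ev v c h * G.T c ^ M" using cor_span[OF u(1)] by blast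
    have "Q.q v * G.S c ^ M = G.ev v c g * (G.ev v c h * G.T c ^ M * G.S c ^ M)"
      using u(2) h by (simp only: mult.assoc)
    also have "\<dots> = G.ev v c (g * h)" by (simp only: cyc.unshift cyc.ev_mult)
    finally have "G.ev v c (monom 1 M - g * h) = 0"
      using G.ev_add[of v c "monom 1 M - g * h" "g * h"] by (simp add: cyc.ev_monom1)
    from G.ev_injective[OF walk c this] have "monom 1 M = g * h" by simp
    then show False using g_ndvd dvd_triv_left by metis
  qed
  have zz: "z v * z v - z v \<in> J"
  proof (rule IJ)
    have "\<Phi> (z v * z v) = \<Phi> (z v)" using zC G.p_idem[OF v] by (simp add: \<Phi>_C_mult \<Phi>_z del: Q.q.simps)
    then show "z v * z v - z v \<in> I" using \<Phi>_eq_iff zC C_mult by blast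
  qed
  obtain Q where Q: "lprime Q" "J \<subseteq> Q" "z v \<notin> Q"
    using prime_avoiding_idempotent[OF J zC \<open>z v \<notin> J\<close> zz] .
  note lQ = lprimeD_lid[OF Q(1)]
  have "g' \<notin> I"
  proof
    assume "g' \<in> I"
    then have "G.ev v c g = 0" using g' \<Phi>_zero_iff[OF C_hull[OF g'(1)]] by simp
    then show False using G.ev_injective[OF walk c] \<open>g \<noteq> 0\<close> by blast
  qed
  have IQ: "I \<subseteq> Q" "I \<subset> Q" using IJ Q(2) \<open>g' \<in> J\<close> \<open>g' \<notin> I\<close> by blast+
  have "a \<in> Q" using all[OF Q(1) IQ(2)] .
  have "x * a * y \<in> Q" by (rule lid_mult(2)[OF lQ lid_mult(1)[OF lQ \<open>a \<in> Q\<close> xy(1)] xy(2)])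
  then have "z v * (x * a * y) * z v \<in> Q"
    by (rule lid_mult(2)[OF lQ lid_mult(1)[OF lQ _ zC] zC])
  then have "G.ev v c f * G.T c ^ N \<in> \<Phi> ` Q" using xy(5) f by (metis imageI)
  then have "G.ev v c f \<in> \<Phi> ` Q" by (rule image_ev_shift[OF lQ cyc])
  then have "G.ev v c (monom 1 1) * G.ev v c f \<in> \<Phi> ` Q" by (rule image_mult[OF lQ _ A_ev[OF walk]])
  then have "G.ev v c (pCons 0 f) \<in> \<Phi> ` Q"
    by (simp add: cyc.ev_x cyc.ev_monom1 cyc.p_x)
  moreover have "G.ev v c g \<in> \<Phi> ` Q" using g' \<open>g' \<in> J\<close> Q(2) by blast
  ultimately have "G.ev v c g - G.ev v c (pCons 0 f) \<in> \<Phi> ` Q" using image_diff[OF lQ] by blast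
  then have "Q.q v \<in> \<Phi> ` Q" by (simp add: g_def G.ev_add cyc.ev_1 del: Q.q.simps)
  then show False using z_mem_iff[OF lQ IQ(1) v] Q(3) by simp
qed

end

section \<open>Graded ideals and admissible pairs\<close>

context lpa
begin

lemma vertex_elem_C:
  assumes "admissible_pair E H U" "x \<in> verts (quotient_graph E H U)"
  shows "vertex_elem H U x \<in> C"
proof -
  interpret admissible E H U by unfold_locales (rule assms(1))
  show ?thesis using assms(2) B_D unfolding F_def[symmetric]
    by (cases x) (auto simp: vertex_elem_def intro!: C_diff C_gens partial_sum_C)
qed

text \<open>
  Pulling the representation on branching systems of the quotient graph back to \<open>E\<close>: its kernel
  lies over \<open>I(H, U)\<close> and contains exactly the vertices of the quotient graph in \<open>Y\<close>.
\<close>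

lemma ideal_with_vertices:
  assumes adm: "admissible_pair E H U"
    and Y: "hereditary (quotient_graph E H U) Y" "saturated (quotient_graph E H U) Y"
  obtains J :: "('v,'e,'k::field) free_elem set" where "lid J" "pair_lid H U \<subseteq> J"
    "\<And>x. x \<in> verts (quotient_graph E H U) \<Longrightarrow> vertex_elem H U x \<in> J \<longleftrightarrow> x \<in> Y"
proof -
  interpret admissible E H U by unfold_locales (rule adm)
  have her: "\<And>e. e \<in> arcs F \<Longrightarrow> tail F e \<in> Y \<Longrightarrow> head F e \<in> Y"
    using Y(1) F.hereditary_iff unfolding F_def by blast
  have "\<exists>(\<kappa> :: 'k \<Rightarrow> (('v + 'v) \<times> ('e + 'e) list \<Rightarrow> 'k) endo) q s' t'.
    leavitt_family F \<kappa> q s' t' \<and> (\<forall>u\<in>verts F. q u = 0 \<longleftrightarrow> u \<in> Y)"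
    by (rule F.branching_representation) (use her Y(2)[folded F_def] in auto)
  then obtain \<kappa> :: "'k \<Rightarrow> (('v + 'v) \<times> ('e + 'e) list \<Rightarrow> 'k) endo" and q s' t' where
    fam: "leavitt_family F \<kappa> q s' t'" and q0: "\<forall>u\<in>verts F. q u = 0 \<longleftrightarrow> u \<in> Y" by (elim exE conjE)
  interpret fq: family_of_quotient E H U \<kappa> q s' t'
    by (intro family_of_quotient.intro admissible_axioms fam[unfolded F_def])
  interpret lf: lpa_family E \<kappa> fq.p fq.s fq.t
    by (intro lpa_family.intro lpa_axioms fq.family)
  have ps: "lf.ext (partial_sum H v) = (\<Sum>e\<in>W v. fq.s e * fq.t e)" for v
    unfolding partial_sum_def lf.ext_sum W_def
    by (intro sum.cong refl) (auto simp: lf.ext_mult lf.ext_gens C_gens)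
  have br: "lf.ext (partial_sum H v) = q (Inl v)" if "v \<in> breaking_vertices E H" for v
    using ps fq.st_W W_breaking[OF that] by simp
  have ext: "lf.ext (vertex_elem H U x) = q x" if x: "x \<in> verts F" for x
  proof (cases x)
    case (Inl v)
    then have v: "v \<in> verts E" "v \<notin> H" using x by auto
    show ?thesis
    proof (cases "v \<in> B")
      case True
      then show ?thesis using Inl br by (simp add: vertex_elem_def B_def)
    next
      case False
      then show ?thesis using Inl v by (simp add: vertex_elem_def B_def[symmetric] lf.ext_gens fq.p_def)
    qed
  next
    case (Inr v)
    then have v: "v \<in> B" using x by simp
    then have "v \<in> breaking_vertices E H" by (simp add: B_def)
    then show ?thesis using Inr v br B_D[OF v]
      by (simp add: vertex_elem_def lf.ext_diff lf.ext_gens fq.p_def)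
  qed
  show ?thesis
  proof (rule that[OF lf.kernel_lid])
    show "vertex_elem H U x \<in> lf.kernel \<longleftrightarrow> x \<in> Y" if "x \<in> verts (quotient_graph E H U)" for x
      using ext[of x] q0 that unfolding F_def[symmetric] lf.kernel_def
      by (simp add: vertex_elem_C[OF adm that])
    show "pair_lid H U \<subseteq> lf.kernel"
      unfolding pair_lid_def
    proof (rule generated_least[OF lf.kernel_lid], rule subsetI)
      fix a :: "('v,'e,'k) free_elem"
      assume a: "a \<in> vx ` H \<union> (\<lambda>v. vertex_elem H U (Inr v)) ` U"
      have "a \<in> C" using pair_gens_C[OF adm] a by blast
      moreover have "lf.ext a = 0"
        using a
      proof
        assume "a \<in> vx ` H"
        then obtain v where v: "v \<in> H" "a = vx v" by blast
        then have "v \<in> verts E" "v \<notin> B" using H_verts B_D by blast+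
        then show ?thesis using v by (simp add: lf.ext_gens fq.p_def)
      next
        assume "a \<in> (\<lambda>v. vertex_elem H U (Inr v)) ` U"
        then obtain v where v: "v \<in> U" "a = vertex_elem H U (Inr v)" by blast
        then have b: "v \<in> breaking_vertices E H" using U_breaking by blast
        then have "v \<in> verts E" "v \<notin> H" using W_breaking by auto
        then show ?thesis using v br[OF b]
          by (simp add: vertex_elem_def lf.ext_diff lf.ext_gens fq.p_def B_def)
      qed
      ultimately show "a \<in> lf.kernel" by (simp add: lf.kernel_def)
    qed
  qed
qed

text \<open>
  For \<open>Y = {}\<close> the previous representation has a kernel without any vertex of the quotient graph, so
  \<open>I(H, U)\<close> determines \<open>H\<close> and \<open>U\<close>.
\<close>

lemma pair_lid_vertices:
  assumes adm: "admissible_pair E H U"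
  shows "v \<in> verts E \<Longrightarrow> vx v \<in> (pair_lid H U :: ('v,'e,'k::field) free_elem set) \<longleftrightarrow> v \<in> H"
    and "v \<in> breaking_vertices E H \<Longrightarrow>
      vertex_elem H U (Inr v) \<in> (pair_lid H U :: ('v,'e,'k) free_elem set) \<longleftrightarrow> v \<in> U"
proof -
  interpret admissible E H U by unfold_locales (rule adm)
  have her: "hereditary F {}" "saturated F {}"
    by (auto simp: hereditary_def saturated_def regular_vertex_def)
  obtain J :: "('v,'e,'k) free_elem set" where J: "lid J" "pair_lid H U \<subseteq> J"
    "\<And>x. x \<in> verts F \<Longrightarrow> vertex_elem H U x \<in> J \<longleftrightarrow> x \<in> {}"
    using ideal_with_vertices[OF adm her[unfolded F_def]] unfolding F_def by metis
  show "vx v \<in> (pair_lid H U :: ('v,'e,'k) free_elem set) \<longleftrightarrow> v \<in> H" if v: "v \<in> verts E"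
  proof
    assume "vx v \<in> (pair_lid H U :: ('v,'e,'k) free_elem set)"
    then have vJ: "vx v \<in> J" using J(2) by blast
    show "v \<in> H"
    proof (rule ccontr)
      assume "v \<notin> H"
      then have nz: "vertex_elem H U (Inl v) \<notin> J" using J(3)[of "Inl v"] v by simp
      have "vx v * partial_sum H v - partial_sum H v = (\<Sum>e | e \<in> out_arcs E v \<and> head E e \<notin> H.
          (vx v * ed e - ed e) * (gh e :: ('v,'e,'k) free_elem))"
        by (simp add: partial_sum_def sum_distrib_left sum_subtractf[symmetric] left_diff_distrib mult.assoc)
      also have "\<dots> \<in> R"
      proof (rule R_sum)
        fix e assume "e \<in> {e. e \<in> out_arcs E v \<and> head E e \<notin> H}"
        then have e: "e \<in> arcs E" "tail E e = v" by auto
        then have "vx v * ed e - ed e \<in> R" using leavitt_relators.edge_source[OF e(1)] R_relators by auto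
        then show "(vx v * ed e - ed e) * gh e \<in> R" using e C_gens by (intro R_mult)
      qed
      finally have "vx v * partial_sum H v - partial_sum H v \<in> J" by (rule lid_R[OF J(1)])
      moreover have "vx v * partial_sum H v \<in> J" using lid_mult(2)[OF J(1) vJ partial_sum_C] .
      ultimately have "partial_sum H v \<in> J" using lid_cong[OF J(1)] by blast
      then show False using nz vJ by (simp add: vertex_elem_def split: if_splits)
    qed
  qed (rule pair_lid_gens[OF adm])
  show "vertex_elem H U (Inr v) \<in> (pair_lid H U :: ('v,'e,'k) free_elem set) \<longleftrightarrow> v \<in> U"
    if v: "v \<in> breaking_vertices E H"
  proof
    assume "vertex_elem H U (Inr v) \<in> (pair_lid H U :: ('v,'e,'k) free_elem set)"
    then have "vertex_elem H U (Inr v) \<in> J" using J(2) by blast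
    then show "v \<in> U" using J(3)[of "Inr v"] v by (cases "v \<in> U") (simp_all add: B_def)
  qed (rule pair_lid_gens[OF adm])
qed

definition ideal_vertices :: "('v,'e,'k::field) free_elem set \<Rightarrow> 'v set" where
  "ideal_vertices I = {v \<in> verts E. vx v \<in> I}"

definition ideal_breaking :: "('v,'e,'k::field) free_elem set \<Rightarrow> 'v set" where
  "ideal_breaking I = {v \<in> breaking_vertices E (ideal_vertices I). vertex_elem (ideal_vertices I) {} (Inr v) \<in> I}"

lemma ideal_admissible:
  assumes "lid (I :: ('v,'e,'k::field) free_elem set)"
  shows "admissible_pair E (ideal_vertices I) (ideal_breaking I)"
proof -
  obtain \<Phi> :: "('v,'e,'k) free_elem \<Rightarrow> ('v,'e,'k) free_elem endo" where "lpa_quotient E I \<Phi>"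
    using quotient_exists[OF assms] .
  then interpret lpa_quotient E I \<Phi> .
  have eq: "ideal_vertices I = {v \<in> verts E. \<Phi> (vx v) \<in> {0}}"
    unfolding ideal_vertices_def using \<Phi>_zero_iff[OF C_hull[OF C_gens(1)]] by auto
  have "fam.gen_closed {0}" by (simp add: fam.gen_closed_def)
  from fam.vertices_of_ideal[OF this] show ?thesis
    unfolding admissible_pair_def eq[symmetric] by (auto simp: ideal_breaking_def)
qed

lemma graded_quotient_exists:
  fixes I :: "('v,'e,'k::field) free_elem set"
  assumes I: "graded_lid I" and adm: "admissible_pair E H U"
    and H: "\<And>v. v \<in> verts E \<Longrightarrow> vx v \<in> I \<longleftrightarrow> v \<in> H"
    and U: "\<And>v. v \<in> breaking_vertices E H \<Longrightarrow> vertex_elem H U (Inr v) \<in> I \<longleftrightarrow> v \<in> U"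
  obtains \<Phi> :: "('v,'e,'k) free_elem \<Rightarrow> ('v,'e,'k) free_elem endo" where "graded_quotient E I \<Phi> H U"
proof -
  have "lid I" using I by (simp add: graded_lid_def)
  from quotient_exists[OF this]
  obtain \<Phi> :: "('v,'e,'k) free_elem \<Rightarrow> ('v,'e,'k) free_elem endo" where \<Phi>: "lpa_quotient E I \<Phi>" .
  interpret admissible E H U by unfold_locales (rule adm)
  have "quotient_over_pair E I \<Phi> H U"
    unfolding quotient_over_pair_def quotient_over_pair_axioms_def
    using \<Phi> admissible_axioms I H U H_verts U_breaking by blast
  then interpret quotient_over_pair E I \<Phi> H U .
  have "graded_quotient E I \<Phi> H U"
    by unfold_locales (rule z_notin_I, use H U in auto)
  then show ?thesis by (rule that)
qed

lemma vertex_elem_Inr: "vertex_elem H U (Inr v) = vertex_elem H U' (Inr v)"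
  by (simp add: vertex_elem_def)

text \<open>
  Let \<open>I(H, U)\<close> be generated by the vertices and elements \<open>v\<^sup>H\<close> in \<open>P\<close>. If \<open>P\<close> were larger, the reduction modulo
  \<open>I(H, U)\<close> would give a polynomial in a cycle or a vertex of the quotient graph in \<open>P\<close>, and in the
  first case also a vertex since \<open>P\<close> is graded; but none of these vertices is in \<open>P\<close>.
\<close>

lemma graded_ideal_pair:
  fixes P :: "('v,'e,'k::field) free_elem set"
  assumes P: "graded_lid P"
  obtains H U where "admissible_pair E H U" "P = pair_lid H U"
proof -
  let ?H = "ideal_vertices P" and ?U = "ideal_breaking P"
  have lP: "lid P" using P by (simp add: graded_lid_def)
  have adm: "admissible_pair E ?H ?U" by (rule ideal_admissible[OF lP])
  let ?I = "pair_lid ?H ?U :: ('v,'e,'k) free_elem set"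
  have H: "vx v \<in> P \<longleftrightarrow> v \<in> ?H" if "v \<in> verts E" for v using that by (simp add: ideal_vertices_def)
  have U: "vertex_elem ?H ?U (Inr v) \<in> P \<longleftrightarrow> v \<in> ?U" if "v \<in> breaking_vertices E ?H" for v
    unfolding vertex_elem_Inr[of ?H ?U v "{}"] using that by (simp add: ideal_breaking_def)
  have IP: "?I \<subseteq> P"
    unfolding pair_lid_def
  proof (rule generated_least[OF lP])
    show "vx ` ?H \<union> (\<lambda>v. vertex_elem ?H ?U (Inr v)) ` ?U \<subseteq> P"
      unfolding vertex_elem_Inr[of ?H ?U _ "{}"] by (auto simp: ideal_vertices_def ideal_breaking_def)
  qed
  obtain \<Phi> :: "('v,'e,'k) free_elem \<Rightarrow> ('v,'e,'k) free_elem endo" where "graded_quotient E P \<Phi> ?H ?U"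
    by (rule graded_quotient_exists[OF P adm H U])
  then interpret GP: graded_quotient E P \<Phi> ?H ?U .
  obtain \<Psi> :: "('v,'e,'k) free_elem \<Rightarrow> ('v,'e,'k) free_elem endo" where "graded_quotient E ?I \<Psi> ?H ?U"
    by (rule graded_quotient_exists[OF pair_lid_graded[OF adm] adm pair_lid_vertices[OF adm]])
  then interpret GI: graded_quotient E ?I \<Psi> ?H ?U .
  have no_vertex: "GI.Q.q x \<notin> \<Psi> ` P" if "x \<in> verts GP.F" for x
    using GI.z_mem_iff[OF lP IP that] GP.z_nonzero[OF that] by simp
  have "?I = P"
  proof (rule ccontr)
    assume "?I \<noteq> P"
    then have "GI.G.vertex_or_cycle (\<Psi> ` P)" using GI.image_reduction[OF lP] IP by blast
    then show False
      unfolding GI.G.vertex_or_cycle_def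
    proof
      assume "\<exists>x\<in>verts GP.F. GI.Q.q x \<in> \<Psi> ` P"
      then show False using no_vertex by blast
    next
      assume "\<exists>v c f. GP.F.awalk v c v \<and> GP.F.cycle c \<and> \<not> has_exit GP.F c \<and> f \<noteq> 0 \<and> GI.G.ev v c f \<in> \<Psi> ` P"
      then obtain v c f where c: "GP.F.awalk v c v" "GP.F.cycle c" "\<not> has_exit GP.F c"
        "f \<noteq> 0" "GI.G.ev v c f \<in> \<Psi> ` P" by blast
      have "GI.Q.q v \<in> \<Psi> ` P"
        by (rule GI.G.graded_ev[OF GI.image_gen_closed[OF lP] GI.image_graded[OF P IP] c])
      then show False using no_vertex GP.F.awalk_hd_in_verts[OF c(1)] by blast
    qed
  qed
  then show ?thesis using that adm by blast
qed

lemma pair_quotient: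
  assumes "admissible_pair E H U"
  obtains \<Phi> :: "('v,'e,'k::field) free_elem \<Rightarrow> ('v,'e,'k) free_elem endo" where
    "graded_quotient E (pair_lid H U) \<Phi> H U"
  by (rule graded_quotient_exists[OF pair_lid_graded[OF assms] assms pair_lid_vertices[OF assms]])

text \<open>
  The intersection of the larger primes contains a vertex \<open>z\<close> of the quotient graph. If a non-empty
  hereditary saturated set \<open>Y\<close> did not contain \<open>z\<close>, there would be a larger prime that contains \<open>Y\<close> but
  not \<open>z\<close>.
\<close>

lemma locally_closed_strong_CSP:
  fixes P :: "('v,'e,'k::field) free_elem set"
  assumes adm: "admissible_pair E H U" and P: "P = pair_lid H U" "lprime P"
    and a: "a \<in> C" "a \<notin> P" and all: "\<And>Q. lprime Q \<Longrightarrow> P \<subset> Q \<Longrightarrow> a \<in> Q"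
    and L: "condition_L (quotient_graph E H U)"
  shows "strong_CSP (quotient_graph E H U)"
proof -
  obtain \<Phi> :: "('v,'e,'k) free_elem \<Rightarrow> ('v,'e,'k) free_elem endo" where "graded_quotient E P \<Phi> H U"
    using pair_quotient[OF adm] P(1) by metis
  then interpret graded_quotient E P \<Phi> H U .
  define J0 where "J0 = C \<inter> \<Inter> {Q. lprime Q \<and> P \<subset> Q}"
  have J0: "lid J0" unfolding J0_def by (rule lid_Inter) (auto dest: lprimeD_lid)
  have "a \<in> J0" using a all by (auto simp: J0_def)
  moreover have "P \<subseteq> J0" using lid_sub[OF I_lid] by (auto simp: J0_def)
  ultimately have PJ: "P \<subset> J0" using a by blast
  obtain x where x: "x \<in> verts F" "Q.q x \<in> \<Phi> ` J0"
    using image_reduction[OF J0 PJ] L[folded F_def] unfolding G.vertex_or_cycle_def condition_L_def by blast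
  then have xJ: "z x \<in> J0" using z_mem_iff[OF J0 \<open>P \<subseteq> J0\<close>] by blast
  have "x \<in> Y" if Y: "Y \<noteq> {}" "hereditary F Y" "saturated F Y" for Y
  proof (rule ccontr)
    assume "x \<notin> Y"
    obtain J :: "('v,'e,'k) free_elem set" where J: "lid J" "pair_lid H U \<subseteq> J"
      "\<And>x. x \<in> verts F \<Longrightarrow> z x \<in> J \<longleftrightarrow> x \<in> Y"
      using ideal_with_vertices[OF adm Y(2,3)[unfolded F_def]] unfolding F_def by metis
    have PJ': "P \<subseteq> J" using J(2) P(1) by simp
    have "z x \<notin> J" using J(3) x(1) \<open>x \<notin> Y\<close> by blast
    moreover have "z x * z x - z x \<in> J"
    proof -
      have "\<Phi> (z x * z x) = \<Phi> (z x)"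
        using z_C[OF x(1)] G.p_idem[OF x(1)] by (simp add: \<Phi>_C_mult \<Phi>_z del: Q.q.simps)
      then show ?thesis using \<Phi>_eq_iff[OF C_mult[OF z_C[OF x(1)] z_C[OF x(1)]] z_C[OF x(1)]] PJ' by blast
    qed
    ultimately obtain Q where Q: "lprime Q" "J \<subseteq> Q" "z x \<notin> Q"
      using prime_avoiding_idempotent[OF J(1) z_C[OF x(1)]] by blast
    obtain y where y: "y \<in> Y" using Y(1) by blast
    then have yF: "y \<in> verts F" using Y(2) by (auto simp: hereditary_def)
    have "z y \<in> Q" "z y \<notin> P" using y yF J(3) Q(2) z_nonzero by blast+
    then have "P \<subset> Q" using PJ' Q(2) by blast
    then have "J0 \<subseteq> Q" using Q(1) by (auto simp: J0_def)
    then show False using xJ Q(3) by blast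
  qed
  then show ?thesis using F.strong_CSP_if_least_vertex[OF x(1)] unfolding F_def by blast
qed

section \<open>Equivalence of the four properties\<close>

text \<open>
  A graded prime is its own graded part, hence equal to \<open>I(H, U)\<close> for the given pair; for a non-graded
  prime the pair of its graded part is used.
\<close>

lemma strongly_primitive_completely_irreducible:
  fixes P :: "('v,'e,'k::field) free_elem set"
  assumes P: "lprime P" and sp: "strongly_primitive E (cls ` P)"
  shows "\<exists>a\<in>C. a \<notin> P \<and> (\<forall>J. lid J \<and> P \<subset> J \<longrightarrow> a \<in> J)"
proof (cases "graded_lid P")
  case False
  note lP = lprimeD_lid[OF P]
  obtain H U where HU: "admissible_pair E H U" "gr P = pair_lid H U"
    using graded_ideal_pair[OF gr_graded_lid[OF lP]] .
  obtain \<Phi> :: "('v,'e,'k) free_elem \<Rightarrow> ('v,'e,'k) free_elem endo" where "graded_quotient E (gr P) \<Phi> H U"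
    using pair_quotient[OF HU(1)] HU(2) by metis
  then interpret graded_quotient E "gr P" \<Phi> H U .
  show ?thesis
    using nongraded_prime_completely_irreducible[OF P refl] False gr_eq_iff[OF lP] by blast
next
  case True
  note lP = lprimeD_lid[OF P]
  have "graded_ideal E (cls ` P)" using graded_ideal_iff[OF lP] True by simp
  then obtain H U where HU: "admissible_pair E H U" "graded_part E (cls ` P) = pair_ideal E H U"
    "downward_directed (quotient_graph E H U)" "condition_L (quotient_graph E H U)" "strong_CSP (quotient_graph E H U)"
    using sp unfolding strongly_primitive_def by blast
  have "gr P = P" using gr_eq_iff[OF lP] True by simp
  then have "cls ` P = cls ` pair_lid H U"
    using HU(2) graded_part_eq[OF lP] pair_ideal_eq[OF HU(1), where 'k = 'k] by simp
  then have eq: "P = pair_lid H U" using cls_image_eq_iff[OF lP pair_lid_lid] by simp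
  obtain \<Phi> :: "('v,'e,'k) free_elem \<Rightarrow> ('v,'e,'k) free_elem endo" where "graded_quotient E P \<Phi> H U"
    using pair_quotient[OF HU(1)] eq by metis
  then interpret graded_quotient E P \<Phi> H U .
  have "verts F \<noteq> {}" using HU(3) unfolding F_def downward_directed_def downward_directed_set_def by blast
  then show ?thesis using graded_completely_irreducible HU(4,5) unfolding F_def by blast
qed

lemma locally_closed_strongly_primitive:
  fixes P :: "('v,'e,'k::field) free_elem set"
  assumes P: "lprime P" and a: "a \<in> C" "a \<notin> P" "\<And>Q. lprime Q \<Longrightarrow> P \<subset> Q \<Longrightarrow> a \<in> Q"
  shows "strongly_primitive E (cls ` P)"
proof (cases "graded_lid P")
  case False
  then show ?thesis
    using P prime_ideal_iff graded_ideal_iff[OF lprimeD_lid[OF P]] unfolding strongly_primitive_def by blast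
next
  case True
  note lP = lprimeD_lid[OF P]
  obtain H U where HU: "admissible_pair E H U" "P = pair_lid H U" using graded_ideal_pair[OF True] .
  obtain \<Phi> :: "('v,'e,'k) free_elem \<Rightarrow> ('v,'e,'k) free_elem endo" where "graded_quotient E P \<Phi> H U"
    using pair_quotient[OF HU(1)] HU(2) by metis
  then interpret graded_quotient E P \<Phi> H U .
  have dd: "downward_directed (quotient_graph E H U)" using prime_downward_directed[OF P] by (simp add: F_def)
  have L: "condition_L (quotient_graph E H U)" using locally_closed_condition_L[OF P a] by (simp add: F_def)
  have CSP: "strong_CSP (quotient_graph E H U)" using locally_closed_strong_CSP[OF HU P a L] .
  have "gr P = P" using gr_eq_iff[OF lP] True by simp
  then have "graded_part E (cls ` P) = pair_ideal E H U"
    using graded_part_eq[OF lP] pair_ideal_eq[OF HU(1), where 'k = 'k] HU(2) by simp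
  moreover have "two_sided_ideal (cls ` P) L" using lP tsi_L_iff by blast
  ultimately show ?thesis using HU(1) dd L CSP unfolding strongly_primitive_def by blast
qed

end

theorem theorem3p9:
  fixes E :: "('v,'e) pre_digraph"
    and P :: "('v,'e,'k::field) lpa_elem set"
  assumes "wf_digraph E"
    and "prime_ideal P (leavitt_path_algebra E)"
  shows "(locally_closed P (leavitt_path_algebra E)
            \<longleftrightarrow> completely_irreducible P (leavitt_path_algebra E)) \<and>
         (completely_irreducible P (leavitt_path_algebra E)
            \<longleftrightarrow> (\<exists>a \<in> carrier (leavitt_path_algebra E).
                   maximal_not_containing P a (leavitt_path_algebra E))) \<and>
         ((\<exists>a \<in> carrier (leavitt_path_algebra E).
                   maximal_not_containing P a (leavitt_path_algebra E))
            \<longleftrightarrow> strongly_primitive E P)"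
proof -
  interpret lpa E by (intro lpa.intro assms(1))
  obtain P' where P': "lprime P'" "P = cls ` P'" using assms(2) unfolding prime_ideal_iff by (elim exE conjE)
  note lP = lprimeD_lid[OF P'(1)]
  let ?ci = "\<exists>a\<in>C. a \<notin> P' \<and> (\<forall>J. lid J \<and> P' \<subset> J \<longrightarrow> a \<in> J)"
  have b: "completely_irreducible P L \<longleftrightarrow> ?ci"
    unfolding P'(2) by (rule completely_irreducible_iff[OF lP])
  have c: "(\<exists>a \<in> carrier L. maximal_not_containing P a L) \<longleftrightarrow> ?ci"
    unfolding P'(2) L_carrier by (simp add: maximal_not_containing_iff[OF lP])
  have a: "locally_closed P L \<longleftrightarrow> (\<exists>a\<in>C. a \<notin> P' \<and> (\<forall>Q. lprime Q \<and> P' \<subset> Q \<longrightarrow> a \<in> Q))"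
    unfolding P'(2) by (rule locally_closed_iff[OF lP])
  have ba: "?ci \<Longrightarrow> locally_closed P L"
    unfolding a using lprimeD_lid by blast
  have ad: "locally_closed P L \<Longrightarrow> strongly_primitive E P"
    unfolding a using locally_closed_strongly_primitive[OF P'(1)] P'(2) by blast
  have db: "strongly_primitive E P \<Longrightarrow> ?ci"
    using strongly_primitive_completely_irreducible[OF P'(1)] P'(2) by simp
  show ?thesis using b c ba ad db by blast
qed

end
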